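(* Let $f\colon(\mathbb C^n,0)\to(\mathbb C^p,0)$ be a germ of reflection map. (a) If $\operatorname{corank} f\ge 2$, then $f$ is not stable. (b) If $f$ is essential, $\operatorname{corank} f=1$ and $f$ is stable, then $f$ is (up to $\mathcal A$-equivalence) a fold map.
   Context: Let $V$ be a $p$-dimensional complex vector space with a fixed positive definite hermitian form. A reflection on $V$ is a unitary linear map $r\colon V\to V$ of finite order whose fixed space has dimension $\dim V-1$ (its reflecting hyperplane). A reflection group is a finite subgroup $G\le \mathrm U(V)$ generated by reflections. The rank of $G$ is the dimension of the span of the orthogonal complements of the reflecting hyperplanes of all reflections in $G$. By Shephard--Todd, $\mathbb C[V]^G$ is generated by $p$ homogeneous algebraically independent polynomials $\omega_1,\dots,\omega_p$; the orbit map of $G$ is $\omega=(\omega_1,\dots,\omega_p)\colon V\to\mathbb C^p$. A germ of reflection map is a germ $f=\omega\circ h\colon(\mathbb C^n,0)\to(\mathbb C^p,0)$, where $h\colon(\mathbb C^n,0)\to(V,0)$ is a germ of embedding and $\omega$ is the orbit map of a reflection group $G$ on $V$. The corank of $f$ is $\dim_{\mathbb C}\ker df_0$. The germ $f$ is essential if $\operatorname{corank} f=\operatorname{rank} G$. A fold map is a germ $(\mathbb C^n,0)\to(\mathbb C^p,0)$ of the form $x\mapsto(x_1,\dots,x_{n-1},x_n^2,H(x))$ for some $H\colon(\mathbb C^n,0)\to(\mathbb C^{p-n},0)$. Two (multi-)germs $f,f'$ are $\mathcal A$-equivalent if $f'=\psi\circ f\circ\phi$ for germs of biholomorphisms $\phi,\psi$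 of source and target. An unfolding of a (multi-)germ $f\colon(\mathbb C^n,S)\to(\mathbb C^p,0)$ is a (multi-)germ $F(t,x)=(t,f_t(x))\colon(\mathbb C^{r}\times\mathbb C^n,\{0\}\times S)\to(\mathbb C^{r}\times\mathbb C^p,0)$ with $f_0=f$. It is trivial if it is $\mathcal A$-equivalent to $\mathrm{id}_{\mathbb C^r}\times f$ via biholomorphisms that are themselves unfoldings of the identities of $\mathbb C^n$ and $\mathbb C^p$. A (multi-)germ is stable if each of its unfoldings is trivial. *)

theory Defs
  imports
    "HOL-Analysis.Analysis"
    "HOL-Library.Function_Algebras"
    "HOL-Library.Poly_Mapping"
    "HOL-Algebra.Bij"
    "HOL-Algebra.Generated_Groups"
begin

section \<open>Complex number space of a given dimension\<close>

text \<open>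
  The number r of unfolding parameters is quantified inside the notion of stability, so
  dimensions have to be numbers rather than index types.  The n-dimensional complex number
  space is the set of sequences vanishing from index n on; its coordinates are
  \<open>x 0, \<dots>, x (n - 1)\<close>.  The product topology of \<open>nat \<Rightarrow> complex\<close> induces the usual
  topology on it.
\<close>

type_synonym cvec = "nat \<Rightarrow> complex"

definition Cn :: "nat \<Rightarrow> cvec set" where
  "Cn n = {x. \<forall>i\<ge>n. x i = 0}"

definition cscale :: "complex \<Rightarrow> cvec \<Rightarrow> cvec" where
  "cscale c x = (\<lambda>i. c * x i)"

interpretation cvs: vector_space cscale
  by unfold_locales (auto simp: cscale_def fun_eq_iff algebra_simps)

text \<open>
  The product of an r-dimensional and an n-dimensional space is identified with the
  (r + n)-dimensional one by concatenating coordinates.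
\<close>

definition join :: "nat \<Rightarrow> cvec \<Rightarrow> cvec \<Rightarrow> cvec" where
  "join r t x = (\<lambda>i. if i < r then t i else x (i - r))"


section \<open>Germs of holomorphic maps\<close>

definition pderiv_at :: "nat \<Rightarrow> (cvec \<Rightarrow> complex) \<Rightarrow> cvec \<Rightarrow> complex" where
  "pderiv_at i g a = deriv (\<lambda>z. g (a(i := z))) (a i)"

text \<open>
  For a relatively open subset U of \<open>Cn n\<close>: continuous, and holomorphic in each
  variable separately.
\<close>

definition hol_fun :: "nat \<Rightarrow> cvec set \<Rightarrow> (cvec \<Rightarrow> complex) \<Rightarrow> bool" where
  "hol_fun n U g \<longleftrightarrow> continuous_on U g \<and>
     (\<forall>a\<in>U. \<forall>i<n. (\<lambda>z. g (a(i := z))) field_differentiable at (a i))"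

definition hol_map :: "nat \<Rightarrow> nat \<Rightarrow> cvec set \<Rightarrow> (cvec \<Rightarrow> cvec) \<Rightarrow> bool" where
  "hol_map n p U f \<longleftrightarrow> f ` U \<subseteq> Cn p \<and> (\<forall>j<p. hol_fun n U (\<lambda>x. f x j))"

definition differential :: "nat \<Rightarrow> nat \<Rightarrow> (cvec \<Rightarrow> cvec) \<Rightarrow> cvec \<Rightarrow> cvec \<Rightarrow> cvec" where
  "differential n p f a v =
     (\<lambda>j. if j < p then \<Sum>i<n. pderiv_at i (\<lambda>x. f x j) a * v i else 0)"

text \<open>
  Germs at the origin are represented by total functions, of which only the values at points
  of \<open>Cn n\<close> near 0 matter.
\<close>

definition hol_germ :: "nat \<Rightarrow> nat \<Rightarrow> (cvec \<Rightarrow> cvec) \<Rightarrow> bool" where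
  "hol_germ n p f \<longleftrightarrow> (\<exists>U. open U \<and> 0 \<in> U \<and> hol_map n p (U \<inter> Cn n) f) \<and> f 0 = 0"

definition germ_eq :: "nat \<Rightarrow> (cvec \<Rightarrow> cvec) \<Rightarrow> (cvec \<Rightarrow> cvec) \<Rightarrow> bool" where
  "germ_eq n f g \<longleftrightarrow> (\<forall>\<^sub>F x in nhds 0. x \<in> Cn n \<longrightarrow> f x = g x)"

definition biholo_germ :: "nat \<Rightarrow> (cvec \<Rightarrow> cvec) \<Rightarrow> bool" where
  "biholo_germ n \<phi> \<longleftrightarrow> hol_germ n n \<phi> \<and>
     (\<exists>\<phi>'. hol_germ n n \<phi>' \<and> germ_eq n (\<phi>' \<circ> \<phi>) id \<and> germ_eq n (\<phi> \<circ> \<phi>') id)"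

definition embedding_germ :: "nat \<Rightarrow> nat \<Rightarrow> (cvec \<Rightarrow> cvec) \<Rightarrow> bool" where
  "embedding_germ n p h \<longleftrightarrow> h 0 = 0 \<and>
     (\<exists>U. open U \<and> 0 \<in> U \<and> hol_map n p (U \<inter> Cn n) h \<and>
        (\<forall>a \<in> U \<inter> Cn n. inj_on (differential n p h a) (Cn n)) \<and>
        (\<exists>k. homeomorphism (U \<inter> Cn n) (h ` (U \<inter> Cn n)) h k))"

definition corank :: "nat \<Rightarrow> nat \<Rightarrow> (cvec \<Rightarrow> cvec) \<Rightarrow> nat" where
  "corank n p f = cvs.dim {v \<in> Cn n. differential n p f 0 v = 0}"


section \<open>Equivalence, unfoldings and stability\<close>

definition A_equiv_via ::
  "nat \<Rightarrow> (cvec \<Rightarrow> cvec) \<Rightarrow> (cvec \<Rightarrow> cvec) \<Rightarrow> (cvec \<Rightarrow> cvec) \<Rightarrow> (cvec \<Rightarrow> cvec) \<Rightarrow> bool" where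
  "A_equiv_via n \<phi> \<psi> f f' \<longleftrightarrow> germ_eq n f' (\<psi> \<circ> f \<circ> \<phi>)"

definition A_equiv :: "nat \<Rightarrow> nat \<Rightarrow> (cvec \<Rightarrow> cvec) \<Rightarrow> (cvec \<Rightarrow> cvec) \<Rightarrow> bool" where
  "A_equiv n p f f' \<longleftrightarrow>
     (\<exists>\<phi> \<psi>. biholo_germ n \<phi> \<and> biholo_germ p \<psi> \<and> A_equiv_via n \<phi> \<psi> f f')"

definition unfolding_of ::
  "nat \<Rightarrow> nat \<Rightarrow> nat \<Rightarrow> (cvec \<Rightarrow> cvec) \<Rightarrow> (cvec \<Rightarrow> cvec) \<Rightarrow> bool" where
  "unfolding_of r n p f F \<longleftrightarrow> hol_germ (r + n) (r + p) F \<and>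
     (\<exists>ft :: cvec \<Rightarrow> cvec \<Rightarrow> cvec. germ_eq n (ft 0) f \<and>
        (\<forall>\<^sub>F (t, x) in nhds (0, 0).
           t \<in> Cn r \<longrightarrow> x \<in> Cn n \<longrightarrow> F (join r t x) = join r t (ft t x)))"

text \<open>The product of the identity of the parameter space with f, in joined coordinates.\<close>

definition id_times :: "nat \<Rightarrow> (cvec \<Rightarrow> cvec) \<Rightarrow> cvec \<Rightarrow> cvec" where
  "id_times r f y = join r y (f (\<lambda>i. y (i + r)))"

definition trivial_unfolding ::
  "nat \<Rightarrow> nat \<Rightarrow> nat \<Rightarrow> (cvec \<Rightarrow> cvec) \<Rightarrow> (cvec \<Rightarrow> cvec) \<Rightarrow> bool" where
  "trivial_unfolding r n p f F \<longleftrightarrow>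
     (\<exists>\<Phi> \<Psi>. biholo_germ (r + n) \<Phi> \<and> unfolding_of r n n id \<Phi> \<and>
            biholo_germ (r + p) \<Psi> \<and> unfolding_of r p p id \<Psi> \<and>
            A_equiv_via (r + n) \<Phi> \<Psi> (id_times r f) F)"

definition stable_germ :: "nat \<Rightarrow> nat \<Rightarrow> (cvec \<Rightarrow> cvec) \<Rightarrow> bool" where
  "stable_germ n p f \<longleftrightarrow> (\<forall>r F. unfolding_of r n p f F \<longrightarrow> trivial_unfolding r n p f F)"

definition fold_map :: "nat \<Rightarrow> nat \<Rightarrow> (cvec \<Rightarrow> cvec) \<Rightarrow> bool" where
  "fold_map n p f \<longleftrightarrow> 1 \<le> n \<and> n \<le> p \<and>
     (\<exists>H. hol_germ n (p - n) H \<and>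
        germ_eq n f (\<lambda>x i. if i < n - 1 then x i
                           else if i = n - 1 then (x (n - 1))\<^sup>2
                           else H x (i - n)))"


section \<open>Reflection groups\<close>

text \<open>
  The hermitian space V is \<open>Cn p\<close> (that is, V in the coordinates of some basis) with an
  arbitrary positive definite hermitian form B.
\<close>

definition hermitian_form :: "nat \<Rightarrow> (cvec \<Rightarrow> cvec \<Rightarrow> complex) \<Rightarrow> bool" where
  "hermitian_form p B \<longleftrightarrow>
     (\<forall>x\<in>Cn p. \<forall>y\<in>Cn p. \<forall>z\<in>Cn p. B (x + y) z = B x z + B y z) \<and>
     (\<forall>c. \<forall>x\<in>Cn p. \<forall>y\<in>Cn p. B (cscale c x) y = c * B x y) \<and>
     (\<forall>x\<in>Cn p. \<forall>y\<in>Cn p. B y x = cnj (B x y))"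

definition pos_def_form :: "nat \<Rightarrow> (cvec \<Rightarrow> cvec \<Rightarrow> complex) \<Rightarrow> bool" where
  "pos_def_form p B \<longleftrightarrow> hermitian_form p B \<and> (\<forall>x\<in>Cn p. x \<noteq> 0 \<longrightarrow> Re (B x x) > 0)"

text \<open>Elements are extensional functions on V, as in \<^const>\<open>BijGroup\<close>.\<close>

definition unitary_group :: "nat \<Rightarrow> (cvec \<Rightarrow> cvec \<Rightarrow> complex) \<Rightarrow> (cvec \<Rightarrow> cvec) monoid" where
  "unitary_group p B = BijGroup (Cn p) \<lparr>carrier :=
     {g \<in> Bij (Cn p).
        (\<forall>x\<in>Cn p. \<forall>y\<in>Cn p. g (x + y) = g x + g y) \<and>
        (\<forall>c. \<forall>x\<in>Cn p. g (cscale c x) = cscale c (g x)) \<and>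
        (\<forall>x\<in>Cn p. \<forall>y\<in>Cn p. B (g x) (g y) = B x y)}\<rparr>"

definition fixed_space :: "nat \<Rightarrow> (cvec \<Rightarrow> cvec) \<Rightarrow> cvec set" where
  "fixed_space p g = {x \<in> Cn p. g x = x}"

definition reflection :: "nat \<Rightarrow> (cvec \<Rightarrow> cvec \<Rightarrow> complex) \<Rightarrow> (cvec \<Rightarrow> cvec) \<Rightarrow> bool" where
  "reflection p B s \<longleftrightarrow> s \<in> carrier (unitary_group p B) \<and>
     (\<exists>k>0::nat. s [^]\<^bsub>unitary_group p B\<^esub> k = \<one>\<^bsub>unitary_group p B\<^esub>) \<and>
     cvs.dim (fixed_space p s) + 1 = p"

definition reflection_group ::
  "nat \<Rightarrow> (cvec \<Rightarrow> cvec \<Rightarrow> complex) \<Rightarrow> (cvec \<Rightarrow> cvec) set \<Rightarrow> bool" where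
  "reflection_group p B G \<longleftrightarrow> subgroup G (unitary_group p B) \<and> finite G \<and>
     (\<exists>S. S \<subseteq> {s. reflection p B s} \<and> G = generate (unitary_group p B) S)"

definition orth_compl ::
  "nat \<Rightarrow> (cvec \<Rightarrow> cvec \<Rightarrow> complex) \<Rightarrow> cvec set \<Rightarrow> cvec set" where
  "orth_compl p B W = {v \<in> Cn p. \<forall>w\<in>W. B v w = 0}"

definition refl_rank ::
  "nat \<Rightarrow> (cvec \<Rightarrow> cvec \<Rightarrow> complex) \<Rightarrow> (cvec \<Rightarrow> cvec) set \<Rightarrow> nat" where
  "refl_rank p B G =
     cvs.dim (cvs.span (\<Union>s\<in>{s \<in> G. reflection p B s}. orth_compl p B (fixed_space p s)))"


section \<open>Invariant polynomials and orbit maps\<close>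

text \<open>
  Polynomials are finitely supported families of coefficients indexed by exponent vectors.
\<close>

type_synonym cpoly = "(nat \<Rightarrow>\<^sub>0 nat) \<Rightarrow>\<^sub>0 complex"

definition polys_in :: "nat \<Rightarrow> cpoly set" where
  "polys_in p = {P. \<forall>m \<in> Poly_Mapping.keys P. Poly_Mapping.keys m \<subseteq> {..<p}}"

definition peval :: "cpoly \<Rightarrow> cvec \<Rightarrow> complex" where
  "peval P x = (\<Sum>m\<in>Poly_Mapping.keys P. Poly_Mapping.lookup P m *
                  (\<Prod>i\<in>Poly_Mapping.keys m. x i ^ Poly_Mapping.lookup m i))"

definition homogeneous_poly :: "cpoly \<Rightarrow> bool" where
  "homogeneous_poly P \<longleftrightarrow>
     (\<exists>d. \<forall>m\<in>Poly_Mapping.keys P. (\<Sum>i\<in>Poly_Mapping.keys m. Poly_Mapping.lookup m i) = d)"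

definition invariant_polys :: "nat \<Rightarrow> (cvec \<Rightarrow> cvec) set \<Rightarrow> cpoly set" where
  "invariant_polys p G = {P \<in> polys_in p. \<forall>g\<in>G. \<forall>x\<in>Cn p. peval P (g x) = peval P x}"

text \<open>
  The polynomials \<open>w 0, \<dots>, w (p - 1)\<close> are the basic invariants.  Since the
  coefficient field is infinite, polynomial identities are expressed through values on V.
\<close>

definition orbit_map :: "nat \<Rightarrow> (cvec \<Rightarrow> cvec) set \<Rightarrow> (cvec \<Rightarrow> cvec) \<Rightarrow> bool" where
  "orbit_map p G \<omega> \<longleftrightarrow> (\<exists>w :: nat \<Rightarrow> cpoly.
     (\<forall>x\<in>Cn p. \<omega> x = (\<lambda>j. if j < p then peval (w j) x else 0)) \<and>
     (\<forall>j<p. w j \<in> invariant_polys p G \<and> homogeneous_poly (w j)) \<and>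
     (\<forall>Q \<in> polys_in p. (\<forall>x\<in>Cn p. peval Q (\<omega> x) = 0) \<longrightarrow> Q = 0) \<and>
     (\<forall>P \<in> invariant_polys p G. \<exists>Q \<in> polys_in p. \<forall>x\<in>Cn p. peval P x = peval Q (\<omega> x)))"


section \<open>Reflection maps\<close>

definition reflection_map_germ ::
  "nat \<Rightarrow> nat \<Rightarrow> (cvec \<Rightarrow> cvec \<Rightarrow> complex) \<Rightarrow> (cvec \<Rightarrow> cvec) set \<Rightarrow> (cvec \<Rightarrow> cvec) \<Rightarrow> bool"
  where
  "reflection_map_germ n p B G f \<longleftrightarrow>
     pos_def_form p B \<and> reflection_group p B G \<and>
     (\<exists>\<omega> h. orbit_map p G \<omega> \<and> embedding_germ n p h \<and> germ_eq n f (\<omega> \<circ> h))"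

definition essential ::
  "nat \<Rightarrow> nat \<Rightarrow> (cvec \<Rightarrow> cvec \<Rightarrow> complex) \<Rightarrow> (cvec \<Rightarrow> cvec) set \<Rightarrow> (cvec \<Rightarrow> cvec) \<Rightarrow> bool"
  where
  "essential n p B G f \<longleftrightarrow> corank n p f = refl_rank p B G"

end

theory Submission
  imports Defs "HOL-Complex_Analysis.Complex_Analysis"
begin

text \<open>
  Let \<open>f = \<omega> \<circ> h\<close> be a reflection map, \<open>T\<close> the differential of \<open>h\<close> at 0 and \<open>W\<close> the kernel of
  the differential of \<open>\<omega>\<close> at 0.  The kernel of the differential of \<open>f\<close> is \<open>K = {w. T w \<in> W}\<close>.
  Stability is used to second order only.  If the linear unfolding \<open>(t, x) \<mapsto> (t, f x + t A x)\<close> is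
  trivial, then comparing the coefficients of \<open>t w\<close> on both sides produces a vector \<open>v\<close>, the
  velocity with which the trivialisation moves the origin, such that for every \<open>w \<in> K\<close> and every
  component \<open>f\<^sub>j\<close> with vanishing differential, \<open>A w\<close> has j-th component \<open>D\<^sup>2 f\<^sub>j (v, w)\<close>
  (\<open>stable_second_order\<close>).  This is transversality to the corank strata.  The components in question
  come from the basic invariants of degree at least 2, and there \<open>D\<^sup>2 f\<^sub>j (v, w) = b\<^sub>j (T v, T w)\<close> for the
  Hessian form \<open>b\<^sub>j\<close> of \<open>\<omega>\<^sub>j\<close> at 0 (\<open>stable_sform\<close>).

  Invariance restricts these forms.  If \<open>u\<close> is fixed by the group, then \<open>b\<^sub>j (u, -)\<close> is an invariant
  linear form, hence a polynomial in \<open>\<omega>\<close>, and so it vanishes on \<open>W\<close> by the chain rule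
  (\<open>invariant_form_vanishes\<close>, \<open>sform_avg_kernel\<close>).  Therefore \<open>b\<^sub>j (x, -)\<close>, restricted to \<open>W\<close>, depends
  on \<open>x\<close> only modulo the fixed space, whose codimension is the number r of nonlinear basic
  invariants.  If \<open>K\<close> contained two independent directions \<open>w\<^sub>1, w\<^sub>2\<close>, stability would make
  \<open>x \<mapsto> (b\<^sub>j (x, T w\<^sub>1), b\<^sub>j (x, T w\<^sub>2))\<^sub>j\<close> a surjection from a space of dimension at most r onto one of
  dimension 2r, while r is positive because \<open>W \<noteq> 0\<close>.  This proves the first claim
  (\<open>two_kernel_directions_unstable\<close>).

  In the second claim the group has rank one, so it fixes a hyperplane pointwise
  (\<open>rank_one_fixes_hyperplane\<close>), \<open>W\<close> is a complementary line and there is exactly one nonlinear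
  invariant.  Stability forces it to be quadratic and nonzero on \<open>W\<close>; in linear coordinates
  \<open>(y, z)\<close> adapted to the hyperplane and the line, \<open>\<omega> = (y, \<kappa> z\<^sup>2 + \<rho> y)\<close> with \<open>\<kappa> \<noteq> 0\<close>.  As \<open>h\<close> is an
  immersion whose image is tangent to \<open>W\<close>, some n of the coordinates of \<open>h\<close>, one of them \<open>z\<close>, are
  coordinates of the source, and a change of target coordinates that removes \<open>\<rho>\<close> leaves a fold map
  (\<open>stable_rank_one_fold\<close>).

  The analysis rests on two facts about functions that are continuous and holomorphic in each
  variable: their partial derivatives are again such functions, and they satisfy the chain rule
  along holomorphic curves.  Second derivatives are then computed along curves in one complex
  variable, and the inverse function theorem follows by Picard iteration.
\<close>

section \<open>Polydiscs\<close>

text \<open>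
  Relative to \<open>Cn n\<close> the polydiscs form a neighbourhood basis of 0, so germs can be handled on
  polydiscs, which are closed under changing a coordinate and under convex combinations.
\<close>

definition cube :: "nat \<Rightarrow> real \<Rightarrow> cvec set" where
  "cube n e = {x \<in> Cn n. \<forall>i<n. cmod (x i) < e}"

lemma cube_Cn: "x \<in> cube n e \<Longrightarrow> x \<in> Cn n"
  by (simp add: cube_def)

lemma cube_less: "x \<in> cube n e \<Longrightarrow> i < n \<Longrightarrow> cmod (x i) < e"
  by (simp add: cube_def)

lemma cube_mono: "d \<le> e \<Longrightarrow> cube n d \<subseteq> cube n e"
  by (force simp: cube_def)

lemma zero_in_cube [simp]: "0 < e \<Longrightarrow> 0 \<in> cube n e"
  by (simp add: cube_def Cn_def)

lemma const_zero_in_cube [simp]: "0 < e \<Longrightarrow> (\<lambda>_. 0) \<in> cube n e"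
  by (simp add: cube_def Cn_def)

lemma cube_upd: "x \<in> cube n e \<Longrightarrow> i < n \<Longrightarrow> cmod z < e \<Longrightarrow> x(i := z) \<in> cube n e"
  by (auto simp: cube_def Cn_def)

lemma continuous_on_coord: "continuous_on S (\<lambda>x::cvec. x i)"
  by (rule continuous_on_subset[OF continuous_on_product_coordinates]) simp

lemma continuous_on_cvecI:
  fixes F :: "'a::topological_space \<Rightarrow> cvec"
  assumes "\<And>i. continuous_on S (\<lambda>x. F x i)"
  shows "continuous_on S F"
  using assms by (simp add: continuous_on_coordinatewise_then_product)

lemma continuous_on_fst_coord: "continuous_on S (\<lambda>p::cvec \<times> 'a::topological_space. fst p i)"
  by (rule continuous_on_compose2[OF continuous_on_coord[of UNIV]])
    (auto intro: continuous_on_fst continuous_on_id)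

lemma continuous_on_cvec_upd:
  fixes F :: "'a::topological_space \<Rightarrow> cvec"
  assumes F: "continuous_on S F" and c: "continuous_on S c"
  shows "continuous_on S (\<lambda>p. (F p)(i := c p))"
proof (rule continuous_on_cvecI)
  fix j
  have "continuous_on S (\<lambda>p. F p j)"
    by (rule continuous_on_compose2[OF continuous_on_coord[of UNIV] F]) auto
  then show "continuous_on S (\<lambda>p. ((F p)(i := c p)) j)"
    by (cases "j = i") (simp_all add: c)
qed

lemma open_coord_less: "open {x::cvec. cmod (x i) < e}"
  by (intro open_Collect_less continuous_intros continuous_on_coord)

lemma cube_eq_open_Int: "\<exists>U. open U \<and> cube n e = U \<inter> Cn n"
proof (intro exI conjI)
  show "open (\<Inter>i\<in>{..<n}. {x::cvec. cmod (x i) < e})"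
    by (intro open_INT) (auto simp: open_coord_less)
  show "cube n e = (\<Inter>i\<in>{..<n}. {x::cvec. cmod (x i) < e}) \<inter> Cn n"
    by (auto simp: cube_def)
qed

text \<open>
  Only finitely many coordinates of a point of \<open>Cn n\<close> can differ from 0; hence a basic open set of
  the product topology contains a polydisc although it restricts arbitrary coordinates.
\<close>

lemma cube_subset_open:
  assumes "open U" "(0::cvec) \<in> U"
  shows "\<exists>e>0. cube n e \<subseteq> U"
proof -
  have *: "openin (product_topology (\<lambda>i. euclidean) UNIV) U"
    using open_fun_def assms by auto
  obtain X where H: "Pi\<^sub>E UNIV X \<subseteq> U" "\<And>i. openin euclidean (X i)"
      "(0::cvec) \<in> Pi\<^sub>E UNIV X"
    using product_topology_open_contains_basis[OF * \<open>0 \<in> U\<close>] by auto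
  have "\<exists>d>0. ball 0 d \<subseteq> X i" for i
  proof -
    have "0 \<in> X i" using H(3) by (auto simp: PiE_iff)
    then show ?thesis using H(2)[of i] open_openin open_contains_ball by blast
  qed
  then obtain d where d: "\<And>i. d i > 0" "\<And>i. ball 0 (d i) \<subseteq> X i" by metis
  define e where "e = Min (insert 1 (d ` {..<n}))"
  have e: "e > 0" "\<And>i. i < n \<Longrightarrow> e \<le> d i"
    using d(1) by (auto simp: e_def)
  have "cube n e \<subseteq> U"
  proof
    fix x assume x: "x \<in> cube n e"
    have "x i \<in> X i" for i
    proof (cases "i < n")
      case True
      then have "x i \<in> ball 0 (d i)" using x e(2)[OF True] by (auto simp: cube_def)
      then show ?thesis using d(2) by blast
    next
      case False
      then have "x i = 0" using x by (auto simp: cube_def Cn_def)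
      then show ?thesis using d(1)[of i] d(2)[of i] by auto
    qed
    then show "x \<in> U" using H(1) by (auto simp: PiE_iff)
  qed
  then show ?thesis using e by blast
qed

lemma eventually_Cn_iff:
  "(\<forall>\<^sub>F x in nhds 0. x \<in> Cn n \<longrightarrow> P x) \<longleftrightarrow> (\<exists>e>0. \<forall>x\<in>cube n e. P x)"
proof
  assume "\<forall>\<^sub>F x in nhds 0. x \<in> Cn n \<longrightarrow> P x"
  then obtain U where "open U" "0 \<in> U" "\<And>x. x \<in> U \<Longrightarrow> x \<in> Cn n \<longrightarrow> P x"
    by (auto simp: eventually_nhds)
  then show "\<exists>e>0. \<forall>x\<in>cube n e. P x"
    using cube_subset_open[of U n] cube_Cn by blast
next
  assume "\<exists>e>0. \<forall>x\<in>cube n e. P x"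
  then obtain e where e: "e > 0" "\<forall>x\<in>cube n e. P x" by blast
  obtain U where "open U" "cube n e = U \<inter> Cn n" using cube_eq_open_Int by blast
  then show "\<forall>\<^sub>F x in nhds 0. x \<in> Cn n \<longrightarrow> P x"
    using e zero_in_cube[of e n] unfolding eventually_nhds by (intro exI[of _ U]) auto
qed

lemma germ_eq_iff: "germ_eq n f g \<longleftrightarrow> (\<exists>e>0. \<forall>x\<in>cube n e. f x = g x)"
  unfolding germ_eq_def by (rule eventually_Cn_iff)

section \<open>Holomorphic functions of several variables\<close>

lemma hol_fun_subset: "hol_fun n U g \<Longrightarrow> V \<subseteq> U \<Longrightarrow> hol_fun n V g"
  unfolding hol_fun_def by (auto intro: continuous_on_subset)

lemma hol_map_subset: "hol_map n p U f \<Longrightarrow> V \<subseteq> U \<Longrightarrow> hol_map n p V f"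
  unfolding hol_map_def by (auto intro: hol_fun_subset)

lemma hol_germ_iff:
  "hol_germ n p f \<longleftrightarrow> f 0 = 0 \<and> (\<exists>e>0. hol_map n p (cube n e) f)"
proof
  assume "hol_germ n p f"
  then obtain U where U: "open U" "0 \<in> U" "hol_map n p (U \<inter> Cn n) f" "f 0 = 0"
    by (auto simp: hol_germ_def)
  then obtain e where "e > 0" "cube n e \<subseteq> U \<inter> Cn n"
    using cube_subset_open[of U n] cube_Cn by blast
  then show "f 0 = 0 \<and> (\<exists>e>0. hol_map n p (cube n e) f)"
    using U hol_map_subset by blast
next
  assume "f 0 = 0 \<and> (\<exists>e>0. hol_map n p (cube n e) f)"
  then obtain e where e: "e > 0" "hol_map n p (cube n e) f" "f 0 = 0" by blast
  obtain U where "open U" "cube n e = U \<inter> Cn n" using cube_eq_open_Int by blast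
  then show "hol_germ n p f"
    using e zero_in_cube[of e n] unfolding hol_germ_def by (metis IntE)
qed

lemma hol_fun_slice:
  assumes "hol_fun n (cube n e) g" "x \<in> cube n e" "i < n"
  shows "(\<lambda>z. g (x(i := z))) holomorphic_on ball 0 e"
proof -
  have "(\<lambda>z. g (x(i := z))) field_differentiable at z" if "z \<in> ball 0 e" for z
  proof -
    have "x(i := z) \<in> cube n e" using that assms by (intro cube_upd) auto
    then have "(\<lambda>w. g ((x(i := z))(i := w))) field_differentiable at ((x(i := z)) i)"
      using assms unfolding hol_fun_def by blast
    then show ?thesis by simp
  qed
  then show ?thesis by (simp add: holomorphic_on_open field_differentiable_def)
qed

lemma hol_fun_slice_deriv:
  assumes "hol_fun n (cube n e) g" "x \<in> cube n e" "i < n" "cmod z < e"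
  shows "((\<lambda>z. g (x(i := z))) has_field_derivative pderiv_at i g (x(i := z))) (at z)"
proof -
  have "(\<lambda>z. g (x(i := z))) field_differentiable at z"
    using hol_fun_slice[OF assms(1-3)] assms(4)
    by (auto simp: holomorphic_on_open field_differentiable_def)
  then show ?thesis
    by (simp add: pderiv_at_def field_differentiable_derivI)
qed

lemma pderiv_at_cong:
  assumes "\<And>x. x \<in> cube n e \<Longrightarrow> g x = g' x" "x \<in> cube n e" "i < n"
  shows "pderiv_at i g x = pderiv_at i g' x"
proof -
  have "\<forall>\<^sub>F z in nhds (x i). cmod z < e"
    using assms cube_less[OF assms(2,3)]
    by (intro eventually_nhds_in_open[of "{z. cmod z < e}", simplified])
      (auto intro!: open_Collect_less continuous_intros)
  then have "\<forall>\<^sub>F z in nhds (x i). g (x(i := z)) = g' (x(i := z))"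
    by eventually_elim (use assms cube_upd in blast)
  then show ?thesis unfolding pderiv_at_def by (intro deriv_cong_ev) auto
qed

lemma pderiv_at_integral:
  assumes g: "hol_fun n (cube n e) g" and x: "x \<in> cube n e" and i: "i < n"
    and R: "cmod (x i) < R" "R < e"
  shows "pderiv_at i g x = integral (cbox 0 1) (\<lambda>t.
     g (x(i := circlepath 0 R t)) / (circlepath 0 R t - x i)\<^sup>2 *
       (2 * pi * \<i> * circlepath 0 R t)) / (2 * pi * \<i>)"
proof -
  let ?f = "\<lambda>z. g (x(i := z))"
  have hol: "?f holomorphic_on ball 0 e" by (rule hol_fun_slice[OF g x i])
  have vd: "vector_derivative (circlepath 0 R) (at t within {0..1}) = 2 * pi * \<i> * circlepath 0 R t"
    if "t \<in> {0..1}" for t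
    using that by (simp add: vector_derivative_circlepath01) (simp add: circlepath)
  have "((\<lambda>u. ?f u / (u - x i)^Suc 1) has_contour_integral
       (2 * pi * \<i> / fact 1 * (deriv ^^ 1) ?f (x i))) (circlepath 0 R)"
  proof (rule Cauchy_has_contour_integral_higher_derivative_circlepath)
    show "continuous_on (cball 0 R) ?f"
      using hol R by (intro holomorphic_on_imp_continuous_on holomorphic_on_subset[OF hol]) auto
    show "?f holomorphic_on ball 0 R"
      using R by (intro holomorphic_on_subset[OF hol]) auto
    show "x i \<in> ball 0 R" using R by simp
  qed
  then have "((\<lambda>t. ?f (circlepath 0 R t) / (circlepath 0 R t - x i)^Suc 1 *
       vector_derivative (circlepath 0 R) (at t within {0..1})) has_integral
       (2 * pi * \<i> * pderiv_at i g x)) {0..1}"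
    by (simp add: has_contour_integral_def pderiv_at_def)
  then have "((\<lambda>t. ?f (circlepath 0 R t) / (circlepath 0 R t - x i)\<^sup>2 *
       (2 * pi * \<i> * circlepath 0 R t)) has_integral
       (2 * pi * \<i> * pderiv_at i g x)) {0..1}"
    by (rule has_integral_eq[rotated]) (simp add: vd numeral_2_eq_2)
  then have "integral (cbox 0 1) (\<lambda>t. ?f (circlepath 0 R t) / (circlepath 0 R t - x i)\<^sup>2 *
       (2 * pi * \<i> * circlepath 0 R t)) = 2 * pi * \<i> * pderiv_at i g x"
    by (simp add: integral_unique)
  then show ?thesis by simp
qed

lemma circlepath_norm: "R > 0 \<Longrightarrow> cmod (circlepath 0 R t) = R"
  by (simp add: circlepath norm_mult)

lemma continuous_on_circle [continuous_intros]:
  "continuous_on S f \<Longrightarrow> continuous_on S (\<lambda>x. circlepath z R (f x))"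
  unfolding circlepath by (intro continuous_intros)

text \<open>
  The circle in Cauchy's formula can be kept fixed while the point varies, so that the partial
  derivative becomes a parameter integral with continuous integrand.
\<close>

lemma continuous_on_pderiv_at:
  assumes g: "hol_fun n (cube n e) g" and i: "i < n"
  shows "continuous_on (cube n e) (pderiv_at i g)"
proof -
  have "continuous (at a within cube n e) (pderiv_at i g)" if a: "a \<in> cube n e" for a
  proof -
    obtain R where R: "cmod (a i) < R" "R < e"
      using cube_less[OF a i] dense by blast
    then have R0: "R > 0" using norm_ge_zero[of "a i"] by linarith
    let ?V = "{x::cvec. cmod (x i) < R}"
    let ?I = "\<lambda>x t. g (x(i := circlepath 0 R t)) / (circlepath 0 R t - x i)\<^sup>2 *
       (2 * pi * \<i> * circlepath 0 R t)"
    have cg: "continuous_on (cube n e) g" using g by (simp add: hol_fun_def)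
    have cin: "x(i := circlepath 0 R t) \<in> cube n e" if "x \<in> cube n e" for x t
      by (rule cube_upd[OF that i]) (use R R0 in \<open>simp add: circlepath_norm\<close>)
    have "continuous_on ((cube n e \<inter> ?V) \<times> cbox 0 1) (\<lambda>(x,t). ?I x t)"
    proof -
      have 1: "continuous_on ((cube n e \<inter> ?V) \<times> cbox (0::real) 1) (\<lambda>p. (fst p)(i := circlepath 0 R (snd p)))"
        by (intro continuous_on_cvec_upd continuous_intros)
      have 2: "continuous_on ((cube n e \<inter> ?V) \<times> cbox (0::real) 1)
         (\<lambda>p. g ((fst p)(i := circlepath 0 R (snd p))))"
        by (rule continuous_on_compose2[OF cg 1]) (use cin in auto)
      have 3: "circlepath 0 R t \<noteq> x i" if "cmod (x i) < R" for x t
        using circlepath_norm[OF R0, of t] that by auto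
      show ?thesis
        unfolding case_prod_beta
        by (intro continuous_intros 2 continuous_on_fst_coord) (use 3 in auto)
    qed
    then have "continuous_on (cube n e \<inter> ?V) (\<lambda>x. integral (cbox 0 1) (?I x))"
      by (rule integral_continuous_on_param)
    then have "continuous_on (cube n e \<inter> ?V) (\<lambda>x. integral (cbox 0 1) (?I x) / (2 * pi * \<i>))"
      by (intro continuous_intros) auto
    then have "continuous_on (cube n e \<inter> ?V) (pderiv_at i g)"
      by (rule continuous_on_eq) (use pderiv_at_integral[OF g _ i _ R(2)] in auto)
    then have "continuous (at a within cube n e \<inter> ?V) (pderiv_at i g)"
      using a R by (auto simp: continuous_on_eq_continuous_within)
    moreover have "at a within cube n e \<inter> ?V = at a within cube n e"
      by (rule at_within_nhd[of a ?V]) (use R open_coord_less in auto)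
    ultimately show ?thesis by simp
  qed
  then show ?thesis by (simp add: continuous_on_eq_continuous_within)
qed

text \<open>
  In the direction of the derivative this is the one-variable theorem.  In another direction,
  Cauchy's formula is differentiated under the integral sign, which is justified by the continuity
  of the other partial derivative.
\<close>

lemma hol_fun_pderiv_at:
  assumes g: "hol_fun n (cube n e) g" and i: "i < n"
  shows "hol_fun n (cube n e) (pderiv_at i g)"
  unfolding hol_fun_def
proof (intro conjI ballI allI impI)
  show "continuous_on (cube n e) (pderiv_at i g)"
    by (rule continuous_on_pderiv_at[OF g i])
next
  fix a j assume a: "a \<in> cube n e" and j: "j < n"
  have e0: "e > 0" using cube_less[OF a i] norm_ge_zero[of "a i"] by linarith
  show "(\<lambda>z. pderiv_at i g (a(j := z))) field_differentiable at (a j)"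
  proof (cases "j = i")
    case True
    have "deriv (\<lambda>w. g (a(i := w))) holomorphic_on ball 0 e"
      by (intro holomorphic_deriv hol_fun_slice[OF g a i]) auto
    then show ?thesis using True cube_less[OF a i]
      by (auto simp: pderiv_at_def holomorphic_on_open field_differentiable_def)
  next
    case False
    obtain R where R: "cmod (a i) < R" "R < e"
      using cube_less[OF a i] dense by blast
    then have R0: "R > 0" using norm_ge_zero[of "a i"] by linarith
    have cin: "a(j := w, i := circlepath 0 R t) \<in> cube n e" if "cmod w < e" for w t
      by (intro cube_upd a i j) (use that R R0 in \<open>simp_all add: circlepath_norm\<close>)
    let ?I = "\<lambda>w t. g (a(j := w, i := circlepath 0 R t)) / (circlepath 0 R t - a i)\<^sup>2 *
       (2 * pi * \<i> * circlepath 0 R t)"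
    let ?J = "\<lambda>w t. pderiv_at j g (a(j := w, i := circlepath 0 R t)) / (circlepath 0 R t - a i)\<^sup>2 *
       (2 * pi * \<i> * circlepath 0 R t)"
    have 3: "circlepath 0 R t \<noteq> a i" for t
      using circlepath_norm[OF R0, of t] R by auto
    have upd: "continuous_on (ball 0 e \<times> cbox (0::real) 1) (\<lambda>p. a(j := fst p, i := circlepath 0 R (snd p)))"
      by (intro continuous_on_cvec_upd continuous_intros)
    have con: "continuous_on (ball 0 e \<times> cbox (0::real) 1)
        (\<lambda>(w,t). H (a(j := w, i := circlepath 0 R t)) / (circlepath 0 R t - a i)\<^sup>2 *
       (2 * pi * \<i> * circlepath 0 R t))" if H: "continuous_on (cube n e) H" for H :: "cvec \<Rightarrow> complex"
    proof -
      have "continuous_on (ball 0 e \<times> cbox (0::real) 1)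
         (\<lambda>p. H (a(j := fst p, i := circlepath 0 R (snd p))))"
        by (rule continuous_on_compose2[OF H upd]) (use cin in auto)
      then show ?thesis
        unfolding case_prod_beta
        by (intro continuous_intros) (use 3 in auto)
    qed
    have "(\<lambda>w. integral (cbox 0 1) (?I w)) holomorphic_on ball 0 e"
    proof (rule leibniz_rule_holomorphic)
      fix w :: complex and t :: real assume w: "w \<in> ball 0 e" and t: "t \<in> cbox 0 1"
      have "((\<lambda>w. g ((a(i := circlepath 0 R t))(j := w))) has_field_derivative
             pderiv_at j g ((a(i := circlepath 0 R t))(j := w))) (at w)"
        by (rule hol_fun_slice_deriv[OF g cube_upd[OF a i] j])
          (use R R0 w in \<open>simp_all add: circlepath_norm\<close>)
      then have "((\<lambda>w. g (a(j := w, i := circlepath 0 R t))) has_field_derivative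
             pderiv_at j g (a(j := w, i := circlepath 0 R t))) (at w)"
        using False by (simp add: fun_upd_twist)
      then have "((\<lambda>w. ?I w t) has_field_derivative ?J w t) (at w)"
        by (intro DERIV_cmult_right DERIV_cdivide)
      then show "((\<lambda>w. ?I w t) has_field_derivative ?J w t) (at w within ball 0 e)"
        by (rule has_field_derivative_at_within)
    next
      fix w :: complex assume w: "w \<in> ball 0 e"
      have "continuous_on (ball 0 e \<times> cbox (0::real) 1) (\<lambda>(w,t). ?I w t)"
        using con[of g] g by (simp add: hol_fun_def)
      then have "continuous_on (cbox 0 1) (\<lambda>t. (\<lambda>(w,t). ?I w t) (w,t))"
        by (rule continuous_on_compose2) (use w in \<open>auto intro!: continuous_intros\<close>)
      then show "?I w integrable_on cbox 0 1"
        by (intro integrable_continuous) simp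
    next
      show "continuous_on (ball 0 e \<times> cbox 0 1) (\<lambda>(w,t). ?J w t)"
        by (rule con) (rule continuous_on_pderiv_at[OF g j])
    qed auto
    then have "(\<lambda>w. integral (cbox 0 1) (?I w) / (2 * pi * \<i>)) holomorphic_on ball 0 e"
      by (intro holomorphic_intros) auto
    moreover have "pderiv_at i g (a(j := w)) = integral (cbox 0 1) (?I w) / (2 * pi * \<i>)"
      if "w \<in> ball 0 e" for w
      using pderiv_at_integral[OF g _ i _ R(2), of "a(j := w)"] that a j R False
      by (auto simp: cube_upd)
    ultimately have "(\<lambda>w. pderiv_at i g (a(j := w))) holomorphic_on ball 0 e"
      by (subst holomorphic_cong[OF refl]) auto
    then show ?thesis using cube_less[OF a j]
      by (auto simp: holomorphic_on_open field_differentiable_def)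
  qed
qed

section \<open>The chain rule\<close>

lemma tendsto_cvecI:
  fixes F :: "'a \<Rightarrow> cvec"
  assumes "\<And>i. ((\<lambda>x. F x i) \<longlongrightarrow> l i) net"
  shows "(F \<longlongrightarrow> l) net"
proof -
  have "limitin (product_topology (\<lambda>i. euclidean) UNIV) F l net"
    using assms by (simp add: limitin_componentwise limitin_canonical_iff)
  then show ?thesis by (simp add: euclidean_product_topology limitin_canonical_iff)
qed

text \<open>
  Continuous partial derivatives make the function differentiable jointly in the curve parameter
  and one more coordinate; the coordinates of the curve are released one after the other.  The
  set S is arbitrary so that the rule also applies along a real segment.
\<close>

lemma hol_fun_chain:
  fixes x :: "complex \<Rightarrow> cvec"
  assumes g: "hol_fun n (cube n e) g"
    and x: "\<And>z. z \<in> S \<Longrightarrow> x z \<in> cube n e" and z0: "z0 \<in> S"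
    and x': "\<And>i. i < n \<Longrightarrow> ((\<lambda>z. x z i) has_field_derivative x' i) (at z0 within S)"
  shows "((\<lambda>z. g (x z)) has_field_derivative (\<Sum>i<n. pderiv_at i g (x z0) * x' i)) (at z0 within S)"
proof -
  let ?c = "x z0"
  have "((\<lambda>z. g (\<lambda>i. if i < m then x z i else ?c i)) has_field_derivative
          (\<Sum>i<m. pderiv_at i g ?c * x' i)) (at z0 within S)" if "m \<le> n" for m
    using that
  proof (induction m)
    case 0
    show ?case by simp
  next
    case (Suc m)
    then have m: "m < n" by simp
    define Pt where "Pt z y = (\<lambda>i. if i < m then x z i else if i = m then y else ?c i)" for z y
    have Pt0: "Pt z0 (?c m) = ?c" by (auto simp: Pt_def fun_eq_iff)
    have Ptcube: "Pt z y \<in> cube n e" if "z \<in> S" "y \<in> ball 0 e" for z y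
      using x[OF that(1)] x[OF z0] that(2) m by (auto simp: Pt_def cube_def Cn_def)
    have Ptupd: "(Pt z y)(m := w) = Pt z w" for z y w
      by (auto simp: Pt_def fun_eq_iff)
    have c_ball: "?c m \<in> ball 0 e" using cube_less[OF x[OF z0] m] by simp
    have eq0: "(\<lambda>z. g (Pt z (?c m))) = (\<lambda>z. g (\<lambda>i. if i < m then x z i else ?c i))"
      by (intro ext arg_cong[of _ _ g]) (auto simp: Pt_def)
    let ?D = "\<Sum>i<m. pderiv_at i g ?c * x' i"
    have total: "((\<lambda>(z, y). g (Pt z y)) has_derivative
        (\<lambda>(tz, ty). ?D * tz + blinfun_mult_right (pderiv_at m g (Pt z0 (?c m))) ty))
        (at (z0, ?c m) within S \<times> ball 0 e)"
    proof (rule has_derivative_partialsI)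
      show "((\<lambda>z. g (Pt z (?c m))) has_derivative (*) ?D) (at z0 within S)"
        using Suc m by (simp add: eq0 has_field_derivative_def)
    next
      fix z y assume z: "z \<in> S" and y: "y \<in> ball (0::complex) e"
      have "((\<lambda>w. g ((Pt z y)(m := w))) has_field_derivative pderiv_at m g ((Pt z y)(m := y))) (at y)"
        by (rule hol_fun_slice_deriv[OF g Ptcube[OF z y] m]) (use y in simp)
      then show "((\<lambda>w. g (Pt z w)) has_derivative blinfun_apply (blinfun_mult_right (pderiv_at m g (Pt z y)))) (at y within ball 0 e)"
        by (auto simp: Ptupd has_field_derivative_def intro: has_derivative_at_withinI)
    next
      have con: "continuous_on (cube n e) (pderiv_at m g)" by (rule continuous_on_pderiv_at[OF g m])
      have "((\<lambda>p. Pt (fst p) (snd p)) \<longlongrightarrow> Pt z0 (?c m)) (at (z0, ?c m) within S \<times> ball 0 e)"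
      proof -
        have "((\<lambda>p. Pt (fst p) (snd p) i) \<longlongrightarrow> Pt z0 (?c m) i) (at (z0, ?c m) within S \<times> ball 0 e)" for i
        proof (cases "i < m")
          case True
          have "((\<lambda>z. x z i) \<longlongrightarrow> x z0 i) (at z0 within S)"
            using x'[of i] True m by (auto dest!: DERIV_continuous simp: continuous_within)
          then have "continuous (at z0 within S) (\<lambda>z. x z i)" by (simp add: continuous_within)
          moreover have "fst ` (S \<times> ball (0::complex) e) = S" using ball_eq_empty c_ball by (metis empty_iff fst_image_times)
          ultimately have "continuous (at (fst (z0, ?c m)) within fst ` (S \<times> ball 0 e)) (\<lambda>z. x z i)"
            by simp
          then have "continuous (at (z0, ?c m) within S \<times> ball 0 e) (\<lambda>p. x (fst p) i)"
            using continuous_within_compose2[of "(z0, ?c m)" "S \<times> ball 0 e" fst "\<lambda>z. x z i"]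
            by (simp add: continuous_fst)
          then show ?thesis using True by (simp add: Pt_def continuous_within)
        next
          case False
          have "(snd \<longlongrightarrow> ?c m) (at (z0, ?c m) within S \<times> ball 0 e)"
            using tendsto_snd[OF tendsto_ident_at, of "(z0, ?c m)"] by simp
          then show ?thesis using False by (cases "i = m") (simp_all add: Pt_def)
        qed
        then show ?thesis by (intro tendsto_cvecI)
      qed
      then have "((\<lambda>p. pderiv_at m g (Pt (fst p) (snd p))) \<longlongrightarrow> pderiv_at m g (Pt z0 (?c m)))
          (at (z0, ?c m) within S \<times> ball 0 e)"
        by (rule continuous_on_tendsto_compose[OF con])
          (use Ptcube z0 c_ball in \<open>auto simp: eventually_at_filter intro!: always_eventually\<close>)
      then have "((\<lambda>p. blinfun_mult_right (pderiv_at m g (Pt (fst p) (snd p)))) \<longlongrightarrow>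
           blinfun_mult_right (pderiv_at m g (Pt z0 (?c m)))) (at (z0, ?c m) within S \<times> ball 0 e)"
        by (rule bounded_linear.tendsto[OF bounded_linear_blinfun_mult_right])
      then show "continuous (at (z0, ?c m) within S \<times> ball 0 e)
          (\<lambda>(z, y). blinfun_mult_right (pderiv_at m g (Pt z y)))"
        by (simp add: continuous_within split_def)
    qed (use c_ball in auto)
    have "((\<lambda>z. (z, x z m)) has_derivative (\<lambda>t. (t, x' m * t))) (at z0 within S)"
      using x'[OF m] by (auto simp: has_field_derivative_def intro!: derivative_intros)
    then have "((\<lambda>z. (\<lambda>(z, y). g (Pt z y)) (z, x z m)) has_derivative
        (\<lambda>t. (\<lambda>(tz, ty). ?D * tz + blinfun_mult_right (pderiv_at m g (Pt z0 (?c m))) ty) (t, x' m * t)))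
        (at z0 within S)"
    proof (rule has_derivative_in_compose)
      show "((\<lambda>(z, y). g (Pt z y)) has_derivative
        (\<lambda>(tz, ty). ?D * tz + blinfun_mult_right (pderiv_at m g (Pt z0 (?c m))) ty))
        (at (z0, ?c m) within (\<lambda>z. (z, x z m)) ` S)"
        by (rule has_derivative_subset[OF total]) (use x cube_less m in force)
    qed
    moreover have "(\<lambda>z. g (Pt z (x z m))) = (\<lambda>z. g (\<lambda>i. if i < Suc m then x z i else ?c i))"
      by (intro ext arg_cong[of _ _ g]) (auto simp: Pt_def less_Suc_eq)
    moreover have "(\<lambda>t. ?D * t + pderiv_at m g ?c * (x' m * t)) = (*) (\<Sum>i<Suc m. pderiv_at i g ?c * x' i)"
      by (auto simp: fun_eq_iff algebra_simps)
    ultimately show ?case by (simp add: has_field_derivative_def Pt0)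
  qed
  from this[of n]
  have 1: "((\<lambda>z. g (\<lambda>i. if i < n then x z i else ?c i)) has_field_derivative
          (\<Sum>i<n. pderiv_at i g ?c * x' i)) (at z0 within S)" by simp
  show ?thesis
  proof (rule has_field_derivative_transform_within[OF 1 zero_less_one z0])
    fix z assume z: "z \<in> S"
    have "(\<lambda>i. if i < n then x z i else ?c i) = x z"
      using cube_Cn[OF x[OF z]] cube_Cn[OF x[OF z0]] by (auto simp: Cn_def fun_eq_iff)
    then show "g (\<lambda>i. if i < n then x z i else ?c i) = g (x z)" by simp
  qed
qed

section \<open>Closure properties of holomorphic functions and maps\<close>

lemma hol_fun_const: "hol_fun n S (\<lambda>x. c)"
  by (simp add: hol_fun_def)

lemma hol_fun_coord: "hol_fun n S (\<lambda>x. x i)"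
proof -
  have "(\<lambda>z. (a(j := z)) i) field_differentiable at (a j)" for a :: cvec and j
    by (cases "i = j") simp_all
  then show ?thesis by (simp only: hol_fun_def continuous_on_coord) simp
qed

lemma hol_fun_add: "hol_fun n S f \<Longrightarrow> hol_fun n S g \<Longrightarrow> hol_fun n S (\<lambda>x. f x + g x)"
  by (auto simp: hol_fun_def intro: continuous_on_add field_differentiable_add)

lemma hol_fun_diff: "hol_fun n S f \<Longrightarrow> hol_fun n S g \<Longrightarrow> hol_fun n S (\<lambda>x. f x - g x)"
  by (auto simp: hol_fun_def intro: continuous_on_diff field_differentiable_diff)

lemma hol_fun_mult: "hol_fun n S f \<Longrightarrow> hol_fun n S g \<Longrightarrow> hol_fun n S (\<lambda>x. f x * g x)"
  by (auto simp: hol_fun_def intro: continuous_on_mult field_differentiable_mult)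

lemma hol_fun_sum: "(\<And>i. i \<in> I \<Longrightarrow> hol_fun n S (f i)) \<Longrightarrow> hol_fun n S (\<lambda>x. \<Sum>i\<in>I. f i x)"
  by (induction I rule: infinite_finite_induct) (simp_all add: hol_fun_const hol_fun_add)

lemma hol_fun_prod: "(\<And>i. i \<in> I \<Longrightarrow> hol_fun n S (f i)) \<Longrightarrow> hol_fun n S (\<lambda>x. \<Prod>i\<in>I. f i x)"
  by (induction I rule: infinite_finite_induct) (simp_all add: hol_fun_const hol_fun_mult)

lemma hol_fun_power: "hol_fun n S f \<Longrightarrow> hol_fun n S (\<lambda>x. f x ^ k)"
  by (induction k) (simp_all add: hol_fun_const hol_fun_mult)

lemma hol_fun_cong:
  assumes "\<And>x. x \<in> cube n e \<Longrightarrow> f x = g x" "hol_fun n (cube n e) f"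
  shows "hol_fun n (cube n e) g"
  unfolding hol_fun_def
proof (intro conjI ballI allI impI)
  show "continuous_on (cube n e) g"
    using assms by (auto simp: hol_fun_def cong: continuous_on_cong)
  fix a i assume a: "a \<in> cube n e" and i: "i < n"
  have "(\<lambda>z. f (a(i := z))) holomorphic_on ball 0 e" by (rule hol_fun_slice[OF assms(2) a i])
  moreover have "f (a(i := z)) = g (a(i := z))" if "z \<in> ball 0 e" for z
    using assms(1) cube_upd[OF a i] that by simp
  ultimately have "(\<lambda>z. g (a(i := z))) holomorphic_on ball 0 e"
    by (subst holomorphic_cong[OF refl]) auto
  then show "(\<lambda>z. g (a(i := z))) field_differentiable at (a i)"
    using cube_less[OF a i] by (auto simp: holomorphic_on_open field_differentiable_def)
qed

lemma hol_map_cong: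
  assumes "\<And>x. x \<in> cube n e \<Longrightarrow> f x = g x" "hol_map n p (cube n e) f"
  shows "hol_map n p (cube n e) g"
proof -
  have "hol_fun n (cube n e) (\<lambda>x. g x j)" if "j < p" for j
    by (rule hol_fun_cong[of n e "\<lambda>x. f x j"]) (use assms that in \<open>auto simp: hol_map_def\<close>)
  then show ?thesis using assms by (auto simp: hol_map_def image_subset_iff)
qed

lemma hol_map_continuous:
  assumes "hol_map n p S f" shows "continuous_on S f"
proof (rule continuous_on_cvecI)
  fix i show "continuous_on S (\<lambda>x. f x i)"
  proof (cases "i < p")
    case True then show ?thesis using assms by (auto simp: hol_map_def hol_fun_def)
  next
    case False
    then have "\<And>x. x \<in> S \<Longrightarrow> f x i = 0" using assms by (auto simp: hol_map_def Cn_def)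
    then show ?thesis by (auto cong: continuous_on_cong)
  qed
qed

lemma hol_fun_compose:
  assumes g: "hol_fun m (cube m d) g" and F: "hol_map n m (cube n e) F"
    and sub: "F ` cube n e \<subseteq> cube m d"
  shows "hol_fun n (cube n e) (\<lambda>x. g (F x))"
  unfolding hol_fun_def
proof (intro conjI ballI allI impI)
  show "continuous_on (cube n e) (\<lambda>x. g (F x))"
    by (rule continuous_on_compose2[OF _ hol_map_continuous[OF F] sub]) (use g in \<open>simp add: hol_fun_def\<close>)
  fix a i assume a: "a \<in> cube n e" and i: "i < n"
  have "((\<lambda>z. g (F (a(i := z)))) has_field_derivative
    (\<Sum>j<m. pderiv_at j g (F (a(i := a i))) * pderiv_at i (\<lambda>x. F x j) (a(i := a i)))) (at (a i) within ball 0 e)"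
  proof (rule hol_fun_chain[OF g])
    show "F (a(i := z)) \<in> cube m d" if "z \<in> ball 0 e" for z
      using sub cube_upd[OF a i, of z] that by auto
    show "a i \<in> ball 0 e" using cube_less[OF a i] by simp
    show "((\<lambda>z. F (a(i := z)) j) has_field_derivative pderiv_at i (\<lambda>x. F x j) (a(i := a i))) (at (a i) within ball 0 e)"
      if "j < m" for j
      by (rule has_field_derivative_at_within, rule hol_fun_slice_deriv[OF _ a i])
        (use F that cube_less[OF a i] in \<open>auto simp: hol_map_def\<close>)
  qed
  moreover have "at (a i) within ball 0 e = at (a i)"
    using cube_less[OF a i] by (intro at_within_open) auto
  ultimately show "(\<lambda>z. g (F (a(i := z)))) field_differentiable at (a i)"
    unfolding field_differentiable_def by auto
qed

text \<open>
  Continuity at 0 gives polydiscs on which germs can be composed.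
\<close>

lemma hol_map_shrink:
  assumes F: "hol_map n m (cube n e) F" "F 0 = 0" and "e > 0" "d > 0"
  shows "\<exists>e'>0. e' \<le> e \<and> F ` cube n e' \<subseteq> cube m d"
proof -
  have c: "continuous_on (cube n e) F" by (rule hol_map_continuous[OF F(1)])
  obtain U where U: "open U" "cube m d = U \<inter> Cn m" using cube_eq_open_Int by blast
  obtain V where V: "open V" "V \<inter> cube n e = F -` U \<inter> cube n e"
    using c U(1) by (metis continuous_on_open_invariant)
  have "0 \<in> V" using V(2) U(2) zero_in_cube[OF \<open>e > 0\<close>, of n] zero_in_cube[OF \<open>d > 0\<close>, of m] F(2)
    by (metis IntD1 IntI vimageI2)
  then obtain e1 where e1: "e1 > 0" "cube n e1 \<subseteq> V" using cube_subset_open V(1) by blast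
  let ?e = "min e e1"
  have "cube n ?e \<subseteq> V \<inter> cube n e"
    using e1 cube_mono[of ?e e n] cube_mono[of ?e e1 n] by auto
  then have "F ` cube n ?e \<subseteq> U \<inter> Cn m"
    using V(2) F(1) by (force simp: hol_map_def)
  then show ?thesis using U e1 \<open>e > 0\<close> by (intro exI[of _ ?e]) auto
qed

lemma hol_germ_bound:
  assumes "hol_germ n m F" "d > 0"
  shows "\<exists>e>0. hol_map n m (cube n e) F \<and> F ` cube n e \<subseteq> cube m d"
proof -
  obtain e where e: "e > 0" "hol_map n m (cube n e) F" "F 0 = 0"
    using assms by (auto simp: hol_germ_iff)
  then obtain e' where "e' > 0" "e' \<le> e" "F ` cube n e' \<subseteq> cube m d"
    using hol_map_shrink[OF e(2,3,1) assms(2)] by blast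
  moreover have "hol_map n m (cube n e') F"
    by (rule hol_map_subset[OF e(2) cube_mono[OF \<open>e' \<le> e\<close>]])
  ultimately show ?thesis by blast
qed

lemma hol_germ_compose:
  assumes F: "hol_germ n m F" and g: "hol_germ m p g"
  shows "hol_germ n p (g \<circ> F)"
proof -
  obtain d where d: "d > 0" "hol_map m p (cube m d) g" "g 0 = 0"
    using g by (auto simp: hol_germ_iff)
  obtain e where e: "e > 0" "hol_map n m (cube n e) F" "F ` cube n e \<subseteq> cube m d"
    using hol_germ_bound[OF F d(1)] by blast
  have "hol_map n p (cube n e) (g \<circ> F)"
    unfolding hol_map_def
  proof (intro conjI allI impI)
    show "(g \<circ> F) ` cube n e \<subseteq> Cn p" using d e by (auto simp: hol_map_def)
    fix j assume "j < p"
    then show "hol_fun n (cube n e) (\<lambda>x. (g \<circ> F) x j)"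
      using hol_fun_compose[of m d "\<lambda>y. g y j", OF _ e(2,3)] d(2) by (auto simp: hol_map_def)
  qed
  then show ?thesis using F d e by (auto simp: hol_germ_iff)
qed

lemma hol_germ_cong:
  assumes "hol_germ n p f" "germ_eq n f g"
  shows "hol_germ n p g"
proof -
  obtain e1 where e1: "e1 > 0" "\<forall>x\<in>cube n e1. f x = g x" using assms(2) by (auto simp: germ_eq_iff)
  obtain e where e: "e > 0" "hol_map n p (cube n e) f" "f 0 = 0"
    using assms by (auto simp: hol_germ_iff)
  have sub: "cube n (min e e1) \<subseteq> cube n e" "cube n (min e e1) \<subseteq> cube n e1"
    by (auto intro!: cube_mono)
  have "hol_map n p (cube n (min e e1)) f" using e(2) sub(1) by (rule hol_map_subset)
  then have "hol_map n p (cube n (min e e1)) g"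
    by (rule hol_map_cong[rotated]) (use e1 sub in auto)
  moreover have "g 0 = 0" using e e1 zero_in_cube by metis
  ultimately show ?thesis using e e1 by (auto simp: hol_germ_iff intro!: exI[of _ "min e e1"])
qed

lemma germ_eq_sym: "germ_eq n f g \<Longrightarrow> germ_eq n g f"
  by (auto simp: germ_eq_iff)

lemma germ_eq_trans:
  assumes "germ_eq n f g" "germ_eq n g h" shows "germ_eq n f h"
proof -
  obtain d e where "d > 0" "\<forall>x\<in>cube n d. f x = g x" "e > 0" "\<forall>x\<in>cube n e. g x = h x"
    using assms by (auto simp: germ_eq_iff)
  moreover have "cube n (min d e) \<subseteq> cube n d" "cube n (min d e) \<subseteq> cube n e"
    by (auto intro!: cube_mono)
  ultimately have "0 < min d e" "\<forall>x\<in>cube n (min d e). f x = h x"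
    by (simp, metis subsetD)
  then show ?thesis by (auto simp: germ_eq_iff simp del: min_less_iff_conj)
qed

lemma germ_eq_comp_left: "germ_eq n f g \<Longrightarrow> germ_eq n (h \<circ> f) (h \<circ> g)"
  by (auto simp: germ_eq_iff)

lemma germ_eq_comp_right:
  assumes "germ_eq m f g" "hol_germ n m F"
  shows "germ_eq n (f \<circ> F) (g \<circ> F)"
proof -
  obtain d where d: "d > 0" "\<forall>x\<in>cube m d. f x = g x" using assms by (auto simp: germ_eq_iff)
  then show ?thesis using hol_germ_bound[OF assms(2) d(1)] by (force simp: germ_eq_iff)
qed

lemma biholo_germ_compose:
  assumes "biholo_germ n a" "biholo_germ n b"
  shows "biholo_germ n (a \<circ> b)"
proof -
  obtain a' b' where a: "hol_germ n n a" "hol_germ n n a'" "germ_eq n (a' \<circ> a) id" "germ_eq n (a \<circ> a') id"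
    and b: "hol_germ n n b" "hol_germ n n b'" "germ_eq n (b' \<circ> b) id" "germ_eq n (b \<circ> b') id"
    using assms by (auto simp: biholo_germ_def)
  have "germ_eq n (b' \<circ> (a' \<circ> a) \<circ> b) (b' \<circ> id \<circ> b)"
    by (intro germ_eq_comp_right[OF _ b(1)] germ_eq_comp_left a)
  then have 1: "germ_eq n ((b' \<circ> a') \<circ> (a \<circ> b)) id"
    using b(3) germ_eq_trans by (auto simp: comp_assoc)
  have "germ_eq n (a \<circ> (b \<circ> b') \<circ> a') (a \<circ> id \<circ> a')"
    by (intro germ_eq_comp_right[OF _ a(2)] germ_eq_comp_left b)
  then have 2: "germ_eq n ((a \<circ> b) \<circ> (b' \<circ> a')) id"
    using a(4) germ_eq_trans by (auto simp: comp_assoc)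
  show ?thesis unfolding biholo_germ_def
    using 1 2 a b hol_germ_compose by blast
qed

lemma biholo_germ_cong:
  assumes "biholo_germ n a" "germ_eq n a b"
  shows "biholo_germ n b"
proof -
  obtain a' where a: "hol_germ n n a" "hol_germ n n a'" "germ_eq n (a' \<circ> a) id" "germ_eq n (a \<circ> a') id"
    using assms by (auto simp: biholo_germ_def)
  have "germ_eq n (a' \<circ> b) id"
    using germ_eq_trans[OF germ_eq_comp_left[OF germ_eq_sym[OF assms(2)]] a(3)] .
  moreover have "germ_eq n (b \<circ> a') id"
    using germ_eq_trans[OF germ_eq_comp_right[OF germ_eq_sym[OF assms(2)] a(2)] a(4)] .
  ultimately show ?thesis using a hol_germ_cong[OF a(1) assms(2)] by (auto simp: biholo_germ_def)
qed

section \<open>Second-order Taylor coefficients along curves\<close>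

text \<open>
  The 2-jet at 0 of a function of one variable, recorded by its value and its first two
  derivatives (not divided by factorials).
\<close>

definition jet2 :: "(complex \<Rightarrow> complex) \<Rightarrow> complex \<Rightarrow> complex \<Rightarrow> complex \<Rightarrow> bool" where
  "jet2 \<phi> a b c \<longleftrightarrow> \<phi> analytic_on {0} \<and> \<phi> 0 = a \<and> deriv \<phi> 0 = b \<and> deriv (deriv \<phi>) 0 = c"

lemma jet2_unique: "jet2 \<phi> a b c \<Longrightarrow> jet2 \<phi> a' b' c' \<Longrightarrow> a = a' \<and> b = b' \<and> c = c'"
  by (simp add: jet2_def)

lemma jet2_ball: "jet2 \<phi> a b c \<Longrightarrow> \<exists>r>0. \<phi> holomorphic_on ball 0 r"
  by (auto simp: jet2_def analytic_at_ball)

lemma jet2I: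
  assumes "r > 0" "\<And>z. cmod z < r \<Longrightarrow> (\<phi> has_field_derivative \<phi>' z) (at z)"
    "(\<phi>' has_field_derivative c) (at 0)" "\<phi> 0 = a" "\<phi>' 0 = b"
  shows "jet2 \<phi> a b c"
proof -
  have d: "deriv \<phi> z = \<phi>' z" if "cmod z < r" for z
    using assms(2)[OF that] by (rule DERIV_imp_deriv)
  have "\<phi> holomorphic_on ball 0 r"
    unfolding holomorphic_on_open[OF open_ball] using assms(2) by (metis mem_ball_0)
  moreover have "deriv (deriv \<phi>) 0 = deriv \<phi>' 0"
  proof (rule deriv_cong_ev)
    show "\<forall>\<^sub>F z in nhds 0. deriv \<phi> z = \<phi>' z"
      using d \<open>r > 0\<close> unfolding eventually_nhds by (intro exI[of _ "ball 0 r"]) auto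
  qed simp
  ultimately show ?thesis
    using assms d DERIV_imp_deriv[OF assms(3)] by (auto simp: jet2_def analytic_at_ball)
qed

lemma holomorphic_ball_deriv:
  assumes "\<phi> holomorphic_on ball 0 r" "cmod z < r"
  shows "(\<phi> has_field_derivative deriv \<phi> z) (at z)"
  using assms by (intro holomorphic_derivI[of _ "ball 0 r"]) auto

lemma holomorphic_ball_deriv2:
  assumes "\<phi> holomorphic_on ball 0 r" "r > 0"
  shows "(deriv \<phi> has_field_derivative deriv (deriv \<phi>) 0) (at 0)"
  using assms by (intro holomorphic_derivI[of _ "ball 0 r"] holomorphic_deriv) auto

lemma jet2_cong:
  assumes "jet2 \<phi> a b c" "\<forall>\<^sub>F z in nhds 0. \<phi> z = \<psi> z"
  shows "jet2 \<psi> a b c"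
proof -
  obtain r where r: "r > 0" "\<phi> holomorphic_on ball 0 r" using jet2_ball[OF assms(1)] by blast
  obtain s where s: "s > 0" "\<And>z. cmod z < s \<Longrightarrow> \<phi> z = \<psi> z"
    using assms(2) by (auto simp: eventually_nhds_metric dist_norm)
  let ?r = "min r s"
  show ?thesis
  proof (rule jet2I[of ?r _ "deriv \<phi>"])
    fix z :: complex assume z: "cmod z < ?r"
    show "(\<psi> has_field_derivative deriv \<phi> z) (at z)"
      by (rule has_field_derivative_transform_within_open[OF holomorphic_ball_deriv[OF r(2)], where S="ball 0 ?r"])
        (use z s in auto)
  next
    show "(deriv \<phi> has_field_derivative c) (at 0)"
      using holomorphic_ball_deriv2[OF r(2,1)] assms(1) by (simp add: jet2_def)
  qed (use assms(1) r s in \<open>auto simp: jet2_def\<close>)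
qed

lemma jet2_linear: "jet2 (\<lambda>z. c * z) 0 c 0"
  by (rule jet2I[of 1 _ "\<lambda>_. c"]) (auto intro!: derivative_eq_intros)

lemma jet2_add:
  assumes "jet2 \<phi> a b c" "jet2 \<psi> a' b' c'"
  shows "jet2 (\<lambda>z. \<phi> z + \<psi> z) (a + a') (b + b') (c + c')"
proof -
  obtain r where r: "r > 0" "\<phi> holomorphic_on ball 0 r" using jet2_ball[OF assms(1)] by blast
  obtain s where s: "s > 0" "\<psi> holomorphic_on ball 0 s" using jet2_ball[OF assms(2)] by blast
  show ?thesis
  proof (rule jet2I[of "min r s" _ "\<lambda>z. deriv \<phi> z + deriv \<psi> z"])
    show "((\<lambda>z. \<phi> z + \<psi> z) has_field_derivative deriv \<phi> z + deriv \<psi> z) (at z)"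
      if "cmod z < min r s" for z
      using that by (intro DERIV_add holomorphic_ball_deriv[OF r(2)] holomorphic_ball_deriv[OF s(2)]) auto
    show "((\<lambda>z. deriv \<phi> z + deriv \<psi> z) has_field_derivative c + c') (at 0)"
      using DERIV_add[OF holomorphic_ball_deriv2[OF r(2,1)] holomorphic_ball_deriv2[OF s(2,1)]] assms by (simp add: jet2_def)
  qed (use assms r s in \<open>auto simp: jet2_def\<close>)
qed

lemma jet2_monomial:
  "jet2 (\<lambda>z. c * z ^ d) (if d = 0 then c else 0) (if d = 1 then c else 0) (if d = 2 then 2 * c else 0)"
proof (rule jet2I[of 1 _ "\<lambda>z. c * (of_nat d * z ^ (d - 1))"])
  show "((\<lambda>z. c * (of_nat d * z ^ (d - 1))) has_field_derivative (if d = 2 then 2 * c else 0)) (at 0)"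
  proof -
    consider "d = 0" | "d = 1" | "d = 2" | "d - 1 - 1 > 0" by linarith
    then show ?thesis
      by cases (auto intro!: derivative_eq_intros simp: power_0_left)
  qed
qed (auto intro!: derivative_eq_intros simp: power_0_left)

text \<open>
  The first and second derivative of a function on \<open>Cn n\<close> at 0, in the directions v and w.
\<close>

definition der1 :: "nat \<Rightarrow> (cvec \<Rightarrow> complex) \<Rightarrow> cvec \<Rightarrow> complex" where
  "der1 n g v = (\<Sum>i<n. pderiv_at i g 0 * v i)"

definition der2 :: "nat \<Rightarrow> (cvec \<Rightarrow> complex) \<Rightarrow> cvec \<Rightarrow> cvec \<Rightarrow> complex" where
  "der2 n g v w = (\<Sum>i<n. \<Sum>j<n. pderiv_at j (pderiv_at i g) 0 * v i * w j)"

text \<open>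
  The second-order chain rule: the chain rule is applied to g and then to each of its partial
  derivatives.
\<close>

lemma jet2_compose:
  assumes g: "hol_fun n (cube n e) g" and e: "e > 0"
    and y: "\<And>i. i < n \<Longrightarrow> jet2 (\<lambda>z. y z i) 0 (v i) (u i)"
    and yC: "\<forall>\<^sub>F z in nhds 0. y z \<in> Cn n"
  shows "jet2 (\<lambda>z. g (y z)) (g 0) (der1 n g v) (der1 n g u + der2 n g v v)"
proof -
  \<comment> \<open>a common disc on which the curve is holomorphic and stays in the polydisc of g\<close>
  have "\<exists>r. \<forall>i<n. r i > 0 \<and> (\<lambda>z. y z i) holomorphic_on ball 0 (r i) \<and> (\<forall>z\<in>ball 0 (r i). cmod (y z i) < e)"
  proof -
    have "\<exists>r>0. (\<lambda>z. y z i) holomorphic_on ball 0 r \<and> (\<forall>z\<in>ball 0 r. cmod (y z i) < e)" if i: "i < n" for i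
    proof -
      obtain r where r: "r > 0" "(\<lambda>z. y z i) holomorphic_on ball 0 r" using jet2_ball[OF y[OF i]] by blast
      have "isCont (\<lambda>z. y z i) 0"
        using holomorphic_ball_deriv[OF r(2), of 0] r(1) by (auto intro: DERIV_isCont)
      then obtain s where s: "s > 0" "\<And>z. cmod z < s \<Longrightarrow> cmod (y z i) < e"
        using e y[OF i] by (auto simp: continuous_at_eps_delta dist_norm jet2_def)
      show ?thesis
        using r s by (intro exI[of _ "min r s"]) (auto intro: holomorphic_on_subset)
    qed
    then show ?thesis by metis
  qed
  then obtain r where r: "\<And>i. i < n \<Longrightarrow> r i > 0"
     "\<And>i. i < n \<Longrightarrow> (\<lambda>z. y z i) holomorphic_on ball 0 (r i)"
     "\<And>i z. i < n \<Longrightarrow> z \<in> ball 0 (r i) \<Longrightarrow> cmod (y z i) < e" by blast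
  obtain s where s: "s > 0" "\<And>z. cmod z < s \<Longrightarrow> y z \<in> Cn n"
    using yC by (auto simp: eventually_nhds_metric dist_norm)
  define R where "R = Min (insert s (r ` {..<n}))"
  have R: "R > 0" "R \<le> s" "\<And>i. i < n \<Longrightarrow> R \<le> r i"
    using r(1) s(1) by (auto simp: R_def)
  have yc: "y z \<in> cube n e" if "z \<in> ball 0 R" for z
    using that s(2)[of z] R r(3)[of _ z] unfolding cube_def by force
  have dy: "((\<lambda>z. y z i) has_field_derivative deriv (\<lambda>z. y z i) z) (at z)" if "i < n" "z \<in> ball 0 R" for i z
    by (rule holomorphic_ball_deriv[OF r(2)[OF that(1)]]) (use that R(3)[OF that(1)] in auto)
  have dy2: "(deriv (\<lambda>z. y z i) has_field_derivative u i) (at 0)" if "i < n" for i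
    using holomorphic_ball_deriv2[OF r(2)[OF that] r(1)[OF that]] y[OF that] by (simp add: jet2_def)
  have y0: "y 0 = 0"
  proof
    fix i show "y 0 i = 0 i" using y[of i] s(2)[of 0] s(1) by (cases "i < n") (auto simp: jet2_def Cn_def)
  qed
  have y1: "deriv (\<lambda>z. y z i) 0 = v i" if "i < n" for i
    using y[OF that] by (simp add: jet2_def)
  have chain: "((\<lambda>z. G (y z)) has_field_derivative (\<Sum>i<n. pderiv_at i G (y z) * deriv (\<lambda>z. y z i) z)) (at z)"
    if "hol_fun n (cube n e) G" "z \<in> ball 0 R" for G z
  proof -
    have "((\<lambda>z. G (y z)) has_field_derivative (\<Sum>i<n. pderiv_at i G (y z) * deriv (\<lambda>z. y z i) z)) (at z within ball 0 R)"
      by (rule hol_fun_chain[OF that(1) yc that(2)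
            has_field_derivative_at_within[OF dy[OF _ that(2)]]])
    then show ?thesis using that(2) at_within_open[of z "ball 0 R"] by simp
  qed
  show ?thesis
  proof (rule jet2I[OF R(1), of _ "\<lambda>z. \<Sum>i<n. pderiv_at i g (y z) * deriv (\<lambda>z. y z i) z"])
    fix z :: complex assume "cmod z < R"
    then show "((\<lambda>z. g (y z)) has_field_derivative (\<Sum>i<n. pderiv_at i g (y z) * deriv (\<lambda>z. y z i) z)) (at z)"
      by (intro chain[OF g]) simp
  next
    have "((\<lambda>z. \<Sum>i<n. pderiv_at i g (y z) * deriv (\<lambda>z. y z i) z) has_field_derivative
       (\<Sum>i<n. pderiv_at i g (y 0) * u i +
          (\<Sum>j<n. pderiv_at j (pderiv_at i g) (y 0) * deriv (\<lambda>z. y z j) 0) * deriv (\<lambda>z. y z i) 0)) (at 0)"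
      by (intro DERIV_sum DERIV_mult' chain hol_fun_pderiv_at g dy2) (use R in auto)
    moreover have "(\<Sum>i<n. pderiv_at i g (y 0) * u i +
          (\<Sum>j<n. pderiv_at j (pderiv_at i g) (y 0) * deriv (\<lambda>z. y z j) 0) * deriv (\<lambda>z. y z i) 0)
        = der1 n g u + der2 n g v v"
      by (simp add: y0 y1 der1_def der2_def sum.distrib sum_distrib_left sum_distrib_right mult_ac)
    ultimately show "((\<lambda>z. \<Sum>i<n. pderiv_at i g (y z) * deriv (\<lambda>z. y z i) z) has_field_derivative
        der1 n g u + der2 n g v v) (at 0)" by simp
  qed (simp_all add: y0 y1 der1_def)
qed

section \<open>Matrices and linear maps\<close>

definition lin :: "nat \<Rightarrow> nat \<Rightarrow> (nat \<Rightarrow> nat \<Rightarrow> complex) \<Rightarrow> cvec \<Rightarrow> cvec" where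
  "lin n p A x = (\<lambda>j. if j < p then \<Sum>i<n. A j i * x i else 0)"

lemma lin_in_Cn: "lin n p A x \<in> Cn p"
  by (simp add: lin_def Cn_def)

lemma lin_zero [simp]: "lin n p A 0 = 0"
  by (auto simp: lin_def)

lemma lin_add: "lin n p A (x + y) = lin n p A x + lin n p A y"
  by (auto simp: lin_def fun_eq_iff algebra_simps sum.distrib)

lemma lin_diff: "lin n p A (x - y) = lin n p A x - lin n p A y"
  by (auto simp: lin_def fun_eq_iff algebra_simps sum_subtractf)

lemma lin_scale: "lin n p A (cscale c x) = cscale c (lin n p A x)"
  by (auto simp: lin_def fun_eq_iff cscale_def algebra_simps sum_distrib_left)

lemma hol_map_lin: "hol_map n p S (lin n p A)"
  unfolding hol_map_def lin_def
  by (auto simp: Cn_def intro!: hol_fun_sum hol_fun_mult hol_fun_const hol_fun_coord)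

lemma hol_germ_lin: "hol_germ n p (lin n p A)"
  using hol_map_lin[of n p "cube n 1" A] by (auto simp: hol_germ_iff intro!: exI[of _ 1])

text \<open>
  Gaussian elimination of one equation at a time.  All dimension counts below use this form, in
  which unknowns and equations are indexed by arbitrary finite sets.
\<close>

lemma underdetermined_system:
  fixes M :: "'a \<Rightarrow> 'b \<Rightarrow> complex"
  assumes "finite J" "finite I" "card J < card I"
  shows "\<exists>c. (\<exists>i\<in>I. c i \<noteq> 0) \<and> (\<forall>j\<in>J. (\<Sum>i\<in>I. c i * M i j) = 0)"
  using assms
proof (induction J arbitrary: I M rule: finite_induct)
  case empty
  then have "I \<noteq> {}" by auto
  then show ?case by (intro exI[of _ "\<lambda>_. 1"]) auto
next
  case (insert j J)
  show ?case
  proof (cases "\<forall>i\<in>I. M i j = 0")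
    case True
    obtain c where "\<exists>i\<in>I. c i \<noteq> 0" "\<forall>j\<in>J. (\<Sum>i\<in>I. c i * M i j) = 0"
      using insert.IH[of I M] insert.prems insert.hyps by auto
    then show ?thesis using True by (intro exI[of _ c]) auto
  next
    case False
    then obtain k where k: "k \<in> I" "M k j \<noteq> 0" by blast
    define N where "N i l = M i l - M i j / M k j * M k l" for i l
    have "card J < card (I - {k})"
      using insert k by simp
    then obtain c where c: "\<exists>i\<in>I - {k}. c i \<noteq> 0" "\<forall>l\<in>J. (\<Sum>i\<in>I - {k}. c i * N i l) = 0"
      using insert.IH[of "I - {k}" N] insert.prems by auto
    define d where "d = c(k := - (\<Sum>i\<in>I - {k}. c i * (M i j / M k j)))"
    have sum: "(\<Sum>i\<in>I. d i * M i l) = (\<Sum>i\<in>I - {k}. c i * N i l)" for l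
    proof -
      have "(\<Sum>i\<in>I. d i * M i l) = d k * M k l + (\<Sum>i\<in>I - {k}. d i * M i l)"
        using k insert.prems by (simp add: sum.remove)
      also have "(\<Sum>i\<in>I - {k}. d i * M i l) = (\<Sum>i\<in>I - {k}. c i * M i l)"
        by (intro sum.cong) (auto simp: d_def)
      finally show ?thesis
        by (simp add: d_def N_def algebra_simps sum_subtractf sum_distrib_left sum_distrib_right)
    qed
    have "N i j = 0" for i using k by (simp add: N_def)
    then have "\<forall>l\<in>insert j J. (\<Sum>i\<in>I. d i * M i l) = 0"
      using sum c(2) by simp
    moreover have "\<exists>i\<in>I. d i \<noteq> 0" using c(1) by (auto simp: d_def)
    ultimately show ?thesis by blast
  qed
qed

text \<open>
  A vector y is in the image because the n columns of A and y are n + 1 vectors with n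
  coordinates, hence dependent, and y occurs in the relation by injectivity.
\<close>

lemma lin_inj_imp_inverse:
  assumes inj: "\<And>x. x \<in> Cn n \<Longrightarrow> lin n n A x = 0 \<Longrightarrow> x = 0"
  shows "\<exists>N. \<forall>x\<in>Cn n. lin n n N (lin n n A x) = x \<and> lin n n A (lin n n N x) = x"
proof -
  have surj: "\<exists>x\<in>Cn n. lin n n A x = y" if y: "y \<in> Cn n" for y
  proof -
    define M where "M i j = (if i < n then A j i else y j)" for i j
    have "\<exists>c. (\<exists>i\<in>{..n}. c i \<noteq> 0) \<and> (\<forall>j\<in>{..<n}. (\<Sum>i\<in>{..n}. c i * M i j) = 0)"
      by (rule underdetermined_system) auto
    then obtain c where c: "\<exists>i\<le>n. c i \<noteq> 0" "\<And>j. j < n \<Longrightarrow> (\<Sum>i\<le>n. c i * M i j) = 0"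
      by auto
    have s: "(\<Sum>i<n. A j i * c i) + c n * y j = 0" if "j < n" for j
      using c(2)[OF that] by (simp add: lessThan_Suc_atMost[symmetric] M_def mult.commute)
    have "c n \<noteq> 0"
    proof
      assume c0: "c n = 0"
      define x where "x = (\<lambda>i. if i < n then c i else 0)"
      have "x \<in> Cn n" by (simp add: x_def Cn_def)
      moreover have "lin n n A x = 0"
        using s c0 by (auto simp: lin_def x_def fun_eq_iff)
      ultimately have "x = 0" by (rule inj)
      then have "c i = 0" if "i < n" for i using that by (metis x_def zero_fun_apply)
      then show False using c(1) c0 by (metis le_neq_implies_less)
    qed
    define x where "x = (\<lambda>i. if i < n then - c i / c n else 0)"
    have "lin n n A x = y"
    proof
      fix j show "lin n n A x j = y j"
      proof (cases "j < n")
        case True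
        have "(\<Sum>i<n. A j i * x i) = - (\<Sum>i<n. A j i * c i) / c n"
          by (simp add: x_def sum_divide_distrib sum_negf)
        also have "\<dots> = y j" using s[OF True] \<open>c n \<noteq> 0\<close>
          by (simp add: field_simps add_eq_0_iff)
        finally show ?thesis using True by (simp add: lin_def)
      next
        case False then show ?thesis using y by (simp add: lin_def Cn_def)
      qed
    qed
    moreover have "x \<in> Cn n" by (simp add: x_def Cn_def)
    ultimately show ?thesis by blast
  qed
  have "(\<lambda>j. if j = k then 1 else 0) \<in> Cn n" if "k < n" for k
    using that by (simp add: Cn_def)
  then have "\<forall>k<n. \<exists>x\<in>Cn n. lin n n A x = (\<lambda>j. if j = k then 1 else 0)"
    by (blast intro: surj)
  then obtain X where X: "\<And>k. k < n \<Longrightarrow> X k \<in> Cn n"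
      "\<And>k. k < n \<Longrightarrow> lin n n A (X k) = (\<lambda>j. if j = k then 1 else 0)"
    by metis
  define N where "N j k = X k j" for j k
  have AN: "lin n n A (lin n n N x) = x" if x: "x \<in> Cn n" for x
  proof
    fix j show "lin n n A (lin n n N x) j = x j"
    proof (cases "j < n")
      case True
      have "lin n n A (lin n n N x) j = (\<Sum>i<n. A j i * (\<Sum>k<n. X k i * x k))"
        using True by (simp add: lin_def N_def)
      also have "\<dots> = (\<Sum>k<n. (\<Sum>i<n. A j i * X k i) * x k)"
        unfolding sum_distrib_left sum_distrib_right by (subst sum.swap) (simp add: mult.assoc)
      also have "\<dots> = (\<Sum>k<n. lin n n A (X k) j * x k)"
        using True by (simp add: lin_def)
      also have "\<dots> = (\<Sum>k<n. if k = j then x k else 0)"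
        by (intro sum.cong) (auto simp: X(2))
      finally show ?thesis using True by simp
    next
      case False then show ?thesis using x by (simp add: lin_def Cn_def)
    qed
  qed
  have "lin n n N (lin n n A x) = x" if x: "x \<in> Cn n" for x
  proof -
    have "lin n n A (lin n n N (lin n n A x) - x) = 0"
      using AN[OF lin_in_Cn] by (simp add: lin_diff)
    moreover have "lin n n N (lin n n A x) - x \<in> Cn n"
      using x lin_in_Cn[of n n N "lin n n A x"] by (auto simp: Cn_def)
    ultimately show ?thesis using inj by (metis eq_iff_diff_eq_0)
  qed
  then show ?thesis using AN by blast
qed

lemma biholo_germ_lin:
  assumes "\<And>x. x \<in> Cn n \<Longrightarrow> lin n n N (lin n n A x) = x" "\<And>x. x \<in> Cn n \<Longrightarrow> lin n n A (lin n n N x) = x"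
  shows "biholo_germ n (lin n n A)"
  unfolding biholo_germ_def
proof (intro conjI exI[of _ "lin n n N"])
  show "germ_eq n (lin n n N \<circ> lin n n A) id" "germ_eq n (lin n n A \<circ> lin n n N) id"
    using assms cube_Cn by (auto simp: germ_eq_iff intro!: exI[of _ 1])
qed (rule hol_germ_lin)+

section \<open>Differentials at the origin\<close>

lemma eventually_ray_in_cube:
  assumes "Y \<in> Cn n" "e > 0"
  shows "\<forall>\<^sub>F z in nhds 0. (\<lambda>i. Y i * z) \<in> cube n e"
proof -
  have "\<forall>\<^sub>F z in nhds 0. cmod (Y i * z) < e" for i
  proof -
    have "((\<lambda>z. cmod (Y i * z)) \<longlongrightarrow> cmod (Y i * 0)) (nhds 0)"
      by (intro tendsto_intros filterlim_ident)
    then show ?thesis using \<open>e > 0\<close> by (intro order_tendstoD) auto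
  qed
  then have "\<forall>\<^sub>F z in nhds 0. \<forall>i\<in>{..<n}. cmod (Y i * z) < e"
    by (intro eventually_ball_finite) auto
  then show ?thesis
    by eventually_elim (use assms(1) in \<open>auto simp: cube_def Cn_def\<close>)
qed

lemma jet2_ray:
  assumes g: "hol_fun n (cube n e) g" "e > 0" and Y: "Y \<in> Cn n"
  shows "jet2 (\<lambda>z. g (\<lambda>i. Y i * z)) (g 0) (der1 n g Y) (der2 n g Y Y)"
proof -
  have "jet2 (\<lambda>z. g (\<lambda>i. Y i * z)) (g 0) (der1 n g Y) (der1 n g 0 + der2 n g Y Y)"
  proof (rule jet2_compose[OF g])
    show "jet2 (\<lambda>z. Y i * z) 0 (Y i) (0 i)" for i using jet2_linear by simp
    show "\<forall>\<^sub>F z in nhds 0. (\<lambda>i. Y i * z) \<in> Cn n"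
      using Y by (auto simp: Cn_def intro!: always_eventually)
  qed
  then show ?thesis by (simp add: der1_def)
qed

lemma differential_der1:
  "differential n p f 0 v = (\<lambda>j. if j < p then der1 n (\<lambda>x. f x j) v else 0)"
  unfolding differential_def der1_def ..

lemma der1_differential: "j < p \<Longrightarrow> der1 n (\<lambda>x. f x j) v = differential n p f 0 v j"
  by (simp add: differential_der1)

lemma differential_Cn: "differential n p f 0 v \<in> Cn p"
  by (simp add: differential_def Cn_def)

lemma differential_eq_lin:
  "differential n p f 0 = lin n p (\<lambda>j i. pderiv_at i (\<lambda>x. f x j) 0)"
  by (auto simp: differential_def lin_def fun_eq_iff)

lemma jet2_germ_ray:
  assumes F: "hol_germ n m F" and v: "v \<in> Cn n" and k: "k < m"
  shows "jet2 (\<lambda>z. F (\<lambda>i. v i * z) k) 0 (differential n m F 0 v k) (der2 n (\<lambda>x. F x k) v v)"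
proof -
  obtain e where e: "e > 0" "hol_map n m (cube n e) F" "F 0 = 0"
    using F by (auto simp: hol_germ_iff)
  then have "hol_fun n (cube n e) (\<lambda>x. F x k)" using k by (simp add: hol_map_def)
  from jet2_ray[OF this e(1) v] show ?thesis using e(3) k by (simp add: differential_der1)
qed

lemma jet2_germ_compose:
  assumes F: "hol_germ n m F" and G: "hol_germ m q G" and v: "v \<in> Cn n" and j: "j < q"
  shows "jet2 (\<lambda>z. G (F (\<lambda>i. v i * z)) j) 0
    (differential m q G 0 (differential n m F 0 v) j)
    (der1 m (\<lambda>y. G y j) (\<lambda>k. der2 n (\<lambda>x. F x k) v v)
      + der2 m (\<lambda>y. G y j) (differential n m F 0 v) (differential n m F 0 v))"
proof -
  obtain e where e: "e > 0" "hol_map m q (cube m e) G" "G 0 = 0"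
    using G by (auto simp: hol_germ_iff)
  have "hol_fun m (cube m e) (\<lambda>x. G x j)" using e(2) j by (simp add: hol_map_def)
  then have "jet2 (\<lambda>z. G (F (\<lambda>i. v i * z)) j) (G 0 j)
    (der1 m (\<lambda>y. G y j) (differential n m F 0 v))
    (der1 m (\<lambda>y. G y j) (\<lambda>k. der2 n (\<lambda>x. F x k) v v)
      + der2 m (\<lambda>y. G y j) (differential n m F 0 v) (differential n m F 0 v))"
  proof (rule jet2_compose[OF _ e(1)])
    show "jet2 (\<lambda>z. F (\<lambda>i. v i * z) k) 0 (differential n m F 0 v k) (der2 n (\<lambda>x. F x k) v v)"
      if "k < m" for k by (rule jet2_germ_ray[OF F v that])
    obtain d where d: "d > 0" "hol_map n m (cube n d) F" using F by (auto simp: hol_germ_iff)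
    show "\<forall>\<^sub>F z in nhds 0. F (\<lambda>i. v i * z) \<in> Cn m"
      using eventually_ray_in_cube[OF v d(1)]
      by (rule eventually_mono) (use d(2) in \<open>auto simp: hol_map_def\<close>)
  qed
  then show ?thesis using e(3) j by (simp add: der1_differential[of j q])
qed

lemma differential_compose:
  assumes F: "hol_germ n m F" and G: "hol_germ m q G" and v: "v \<in> Cn n"
  shows "differential n q (G \<circ> F) 0 v = differential m q G 0 (differential n m F 0 v)"
proof
  fix j show "differential n q (G \<circ> F) 0 v j = differential m q G 0 (differential n m F 0 v) j"
  proof (cases "j < q")
    case True
    show ?thesis
      using jet2_unique[OF jet2_germ_ray[OF hol_germ_compose[OF F G] v True, unfolded o_def]
          jet2_germ_compose[OF F G v True]] by (simp add: o_def)
  qed (simp add: differential_def)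
qed

lemma differential_cong:
  assumes "germ_eq n f g"
  shows "differential n p f 0 = differential n p g 0"
proof -
  obtain e where "e > 0" "\<And>x. x \<in> cube n e \<Longrightarrow> f x = g x" using assms by (auto simp: germ_eq_iff)
  then have "pderiv_at i (\<lambda>x. f x j) 0 = pderiv_at i (\<lambda>x. g x j) 0" if "i < n" for i j
    using pderiv_at_cong[of n e "\<lambda>x. f x j" "\<lambda>x. g x j" 0 i] that by simp
  then show ?thesis by (simp add: differential_def fun_eq_iff)
qed

lemma differential_lin:
  assumes "v \<in> Cn n"
  shows "differential n p (lin n p A) 0 v = lin n p A v"
proof
  fix j show "differential n p (lin n p A) 0 v j = lin n p A v j"
  proof (cases "j < p")
    case True
    have "(\<lambda>z. lin n p A (\<lambda>i. v i * z) j) = (\<lambda>z. lin n p A v j * z)"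
      using True by (simp add: lin_def sum_distrib_right mult.assoc fun_eq_iff)
    then have "jet2 (\<lambda>z. lin n p A v j * z) 0 (differential n p (lin n p A) 0 v j) (der2 n (\<lambda>x. lin n p A x j) v v)"
      using jet2_germ_ray[OF hol_germ_lin[of n p A] assms True] by simp
    from jet2_unique[OF this jet2_linear] show ?thesis by simp
  qed (simp add: differential_def lin_def)
qed

lemma embedding_germD:
  assumes "embedding_germ n p h"
  shows "hol_germ n p h" "\<And>v. v \<in> Cn n \<Longrightarrow> differential n p h 0 v = 0 \<Longrightarrow> v = 0"
proof -
  obtain U where U: "h 0 = 0" "open U" "0 \<in> U" "hol_map n p (U \<inter> Cn n) h"
     "\<And>a. a \<in> U \<inter> Cn n \<Longrightarrow> inj_on (differential n p h a) (Cn n)"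
    using assms by (auto simp: embedding_germ_def)
  show "hol_germ n p h" using U by (auto simp: hol_germ_def)
  fix v assume v: "v \<in> Cn n" "differential n p h 0 v = 0"
  have z: "(0::cvec) \<in> Cn n" by (simp add: Cn_def)
  have inj: "inj_on (differential n p h 0) (Cn n)" using U(3,5) z by blast
  have "differential n p h 0 0 = 0" unfolding differential_eq_lin by (rule lin_zero)
  then have "differential n p h 0 v = differential n p h 0 0" using v(2) by (simp only:)
  then show "v = 0" by (rule inj_onD[OF inj _ v(1) z])
qed

section \<open>The inverse function theorem\<close>

lemma hol_fun_small:
  assumes g: "hol_fun n (cube n e) g" and e: "e > 0" and "g 0 = 0" and "d > 0"
  shows "\<exists>e'>0. e' \<le> e \<and> (\<forall>x\<in>cube n e'. cmod (g x) < d)"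
proof -
  define F where "F x = (\<lambda>k::nat. if k = 0 then g x else 0)" for x
  have "hol_map n 1 (cube n e) F" using g by (auto simp: hol_map_def F_def Cn_def)
  moreover have "F 0 = 0" using \<open>g 0 = 0\<close> by (auto simp: F_def)
  ultimately obtain e' where "e' > 0" "e' \<le> e" "F ` cube n e' \<subseteq> cube 1 d"
    using hol_map_shrink e \<open>d > 0\<close> by blast
  then show ?thesis by (intro exI[of _ e']) (auto simp: F_def cube_def image_subset_iff)
qed

lemma cube_segment:
  assumes "x \<in> cube n e" "y \<in> cube n e" "z \<in> closed_segment 0 (1::complex)"
  shows "(\<lambda>i. y i + z * (x i - y i)) \<in> cube n e"
proof -
  obtain t where t: "0 \<le> t" "t \<le> 1" "z = of_real t"
    using assms(3) by (auto simp: in_segment scaleR_conv_of_real)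
  have "cmod (y i + z * (x i - y i)) < e" if "i < n" for i
  proof -
    have "y i + z * (x i - y i) = (1 - t) *\<^sub>R y i + t *\<^sub>R x i"
      by (simp add: t scaleR_conv_of_real algebra_simps)
    moreover have "(1 - t) *\<^sub>R y i + t *\<^sub>R x i \<in> ball 0 e"
      using convexD[OF convex_ball, of "y i" 0 e "x i" "1 - t" t] t cube_less[OF assms(1) that] cube_less[OF assms(2) that]
      by simp
    ultimately show ?thesis by simp
  qed
  then show ?thesis using assms by (auto simp: cube_def Cn_def)
qed

lemma hol_fun_lipschitz:
  assumes g: "hol_fun n (cube n e) g"
    and B: "\<And>x i. x \<in> cube n e \<Longrightarrow> i < n \<Longrightarrow> cmod (pderiv_at i g x) \<le> B"
    and x: "x \<in> cube n e" and y: "y \<in> cube n e"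
    and d: "\<And>i. i < n \<Longrightarrow> cmod (x i - y i) \<le> d"
  shows "cmod (g x - g y) \<le> real n * (B * d)"
proof -
  let ?S = "closed_segment 0 (1::complex)"
  define X where "X z = (\<lambda>i. y i + z * (x i - y i))" for z
  have "cmod (g (X 1) - g (X 0)) \<le> real n * (B * d) * cmod (1 - 0)"
  proof (rule field_differentiable_bound)
    fix z assume z: "z \<in> ?S"
    show "((\<lambda>z. g (X z)) has_field_derivative (\<Sum>i<n. pderiv_at i g (X z) * (x i - y i))) (at z within ?S)"
    proof (rule hol_fun_chain[OF g _ z])
      show "X z \<in> cube n e" if "z \<in> ?S" for z
        unfolding X_def by (rule cube_segment[OF x y that])
    qed (auto simp: X_def intro!: derivative_eq_intros)
    have "cmod (\<Sum>i<n. pderiv_at i g (X z) * (x i - y i)) \<le> (\<Sum>i<n. B * d)"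
    proof (rule sum_norm_le)
      fix i assume "i \<in> {..<n}"
      then have i: "i < n" by simp
      have "X z \<in> cube n e" unfolding X_def by (rule cube_segment[OF x y z])
      then show "cmod (pderiv_at i g (X z) * (x i - y i)) \<le> B * d"
        using B[of "X z" i] d[OF i] i norm_ge_zero[of "x i - y i"] norm_ge_zero[of "pderiv_at i g (X z)"]
        unfolding norm_mult by (intro mult_mono) linarith+
    qed
    then show "cmod (\<Sum>i<n. pderiv_at i g (X z) * (x i - y i)) \<le> real n * (B * d)" by simp
  qed auto
  then show ?thesis by (simp add: X_def)
qed

text \<open>
  Write \<open>g = id - r\<close>.  The partial derivatives of r vanish at 0, so r contracts distances by one
  half on a small polydisc, and \<open>g x = y\<close> is solved by the iteration \<open>x \<mapsto> y + r x\<close>.  The iterates are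
  holomorphic in y and converge uniformly, hence so is their limit.
\<close>

lemma biholo_germ_near_id:
  assumes g: "hol_germ n n g"
    and D: "\<And>i j. i < n \<Longrightarrow> j < n \<Longrightarrow> pderiv_at i (\<lambda>x. g x j) 0 = (if i = j then 1 else 0)"
  shows "biholo_germ n g"
proof -
  obtain e0 where e0: "e0 > 0" "hol_map n n (cube n e0) g" and g0: "g 0 = 0"
    using g by (auto simp: hol_germ_iff)
  define r where "r x j = x j - g x j" for x :: cvec and j
  have rhol0: "hol_fun n (cube n e0) (\<lambda>x. r x j)" if "j < n" for j
    unfolding r_def using e0 that by (intro hol_fun_diff hol_fun_coord) (auto simp: hol_map_def)
  have r0: "r 0 j = 0" for j by (simp add: r_def g0)
  define B where "B = 1 / (2 * real (n + 1))"
  have B: "B > 0" "real n * (B * d) \<le> d / 2" if "d \<ge> 0" for d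
    using that by (auto simp: B_def field_simps)
  have Dr: "pderiv_at i (\<lambda>x. r x j) 0 = 0" if "i < n" "j < n" for i j
  proof -
    have "((\<lambda>z. g (0(i := z)) j) has_field_derivative pderiv_at i (\<lambda>x. g x j) (0(i := 0))) (at 0)"
      by (rule hol_fun_slice_deriv[OF _ zero_in_cube[OF e0(1)] that(1)])
        (use e0 that in \<open>auto simp: hol_map_def\<close>)
    moreover have "(0::cvec)(i := 0) = 0" by (auto simp: fun_eq_iff)
    ultimately have 1: "((\<lambda>z. g (0(i := z)) j) has_field_derivative (if i = j then 1 else 0)) (at 0)"
      using D[OF that] by simp
    have 2: "((\<lambda>z. (0(i := z)) j) has_field_derivative (if i = j then 1 else 0)) (at (0::complex))"
      by (cases "i = j") (auto intro!: derivative_eq_intros)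
    have "((\<lambda>z. r (0(i := z)) j) has_field_derivative 0) (at 0)"
      unfolding r_def using DERIV_diff[OF 2 1] by simp
    then show ?thesis by (simp add: pderiv_at_def DERIV_imp_deriv)
  qed
  have "\<exists>E. \<forall>i<n. \<forall>j<n. E i j > 0 \<and> E i j \<le> e0 \<and> (\<forall>x\<in>cube n (E i j). cmod (pderiv_at i (\<lambda>x. r x j) x) < B)"
  proof -
    have "\<exists>e>0. e \<le> e0 \<and> (\<forall>x\<in>cube n e. cmod (pderiv_at i (\<lambda>x. r x j) x) < B)" if "i < n" "j < n" for i j
      by (rule hol_fun_small[OF hol_fun_pderiv_at[OF rhol0] e0(1) Dr]) (use that B in auto)
    then show ?thesis by metis
  qed
  then obtain E where E: "\<And>i j. i < n \<Longrightarrow> j < n \<Longrightarrow> E i j > 0 \<and> E i j \<le> e0 \<and>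
      (\<forall>x\<in>cube n (E i j). cmod (pderiv_at i (\<lambda>x. r x j) x) < B)" by blast
  define e where "e = Min (insert e0 ((\<lambda>(i,j). E i j) ` ({..<n} \<times> {..<n})))"
  have e: "e > 0" "e \<le> e0" using E e0 by (auto simp: e_def)
  have eE: "e \<le> E i j" if "i < n" "j < n" for i j
    unfolding e_def using that by (intro Min_le) (auto intro!: image_eqI[of _ _ "(i,j)"])
  have rhol: "hol_fun n (cube n e) (\<lambda>x. r x j)" if "j < n" for j
    by (rule hol_fun_subset[OF rhol0[OF that] cube_mono[OF e(2)]])
  have lip: "cmod (r x j - r y j) \<le> d / 2"
    if "x \<in> cube n e" "y \<in> cube n e" "j < n" "\<And>i. i < n \<Longrightarrow> cmod (x i - y i) \<le> d" "d \<ge> 0" for x y j d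
  proof -
    have "cmod (r x j - r y j) \<le> real n * (B * d)"
    proof (rule hol_fun_lipschitz[OF rhol[OF that(3)] _ that(1,2,4)])
      fix x i assume "x \<in> cube n e" "i < n"
      then have "x \<in> cube n (E i j)" using cube_mono[OF eE] that(3) by blast
      then show "cmod (pderiv_at i (\<lambda>x. r x j) x) \<le> B"
        using E[OF \<open>i < n\<close> that(3)] by (simp add: less_imp_le)
    qed
    then show ?thesis using B(2)[OF that(5)] by linarith
  qed
  \<comment> \<open>g is injective: a difference d of two solutions would satisfy d <= d / 2\<close>
  have ginj: "x = y" if "x \<in> cube n e" "y \<in> cube n e" "g x = g y" for x y
  proof -
    define d where "d = Max (insert 0 ((\<lambda>i. cmod (x i - y i)) ` {..<n}))"
    have d: "d \<ge> 0" "\<And>i. i < n \<Longrightarrow> cmod (x i - y i) \<le> d" by (auto simp: d_def)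
    have "r x i - r y i = x i - y i" for i using that(3) by (simp add: r_def)
    then have "cmod (x i - y i) \<le> d / 2" if "i < n" for i
      using lip[OF \<open>x \<in> cube n e\<close> \<open>y \<in> cube n e\<close> that d(2,1)] by simp
    then have "d \<le> d / 2" using d(1) unfolding d_def by (subst Max_le_iff) auto
    then have "d = 0" using d(1) by simp
    then have "x i = y i" if "i < n" for i using d(2)[OF that] by simp
    then show "x = y" using cube_Cn[OF that(1)] cube_Cn[OF that(2)]
      by (intro ext) (metis (mono_tags, lifting) Cn_def leI mem_Collect_eq)
  qed
  define u where "u m y = rec_nat (\<lambda>_. 0) (\<lambda>_ w i. if i < n then y i + r w i else 0) m" for m :: nat and y :: cvec
  have u0: "u 0 y = 0" for y by (auto simp: u_def)
  have uS: "u (Suc m) y = (\<lambda>i. if i < n then y i + r (u m y) i else 0)" for m y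
    unfolding u_def by simp
  let ?Q = "cube n (e / 4)"
  have ub: "u m y \<in> cube n e \<and> (\<forall>i<n. cmod (u m y i) \<le> e / 2)" if y: "y \<in> ?Q" for m y
  proof (induction m)
    case 0 then show ?case using e by (simp add: u0)
  next
    case (Suc m)
    have "cmod (u (Suc m) y i) \<le> e / 2" if i: "i < n" for i
    proof -
      have "cmod (r (u m y) i - r 0 i) \<le> (e / 2) / 2"
        by (rule lip) (use Suc e i in auto)
      then show ?thesis
        using norm_triangle_ineq[of "y i" "r (u m y) i"] cube_less[OF y i] i by (simp add: uS r0)
    qed
    then show ?case using e by (force simp: cube_def Cn_def uS)
  qed
  have ud: "cmod (u (Suc m) y i - u m y i) \<le> e * (1/2)^m" if y: "y \<in> ?Q" and i: "i < n" for m y i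
    using i
  proof (induction m arbitrary: i)
    case 0 then show ?case using cube_less[OF y 0] e by (simp add: uS u0 r0)
  next
    case (Suc m)
    have "cmod (r (u (Suc m) y) i - r (u m y) i) \<le> e * (1/2)^m / 2"
      by (rule lip) (use ub[OF y] Suc e in auto)
    then show ?case using Suc.prems by (simp add: uS[of "Suc m"] uS[of m])
  qed
  define k where "k y = (\<lambda>i. if i < n then suminf (\<lambda>m. u (Suc m) y i - u m y i) else 0)" for y
  have lim: "uniform_limit ?Q (\<lambda>m y. u m y i) (\<lambda>y. k y i) sequentially" if i: "i < n" for i
  proof -
    have "uniform_limit ?Q (\<lambda>m y. \<Sum>j<m. u (Suc j) y i - u j y i) (\<lambda>y. suminf (\<lambda>j. u (Suc j) y i - u j y i)) sequentially"
    proof (rule Weierstrass_m_test)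
      show "summable (\<lambda>m. e * (1/2::real)^m)" by (intro summable_mult summable_geometric) simp
    qed (use ud i in auto)
    moreover have "(\<Sum>j<m. u (Suc j) y i - u j y i) = u m y i" for m y
      using sum_lessThan_telescope[of "\<lambda>j. u j y i" m] by (simp add: u0)
    ultimately show ?thesis using i by (simp add: k_def)
  qed
  have limp: "(\<lambda>m. u m y i) \<longlonglongrightarrow> k y i" if "y \<in> ?Q" for y i
  proof (cases "i < n")
    case True then show ?thesis using tendsto_uniform_limitI[OF lim that] by simp
  next
    case False
    have "u m y i = 0" for m using False by (cases m) (simp_all add: u0 uS)
    then show ?thesis using False by (simp add: k_def)
  qed
  have kcube: "k y \<in> cube n e" if "y \<in> ?Q" for y
  proof -
    have "cmod (k y i) \<le> e / 2" if i: "i < n" for i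
      by (rule tendsto_upperbound[OF tendsto_norm[OF limp[OF \<open>y \<in> ?Q\<close>]]])
        (use ub[OF \<open>y \<in> ?Q\<close>] i in auto)
    then show ?thesis using e by (force simp: cube_def Cn_def k_def)
  qed
  have gk: "g (k y) = y" if y: "y \<in> ?Q" for y
  proof
    fix j show "g (k y) j = y j"
    proof (cases "j < n")
      case True
      have c: "continuous_on (cube n e) (\<lambda>x. r x j)" using rhol[OF True] by (simp add: hol_fun_def)
      have "(\<lambda>m. u m y) \<longlonglongrightarrow> k y" by (rule tendsto_cvecI) (rule limp[OF y])
      then have "(\<lambda>m. r (u m y) j) \<longlonglongrightarrow> r (k y) j"
        by (rule continuous_on_tendsto_compose[OF c _ kcube[OF y]]) (use ub[OF y] in auto)
      then have "(\<lambda>m. y j + r (u m y) j) \<longlonglongrightarrow> y j + r (k y) j" by (intro tendsto_intros)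
      moreover have "(\<lambda>m. u (Suc m) y j) \<longlonglongrightarrow> k y j" by (rule LIMSEQ_Suc[OF limp[OF y]])
      ultimately have "k y j = y j + r (k y) j" using True by (simp add: uS LIMSEQ_unique)
      then show ?thesis by (simp add: r_def)
    next
      case False
      have "k y \<in> cube n e0" using kcube[OF y] cube_mono[OF e(2)] by blast
      then have "g (k y) \<in> Cn n" using e0(2) by (auto simp: hol_map_def)
      then show ?thesis using False cube_Cn[OF y] by (simp add: Cn_def)
    qed
  qed
  have k0: "k 0 = 0"
    using ginj[OF kcube, of 0 0] gk[of 0] e g0 by simp
  have uhol: "hol_map n n ?Q (u m)" for m
  proof (induction m)
    case 0 then show ?case by (auto simp: hol_map_def u0 hol_fun_const Cn_def)
  next
    case (Suc m)
    have "hol_fun n ?Q (\<lambda>y. r (u m y) j)" if "j < n" for j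
      by (rule hol_fun_compose[OF rhol[OF that] Suc]) (use ub in auto)
    then show ?case
      by (auto simp: hol_map_def uS Cn_def intro!: hol_fun_add hol_fun_coord)
  qed
  have khol: "hol_map n n ?Q k"
    unfolding hol_map_def
  proof (intro conjI allI impI)
    show "k ` ?Q \<subseteq> Cn n" by (auto simp: k_def Cn_def)
    fix j assume j: "j < n"
    have uj: "hol_fun n ?Q (\<lambda>y. u m y j)" for m using uhol[of m] j by (simp add: hol_map_def)
    show "hol_fun n ?Q (\<lambda>y. k y j)"
      unfolding hol_fun_def
    proof (intro conjI ballI allI impI)
      show "continuous_on ?Q (\<lambda>y. k y j)"
        by (rule uniform_limit_theorem[OF _ lim[OF j]]) (use uj in \<open>auto simp: hol_fun_def\<close>)
      fix a i assume a: "a \<in> ?Q" and i: "i < n"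
      have "(\<lambda>z. k (a(i := z)) j) holomorphic_on ball 0 (e/4)"
      proof (rule holomorphic_uniform_sequence)
        show "(\<lambda>z. u m (a(i := z)) j) holomorphic_on ball 0 (e/4)" for m
          by (rule hol_fun_slice[OF uj a i])
        fix x :: complex assume x: "x \<in> ball 0 (e/4)"
        then obtain d where d: "d > 0" "cball x d \<subseteq> ball 0 (e/4)"
          using open_contains_cball[of "ball 0 (e/4)"] open_ball by blast
        have "uniform_limit (cball x d) (\<lambda>m z. u m (a(i := z)) j) (\<lambda>z. k (a(i := z)) j) sequentially"
          by (rule uniform_limit_compose'[OF lim[OF j]]) (use d cube_upd[OF a i] in auto)
        then show "\<exists>d>0. cball x d \<subseteq> ball 0 (e/4) \<and>
           uniform_limit (cball x d) (\<lambda>m z. u m (a(i := z)) j) (\<lambda>z. k (a(i := z)) j) sequentially"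
          using d by blast
      qed auto
      then show "(\<lambda>z. k (a(i := z)) j) field_differentiable at (a i)"
        using cube_less[OF a i] by (auto simp: holomorphic_on_open field_differentiable_def)
    qed
  qed
  have "hol_germ n n k" using khol k0 e by (auto simp: hol_germ_iff intro!: exI[of _ "e/4"])
  moreover have "germ_eq n (g \<circ> k) id"
    using gk e by (auto simp: germ_eq_iff intro!: exI[of _ "e/4"])
  moreover have "germ_eq n (k \<circ> g) id"
  proof -
    have "e / 4 > 0" using e by simp
    then obtain e1 where e1: "e1 > 0" "g ` cube n e1 \<subseteq> ?Q"
      using hol_germ_bound[OF g] by blast
    have "k (g x) = x" if "x \<in> cube n (min e e1)" for x
    proof -
      have x: "x \<in> cube n e" "x \<in> cube n e1" using that by (auto simp: cube_def)
      then have gx: "g x \<in> ?Q" using e1 by blast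
      show ?thesis by (rule ginj[OF kcube[OF gx] x(1) gk[OF gx]])
    qed
    then show ?thesis using e e1 by (auto simp: germ_eq_iff intro!: exI[of _ "min e e1"])
  qed
  ultimately show ?thesis using g by (auto simp: biholo_germ_def)
qed

theorem biholo_germ_inverse_function:
  assumes g: "hol_germ n n g"
    and inj: "\<And>v. v \<in> Cn n \<Longrightarrow> differential n n g 0 v = 0 \<Longrightarrow> v = 0"
  shows "biholo_germ n g"
proof -
  define A where "A j i = pderiv_at i (\<lambda>x. g x j) 0" for j i
  have dA: "differential n n g 0 = lin n n A" unfolding differential_eq_lin A_def ..
  obtain N where N: "\<And>x. x \<in> Cn n \<Longrightarrow> lin n n N (lin n n A x) = x"
      "\<And>x. x \<in> Cn n \<Longrightarrow> lin n n A (lin n n N x) = x"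
  proof -
    have "x = 0" if "x \<in> Cn n" "lin n n A x = 0" for x
      using inj[OF that(1)] that(2) unfolding dA .
    then obtain N where "\<forall>x\<in>Cn n. lin n n N (lin n n A x) = x \<and> lin n n A (lin n n N x) = x"
      using lin_inj_imp_inverse[of n A] by metis
    then show ?thesis by (intro that[of N]) auto
  qed
  obtain e where e: "e > 0" "hol_map n n (cube n e) g" using g by (auto simp: hol_germ_iff)
  have "biholo_germ n (lin n n N \<circ> g)"
  proof (rule biholo_germ_near_id)
    show "hol_germ n n (lin n n N \<circ> g)" by (rule hol_germ_compose[OF g hol_germ_lin])
    fix i j assume i: "i < n" and j: "j < n"
    define E where "E = (\<lambda>k. if k = i then 1 else 0 :: complex)"
    have E: "E \<in> Cn n" using i by (auto simp: E_def Cn_def)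
    have "pderiv_at i (\<lambda>x. (lin n n N \<circ> g) x j) 0 = differential n n (lin n n N \<circ> g) 0 E j"
      using i j by (simp add: differential_def E_def if_distrib cong: if_cong)
    also have "\<dots> = lin n n N (lin n n A E) j"
      unfolding differential_compose[OF g hol_germ_lin E] dA differential_lin[OF lin_in_Cn] ..
    also have "\<dots> = (if i = j then 1 else 0)" by (simp add: N E) (simp add: E_def)
    finally show "pderiv_at i (\<lambda>x. (lin n n N \<circ> g) x j) 0 = (if i = j then 1 else 0)" .
  qed
  moreover have "biholo_germ n (lin n n A)"
    by (rule biholo_germ_lin[of n N]) (use N in auto)
  ultimately have "biholo_germ n (lin n n A \<circ> (lin n n N \<circ> g))"
    by (rule biholo_germ_compose[rotated])
  moreover have "germ_eq n (lin n n A \<circ> (lin n n N \<circ> g)) g"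
    using e N(2) by (auto simp: germ_eq_iff hol_map_def image_subset_iff intro!: exI[of _ e])
  ultimately show ?thesis by (rule biholo_germ_cong)
qed

section \<open>What stability says to second order\<close>

lemma unfolding_of_cube:
  assumes "unfolding_of r n p f F"
  shows "\<exists>e>0. (\<forall>t\<in>cube r e. \<forall>x\<in>cube n e. \<forall>i<r. F (join r t x) i = t i) \<and>
               (\<forall>x\<in>cube n e. F (join r 0 x) = join r 0 (f x))"
proof -
  obtain ft :: "cvec \<Rightarrow> cvec \<Rightarrow> cvec" where ft: "germ_eq n (ft 0) f"
    "\<forall>\<^sub>F (t, x) in nhds (0, 0). t \<in> Cn r \<longrightarrow> x \<in> Cn n \<longrightarrow> F (join r t x) = join r t (ft t x)"
    using assms by (auto simp: unfolding_of_def)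
  obtain P Q where PQ: "\<forall>\<^sub>F t in nhds 0. P t" "\<forall>\<^sub>F x in nhds 0. Q x"
    "\<And>t x. P t \<Longrightarrow> Q x \<Longrightarrow> t \<in> Cn r \<Longrightarrow> x \<in> Cn n \<Longrightarrow> F (join r t x) = join r t (ft t x)"
    using ft(2) unfolding nhds_prod eventually_prod_filter by auto
  obtain e1 where e1: "e1 > 0" "\<forall>t\<in>cube r e1. P t"
    using eventually_Cn_iff[of r P] eventually_mono[OF PQ(1), of "\<lambda>t. t \<in> Cn r \<longrightarrow> P t"] by auto
  obtain e2 where e2: "e2 > 0" "\<forall>x\<in>cube n e2. Q x"
    using eventually_Cn_iff[of n Q] eventually_mono[OF PQ(2), of "\<lambda>x. x \<in> Cn n \<longrightarrow> Q x"] by auto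
  obtain e3 where e3: "e3 > 0" "\<forall>x\<in>cube n e3. ft 0 x = f x"
    using ft(1) by (auto simp: germ_eq_iff)
  define e where "e = min e1 (min e2 e3)"
  have e: "e > 0" using e1 e2 e3 by (simp add: e_def)
  have F: "F (join r t x) = join r t (ft t x)" if "t \<in> cube r e" "x \<in> cube n e" for t x
  proof -
    have "t \<in> cube r e1" "x \<in> cube n e2" using that by (auto simp: cube_def e_def)
    then show ?thesis using PQ(3) e1 e2 cube_Cn by blast
  qed
  have "F (join r 0 x) = join r 0 (f x)" if x: "x \<in> cube n e" for x
  proof -
    have "x \<in> cube n e3" using x by (auto simp: cube_def e_def)
    then show ?thesis using F[OF zero_in_cube[OF e] x] e3(2) by simp
  qed
  moreover have "F (join r t x) i = t i" if "t \<in> cube r e" "x \<in> cube n e" "i < r" for t x i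
    using F[OF that(1,2)] that(3) by (simp add: join_def)
  ultimately show ?thesis using e by blast
qed

lemma cube_Suc_join:
  assumes "y \<in> cube (1 + n) e"
  shows "(\<lambda>i. y (Suc i)) \<in> cube n e" "(\<lambda>i. if i = 0 then y 0 else 0) \<in> cube 1 e"
    "y = join 1 (\<lambda>i. if i = 0 then y 0 else 0) (\<lambda>i. y (Suc i))"
  using assms by (auto simp: cube_def Cn_def join_def fun_eq_iff)

lemma hol_map_shift: "hol_map (1 + n) n (cube (1 + n) e) (\<lambda>y i. y (Suc i))"
  unfolding hol_map_def using cube_Cn[OF cube_Suc_join(1)[of _ n e]]
  by (auto simp: hol_fun_coord)

text \<open>
  To first order an unfolding of the identity moves a point only in proportion to the parameter:
  the block of partial derivatives in the space directions is the identity matrix.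
\<close>

lemma unfolding_id_derivs:
  assumes "hol_germ (1 + n) (1 + n) \<Phi>" "unfolding_of 1 n n id \<Phi>"
  shows "\<exists>e>0. \<forall>y\<in>cube (1 + n) e. \<Phi> y 0 = y 0"
    and "i < n \<Longrightarrow> k < n \<Longrightarrow> pderiv_at (Suc i) (\<lambda>y. \<Phi> y (Suc k)) 0 = (if i = k then 1 else 0)"
proof -
  obtain e where e: "e > 0" "\<And>t x. t \<in> cube 1 e \<Longrightarrow> x \<in> cube n e \<Longrightarrow> \<Phi> (join 1 t x) 0 = t 0"
     "\<And>x. x \<in> cube n e \<Longrightarrow> \<Phi> (join 1 0 x) = join 1 0 x"
    using unfolding_of_cube[OF assms(2)] by auto
  have "\<Phi> y 0 = y 0" if y: "y \<in> cube (1 + n) e" for y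
    using e(2)[OF cube_Suc_join(2)[OF y] cube_Suc_join(1)[OF y]] cube_Suc_join(3)[OF y] by simp
  then show "\<exists>e>0. \<forall>y\<in>cube (1 + n) e. \<Phi> y 0 = y 0" using e(1) by blast
  assume i: "i < n" and k: "k < n"
  have "\<forall>\<^sub>F z in nhds 0. \<Phi> (0(Suc i := z)) (Suc k) = (if i = k then z else 0)"
    unfolding eventually_nhds
  proof (intro exI[of _ "ball 0 e"] conjI ballI)
    fix z :: complex assume z: "z \<in> ball 0 e"
    have "0(Suc i := z) = join 1 0 (0(i := z))" by (auto simp: join_def fun_eq_iff)
    moreover have "0(i := z) \<in> cube n e"
      using cube_upd[OF zero_in_cube[OF e(1)] i] z by simp
    ultimately show "\<Phi> (0(Suc i := z)) (Suc k) = (if i = k then z else 0)"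
      using e(3) by (simp add: join_def)
  qed (use e in auto)
  then have "deriv (\<lambda>z. \<Phi> (0(Suc i := z)) (Suc k)) 0 = deriv (\<lambda>z. if i = k then z else 0) 0"
    by (rule deriv_cong_ev) simp
  then show "pderiv_at (Suc i) (\<lambda>y. \<Phi> y (Suc k)) 0 = (if i = k then 1 else 0)"
    by (cases "i = k") (simp_all add: pderiv_at_def)
qed

definition linear_perturbation ::
  "nat \<Rightarrow> nat \<Rightarrow> (cvec \<Rightarrow> cvec) \<Rightarrow> (nat \<Rightarrow> nat \<Rightarrow> complex) \<Rightarrow> cvec \<Rightarrow> cvec" where
  "linear_perturbation n p f A y =
     join 1 y (\<lambda>j. f (\<lambda>i. y (Suc i)) j + y 0 * lin n p A (\<lambda>i. y (Suc i)) j)"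

lemma unfolding_linear_perturbation:
  assumes f: "hol_germ n p f"
  shows "unfolding_of 1 n p f (linear_perturbation n p f A)"
  unfolding unfolding_of_def
proof (intro conjI exI[of _ "\<lambda>t x j. f x j + t 0 * lin n p A x j"])
  let ?F = "linear_perturbation n p f A"
  obtain e where e: "e > 0" "hol_map n p (cube n e) f" "f 0 = 0"
    using f by (auto simp: hol_germ_iff)
  have "hol_map (1 + n) (1 + p) (cube (1 + n) e) ?F"
    unfolding hol_map_def
  proof (intro conjI allI impI subsetI)
    fix Y assume "Y \<in> ?F ` cube (1 + n) e"
    then obtain y where y: "y \<in> cube (1 + n) e" "Y = ?F y" by blast
    have "f (\<lambda>i. y (Suc i)) \<in> Cn p" using cube_Suc_join(1)[OF y(1)] e(2) by (auto simp: hol_map_def)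
    then show "Y \<in> Cn (1 + p)"
      using lin_in_Cn[of n p A] by (auto simp: y(2) linear_perturbation_def join_def Cn_def)
  next
    fix j assume j: "j < 1 + p"
    have shift: "hol_fun (1 + n) (cube (1 + n) e) (\<lambda>y. H (\<lambda>i. y (Suc i)))"
      if "hol_fun n (cube n e) H" for H
      by (rule hol_fun_compose[OF that hol_map_shift]) (use cube_Suc_join(1)[of _ n e] in auto)
    show "hol_fun (1 + n) (cube (1 + n) e) (\<lambda>y. ?F y j)"
    proof (cases j)
      case 0
      then show ?thesis by (simp add: linear_perturbation_def join_def hol_fun_coord)
    next
      case (Suc k)
      then have "hol_fun n (cube n e) (\<lambda>x. f x k)" "hol_fun n (cube n e) (\<lambda>x. lin n p A x k)"
        using j e(2) hol_map_lin[of n p "cube n e" A] by (auto simp: hol_map_def)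
      from hol_fun_add[OF shift[OF this(1)] hol_fun_mult[OF hol_fun_coord[of _ _ 0] shift[OF this(2)]]]
      show ?thesis using Suc by (simp add: linear_perturbation_def join_def)
    qed
  qed
  moreover have "?F 0 = 0"
  proof -
    have "f (\<lambda>_. 0) = (\<lambda>_. 0)" using e(3) by (simp add: zero_fun_def)
    then show ?thesis by (auto simp: linear_perturbation_def join_def e(3) fun_eq_iff)
  qed
  ultimately show "hol_germ (1 + n) (1 + p) ?F" using e(1) by (auto simp: hol_germ_iff)
  show "germ_eq n (\<lambda>x j. f x j + 0 0 * lin n p A x j) f"
    by (auto simp: germ_eq_iff intro!: exI[of _ 1])
  show "\<forall>\<^sub>F (t, x) in nhds (0, 0). t \<in> Cn 1 \<longrightarrow> x \<in> Cn n \<longrightarrow>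
      ?F (join 1 t x) = join 1 t (\<lambda>j. f x j + t 0 * lin n p A x j)"
    by (auto simp: linear_perturbation_def join_def intro!: always_eventually)
qed

text \<open>
  Let \<open>\<Phi>\<close> and \<open>\<Psi>\<close> trivialise the linear unfolding \<open>F\<close>.  Both sides of \<open>F = \<Psi> \<circ> (id \<times> f) \<circ> \<Phi>\<close> are
  evaluated on the curve \<open>z \<mapsto> (z, z \<beta> w)\<close>.  Because w lies in the kernel of the differential of f,
  the first derivative of the curve \<open>(id \<times> f) \<circ> \<Phi>\<close> does not depend on \<open>\<beta>\<close>; hence all of the unknown
  second-order behaviour of \<open>\<Psi>\<close> enters through a constant C independent of \<open>\<beta>\<close>.  It disappears when
  the second derivatives for \<open>\<beta> = 1\<close> and \<open>\<beta> = -1\<close> are subtracted.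
\<close>

theorem stable_second_order:
  assumes f: "hol_germ n p f" and st: "stable_germ n p f"
  shows "\<exists>v\<in>Cn n. \<forall>w\<in>Cn n. (\<forall>k<p. der1 n (\<lambda>x. f x k) w = 0) \<longrightarrow>
    (\<forall>j<p. (\<forall>u. der1 n (\<lambda>x. f x j) u = 0) \<longrightarrow>
       2 * lin n p A w j = der2 n (\<lambda>x. f x j) v w + der2 n (\<lambda>x. f x j) w v)"
proof -
  let ?F = "linear_perturbation n p f A"
  obtain \<Phi> \<Psi> where \<Phi>: "hol_germ (1 + n) (1 + n) \<Phi>" "unfolding_of 1 n n id \<Phi>"
    and \<Psi>: "hol_germ (1 + p) (1 + p) \<Psi>" "unfolding_of 1 p p id \<Psi>"
    and eq: "germ_eq (1 + n) ?F (\<Psi> \<circ> id_times 1 f \<circ> \<Phi>)"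
    using st unfolding_linear_perturbation[OF f, of A]
    unfolding stable_germ_def trivial_unfolding_def A_equiv_via_def biholo_germ_def by blast
  obtain ef where ef: "ef > 0" "hol_map n p (cube n ef) f" "f 0 = 0"
    using f by (auto simp: hol_germ_iff)
  obtain eP where eP: "eP > 0" "hol_map (1 + p) (1 + p) (cube (1 + p) eP) \<Psi>" "\<Psi> 0 = 0"
    using \<Psi>(1) by (auto simp: hol_germ_iff)
  obtain e1 where e1: "e1 > 0" "hol_map (1 + n) (1 + n) (cube (1 + n) e1) \<Phi>"
      "\<Phi> ` cube (1 + n) e1 \<subseteq> cube (1 + n) ef"
    using hol_germ_bound[OF \<Phi>(1) ef(1)] by blast
  obtain e2 where e2: "e2 > 0" "\<And>y. y \<in> cube (1 + n) e2 \<Longrightarrow> \<Phi> y 0 = y 0"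
    using unfolding_id_derivs(1)[OF \<Phi>] by blast
  obtain e3 where e3: "e3 > 0" "\<And>y. y \<in> cube (1 + n) e3 \<Longrightarrow> ?F y = \<Psi> (id_times 1 f (\<Phi> y))"
    using eq by (auto simp: germ_eq_iff)
  have \<Phi>0: "\<Phi> 0 = 0" using \<Phi>(1) by (simp add: hol_germ_iff)
  \<comment> \<open>the velocity of the origin under the trivialisation of the source\<close>
  define v where "v k = (if k < n then pderiv_at 0 (\<lambda>y. \<Phi> y (Suc k)) 0 else 0)" for k
  have vC: "v \<in> Cn n" by (simp add: v_def Cn_def)
  show ?thesis
  proof (intro bexI[of _ v] ballI impI allI)
    fix w j assume w: "w \<in> Cn n" and ker: "\<forall>k<p. der1 n (\<lambda>x. f x k) w = 0"
      and j: "j < p" and crit: "\<forall>u. der1 n (\<lambda>x. f x j) u = 0"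
    let ?Q = "der2 n (\<lambda>x. f x j)"
    \<comment> \<open>the first derivative of the curve in the target, with no contribution of w\<close>
    define M where "M k = (case k of 0 \<Rightarrow> 1 | Suc k \<Rightarrow> der1 n (\<lambda>x. f x k) v)" for k
    define C where "C = der2 (1 + p) (\<lambda>y. \<Psi> y (Suc j)) M M"
    have key: "?Q (cscale \<beta> w) (cscale \<beta> w) + 2 * (\<beta> * lin n p A w j)
        = ?Q (v + cscale \<beta> w) (v + cscale \<beta> w) + C" for \<beta>
    proof -
      let ?X = "v + cscale \<beta> w"
      define Y where "Y i = (case i of 0 \<Rightarrow> 1 | Suc k \<Rightarrow> \<beta> * w k)" for i
      define y where "y z = (\<lambda>i. Y i * z)" for z
      have Y: "Y \<in> Cn (1 + n)" using w by (auto simp: Y_def Cn_def split: nat.split)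
      have ysh: "(\<lambda>i. y z (Suc i)) = (\<lambda>i. cscale \<beta> w i * z)" for z
        by (simp add: y_def Y_def cscale_def)
      have bw: "cscale \<beta> w \<in> Cn n" using w by (simp add: Cn_def cscale_def)
      have ycube: "\<forall>\<^sub>F z in nhds 0. y z \<in> cube (1 + n) d" if "d > 0" for d
        unfolding y_def by (rule eventually_ray_in_cube[OF Y that])
      define \<xi> where "\<xi> z = (\<lambda>i. \<Phi> (y z) (Suc i))" for z
      define m where "m z = id_times 1 f (\<Phi> (y z))" for z
      have m0: "m z 0 = \<Phi> (y z) 0" and mS: "m z (Suc k) = f (\<xi> z) k" for z k
        by (simp_all add: m_def id_times_def join_def \<xi>_def)
      have \<Phi>jet: "jet2 (\<lambda>z. \<Phi> (y z) i) 0 (der1 (1 + n) (\<lambda>y. \<Phi> y i) Y) (der2 (1 + n) (\<lambda>y. \<Phi> y i) Y Y)"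
        if "i < 1 + n" for i
        using jet2_ray[OF _ e1(1) Y, of "\<lambda>y. \<Phi> y i"] e1(2) that \<Phi>0 by (simp add: hol_map_def y_def)
      \<comment> \<open>the source curve starts with velocity v + beta w\<close>
      have "der1 (1 + n) (\<lambda>y. \<Phi> y (Suc k)) Y = ?X k" if k: "k < n" for k
      proof -
        have "der1 (1 + n) (\<lambda>y. \<Phi> y (Suc k)) Y = v k + (\<Sum>i<n. (if i = k then 1 else 0) * (\<beta> * w i))"
          using k unfolding der1_def plus_1_eq_Suc sum.lessThan_Suc_shift
          by (simp add: Y_def v_def unfolding_id_derivs(2)[OF \<Phi>])
        also have "\<dots> = ?X k" using k by (simp add: if_distrib[of "\<lambda>x. x * _"] cscale_def cong: if_cong)
        finally show ?thesis .
      qed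
      then have \<xi>jet: "\<exists>u. jet2 (\<lambda>z. \<xi> z k) 0 (?X k) u" if "k < n" for k
        using \<Phi>jet[of "Suc k"] that by (auto simp: \<xi>_def)
      then obtain U where U: "\<And>k. k < n \<Longrightarrow> jet2 (\<lambda>z. \<xi> z k) 0 (?X k) (U k)" by metis
      have \<xi>cube: "\<forall>\<^sub>F z in nhds 0. \<xi> z \<in> cube n ef"
        using ycube[OF e1(1)] by eventually_elim (use e1(3) cube_Suc_join(1) \<xi>_def in auto)
      have fjet: "jet2 (\<lambda>z. f (\<xi> z) k) 0 (der1 n (\<lambda>x. f x k) ?X) (der1 n (\<lambda>x. f x k) U + der2 n (\<lambda>x. f x k) ?X ?X)"
        if k: "k < p" for k
      proof -
        have "hol_fun n (cube n ef) (\<lambda>x. f x k)" using ef(2) k by (simp add: hol_map_def)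
        then have "jet2 (\<lambda>z. f (\<xi> z) k) (f 0 k) (der1 n (\<lambda>x. f x k) ?X) (der1 n (\<lambda>x. f x k) U + der2 n (\<lambda>x. f x k) ?X ?X)"
        proof (rule jet2_compose[OF _ ef(1) U])
          show "\<forall>\<^sub>F z in nhds 0. \<xi> z \<in> Cn n"
            using \<xi>cube by (rule eventually_mono) (rule cube_Cn)
        qed
        then show ?thesis by (simp add: ef(3))
      qed
      have lin1: "der1 n (\<lambda>x. f x k) ?X = der1 n (\<lambda>x. f x k) v" if "k < p" for k
      proof -
        have "der1 n (\<lambda>x. f x k) ?X = der1 n (\<lambda>x. f x k) v + \<beta> * der1 n (\<lambda>x. f x k) w"
          by (simp add: der1_def cscale_def algebra_simps sum.distrib sum_distrib_left)
        then show ?thesis using ker that by simp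
      qed
      have m0jet: "jet2 (\<lambda>z. m z 0) 0 1 0"
      proof (rule jet2_cong)
        show "jet2 (\<lambda>z. 1 * z) 0 1 0" by (rule jet2_linear)
        show "\<forall>\<^sub>F z in nhds 0. 1 * z = m z 0"
          using ycube[OF e2(1)] by eventually_elim (simp add: m0 e2(2), simp add: y_def Y_def)
      qed
      define V where "V k = (case k of 0 \<Rightarrow> 0 | Suc k \<Rightarrow> der1 n (\<lambda>x. f x k) U + der2 n (\<lambda>x. f x k) ?X ?X)" for k
      have mjet: "jet2 (\<lambda>z. m z k) 0 (M k) (V k)" if "k < 1 + p" for k
        using that m0jet fjet lin1 by (cases k) (simp_all add: M_def V_def mS)
      have mC: "\<forall>\<^sub>F z in nhds 0. m z \<in> Cn (1 + p)"
        using \<xi>cube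
      proof eventually_elim
        case (elim z)
        then have "f (\<xi> z) \<in> Cn p" using ef(2) by (auto simp: hol_map_def)
        then have "m z k = 0" if "k \<ge> 1 + p" for k
          using that by (cases k) (auto simp: mS Cn_def)
        then show ?case by (simp add: Cn_def)
      qed
      have "hol_fun (1 + p) (cube (1 + p) eP) (\<lambda>y. \<Psi> y (Suc j))"
        using eP(2) j by (simp add: hol_map_def)
      from jet2_compose[OF this eP(1) mjet mC]
      have R: "jet2 (\<lambda>z. \<Psi> (m z) (Suc j)) 0 (der1 (1 + p) (\<lambda>y. \<Psi> y (Suc j)) M)
          (der1 (1 + p) (\<lambda>y. \<Psi> y (Suc j)) V + C)"
        by (simp add: eP(3) C_def)
      have "der1 (1 + p) (\<lambda>y. \<Psi> y (Suc j)) V = (\<Sum>i<p. (if i = j then 1 else 0) * V (Suc i))"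
        using j unfolding der1_def plus_1_eq_Suc sum.lessThan_Suc_shift
        by (simp add: V_def unfolding_id_derivs(2)[OF \<Psi>])
      also have "\<dots> = ?Q ?X ?X"
        using j crit by (simp add: V_def if_distrib[of "\<lambda>x. x * _"] cong: if_cong)
      finally have V: "der1 (1 + p) (\<lambda>y. \<Psi> y (Suc j)) V = ?Q ?X ?X" .
      have Fy: "?F (y z) (Suc j) = f (\<lambda>i. cscale \<beta> w i * z) j + (\<beta> * lin n p A w j) * z ^ 2" for z
        unfolding linear_perturbation_def ysh using j
        by (simp add: join_def lin_def y_def Y_def cscale_def power2_eq_square sum_distrib_left mult_ac)
      have "hol_fun n (cube n ef) (\<lambda>x. f x j)" using ef(2) j by (simp add: hol_map_def)
      from jet2_add[OF jet2_ray[OF this ef(1) bw] jet2_monomial[of "\<beta> * lin n p A w j" 2]]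
      have L: "jet2 (\<lambda>z. ?F (y z) (Suc j)) 0 0
         (?Q (cscale \<beta> w) (cscale \<beta> w) + 2 * (\<beta> * lin n p A w j))"
        using crit by (simp add: Fy ef(3))
      have "\<forall>\<^sub>F z in nhds 0. ?F (y z) (Suc j) = \<Psi> (m z) (Suc j)"
        using ycube[OF e3(1)] by eventually_elim (simp add: e3(2) m_def)
      from jet2_unique[OF jet2_cong[OF L this] R] show ?thesis using V by simp
    qed
    show "2 * lin n p A w j = ?Q v w + ?Q w v"
    proof -
      have bil: "der2 n g (v + cscale \<beta> w) (v + cscale \<beta> w) = der2 n g v v + \<beta> * (der2 n g v w + der2 n g w v)
          + der2 n g (cscale \<beta> w) (cscale \<beta> w)" for g \<beta>
        by (simp add: der2_def cscale_def algebra_simps sum.distrib sum_distrib_left)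
      have "2 * lin n p A w j = ?Q v v + (?Q v w + ?Q w v) + C"
        using key[of 1] unfolding bil by (simp add: algebra_simps)
      moreover have "- (2 * lin n p A w j) = ?Q v v - (?Q v w + ?Q w v) + C"
        using key[of "-1"] unfolding bil by (simp add: algebra_simps)
      ultimately show ?thesis by algebra
    qed
  qed (rule vC)
qed

section \<open>Polynomial functions\<close>

lemma hol_fun_peval: "hol_fun n S (peval P)"
proof -
  have "hol_fun n S (\<lambda>x. \<Sum>m\<in>Poly_Mapping.keys P. Poly_Mapping.lookup P m *
                  (\<Prod>i\<in>Poly_Mapping.keys m. x i ^ Poly_Mapping.lookup m i))"
    by (intro hol_fun_sum hol_fun_mult hol_fun_const hol_fun_prod hol_fun_power hol_fun_coord)
  then show ?thesis by (simp add: peval_def[abs_def])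
qed

lemma peval_superset:
  assumes "finite S" "Poly_Mapping.keys P \<subseteq> S"
  shows "peval P x = (\<Sum>m\<in>S. Poly_Mapping.lookup P m *
                  (\<Prod>i\<in>Poly_Mapping.keys m. x i ^ Poly_Mapping.lookup m i))"
  unfolding peval_def using assms by (intro sum.mono_neutral_left) (auto simp: in_keys_iff)

lemma peval_add: "peval (P + Q) x = peval P x + peval Q x"
proof -
  let ?S = "Poly_Mapping.keys P \<union> Poly_Mapping.keys Q"
  have "Poly_Mapping.keys (P + Q) \<subseteq> ?S" by (rule Poly_Mapping.keys_add)
  then show ?thesis
    by (simp add: peval_superset[of ?S] lookup_add algebra_simps sum.distrib)
qed

lemma peval_zero: "peval 0 x = 0"
  by (simp add: peval_def)

lemma peval_const: "peval (Poly_Mapping.single 0 c) x = c"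
  by (simp add: peval_superset[of "{0}"])

lemma peval_var: "peval (Poly_Mapping.single (Poly_Mapping.single i 1) c) x = c * x i"
  by (simp add: peval_superset[of "{Poly_Mapping.single i 1}"])

lemma peval_sum: "peval (\<Sum>i\<in>I. P i) x = (\<Sum>i\<in>I. peval (P i) x)"
  by (induction I rule: infinite_finite_induct) (simp_all add: peval_zero peval_add)

lemma polys_in_add: "P \<in> polys_in p \<Longrightarrow> Q \<in> polys_in p \<Longrightarrow> P + Q \<in> polys_in p"
  using Poly_Mapping.keys_add[of P Q] by (auto simp: polys_in_def)

lemma polys_in_zero: "0 \<in> polys_in p"
  by (simp add: polys_in_def)

lemma polys_in_sum: "(\<And>i. i \<in> I \<Longrightarrow> P i \<in> polys_in p) \<Longrightarrow> (\<Sum>i\<in>I. P i) \<in> polys_in p"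
  by (induction I rule: infinite_finite_induct) (simp_all add: polys_in_add polys_in_zero)

lemma polys_in_const: "Poly_Mapping.single 0 c \<in> polys_in p"
  by (simp add: polys_in_def)

lemma polys_in_var: "i < p \<Longrightarrow> Poly_Mapping.single (Poly_Mapping.single i 1) c \<in> polys_in p"
  by (simp add: polys_in_def)

text \<open>
  The polynomial \<open>c\<^sub>0 X\<^sub>0 + \<dots> + c\<^bsub>p - 1\<^esub> X\<^bsub>p - 1\<^esub> + b\<close>, which serves both as a linear relation
  between basic invariants and as a linear form on the space.
\<close>

definition affine_poly :: "nat \<Rightarrow> (nat \<Rightarrow> complex) \<Rightarrow> complex \<Rightarrow> cpoly" where
  "affine_poly p c b = (\<Sum>i<p. Poly_Mapping.single (Poly_Mapping.single i 1) (c i)) + Poly_Mapping.single 0 b"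

lemma affine_poly_in: "affine_poly p c b \<in> polys_in p"
  unfolding affine_poly_def by (intro polys_in_add polys_in_sum polys_in_const polys_in_var) simp

lemma peval_affine_poly: "peval (affine_poly p c b) x = (\<Sum>i<p. c i * x i) + b"
  unfolding affine_poly_def peval_add peval_sum peval_var peval_const ..

lemma affine_poly_eq_0:
  assumes "affine_poly p c b = 0"
  shows "b = 0" "\<And>i. i < p \<Longrightarrow> c i = 0"
proof -
  have pe: "(\<Sum>i<p. c i * x i) + b = 0" for x
    using peval_affine_poly[of p c b x] assms by (simp add: peval_zero)
  from pe[of "\<lambda>_. 0"] show b: "b = 0" by simp
  fix i assume "i < p"
  then show "c i = 0" using pe[of "\<lambda>k. if k = i then 1 else 0"] b
    by (simp add: if_distrib cong: if_cong)
qed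

lemma peval_homogeneous:
  assumes "homogeneous_poly P"
  obtains d where "\<And>c x. peval P (cscale c x) = c ^ d * peval P x"
proof -
  obtain d where d: "\<And>m. m \<in> Poly_Mapping.keys P \<Longrightarrow> (\<Sum>i\<in>Poly_Mapping.keys m. Poly_Mapping.lookup m i) = d"
    using assms by (auto simp: homogeneous_poly_def)
  have "peval P (cscale c x) = c ^ d * peval P x" for c x
  proof -
    have "(\<Prod>i\<in>Poly_Mapping.keys m. (c * x i) ^ Poly_Mapping.lookup m i)
        = c ^ d * (\<Prod>i\<in>Poly_Mapping.keys m. x i ^ Poly_Mapping.lookup m i)"
      if "m \<in> Poly_Mapping.keys P" for m
      using d[OF that] by (simp add: power_mult_distrib prod.distrib power_sum[symmetric])
    then show ?thesis by (simp add: peval_def cscale_def sum_distrib_left mult_ac)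
  qed
  then show ?thesis by (rule that)
qed

lemma linear_form_coeffs:
  assumes add: "\<And>x y. x \<in> Cn p \<Longrightarrow> y \<in> Cn p \<Longrightarrow> L (x + y) = L x + L y"
    and scale: "\<And>c x. x \<in> Cn p \<Longrightarrow> L (cscale c x) = c * L x"
    and x: "x \<in> Cn p"
  shows "L x = (\<Sum>i<p. L (\<lambda>k. if k = i then 1 else 0) * x i)"
proof -
  let ?E = "\<lambda>i k::nat. if k = i then 1 else (0::complex)"
  have E: "?E i \<in> Cn p" if "i < p" for i using that by (simp add: Cn_def)
  have "L (\<lambda>k. if k < m then x k else 0) = (\<Sum>i<m. L (?E i) * x i)" if "m \<le> p" for m
    using that
  proof (induction m)
    case 0
    have "L (\<lambda>_. 0) = 0" using scale[of "\<lambda>_. 0" 0] by (simp add: cscale_def Cn_def)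
    then show ?case by simp
  next
    case (Suc m)
    have "(\<lambda>k. if k < Suc m then x k else 0) = (\<lambda>k. if k < m then x k else 0) + cscale (x m) (?E m)"
      by (auto simp: fun_eq_iff cscale_def less_Suc_eq)
    moreover have "(\<lambda>k. if k < m then x k else 0) \<in> Cn p" "cscale (x m) (?E m) \<in> Cn p"
      using Suc.prems by (auto simp: Cn_def cscale_def)
    ultimately show ?case
      using Suc by (simp only: add scale E) (simp add: scale E)
  qed
  from this[of p] have "L (\<lambda>k. if k < p then x k else 0) = (\<Sum>i<p. L (?E i) * x i)" by simp
  moreover have "(\<lambda>k. if k < p then x k else 0) = x" using x by (auto simp: Cn_def fun_eq_iff)
  ultimately show ?thesis by simp
qed

section \<open>The linear algebra of basic invariants at the origin\<close>

text \<open>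
  What the argument takes from a reflection group and its basic invariants; \<open>d j\<close> is the degree of
  the j-th invariant.  \<open>G_translate\<close> says that left translation permutes the group, which is what
  averaging rests on.  \<open>omega_indep\<close> is algebraic independence for polynomials of degree at most one, and
  \<open>omega_generate\<close> is the generation of the invariant ring for invariant linear forms.
\<close>

locale basic_invariants =
  fixes p :: nat and G :: "(cvec \<Rightarrow> cvec) set" and \<omega> :: "cvec \<Rightarrow> cvec" and d :: "nat \<Rightarrow> nat"
  assumes finite_G: "finite G" and G_nonempty: "G \<noteq> {}"
    and G_closed: "\<And>g x. g \<in> G \<Longrightarrow> x \<in> Cn p \<Longrightarrow> g x \<in> Cn p"
    and G_add: "\<And>g x y. g \<in> G \<Longrightarrow> x \<in> Cn p \<Longrightarrow> y \<in> Cn p \<Longrightarrow> g (x + y) = g x + g y"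
    and G_translate: "\<And>g. g \<in> G \<Longrightarrow> \<exists>\<sigma>. bij_betw \<sigma> G G \<and> (\<forall>h\<in>G. \<forall>x\<in>Cn p. \<sigma> h x = g (h x))"
    and omega_Cn: "\<And>x. x \<in> Cn p \<Longrightarrow> \<omega> x \<in> Cn p"
    and omega_hol: "\<And>j e. j < p \<Longrightarrow> hol_fun p (cube p e) (\<lambda>x. \<omega> x j)"
    and omega_scale: "\<And>j c x. j < p \<Longrightarrow> x \<in> Cn p \<Longrightarrow> \<omega> (cscale c x) j = c ^ d j * \<omega> x j"
    and omega_inv: "\<And>g x. g \<in> G \<Longrightarrow> x \<in> Cn p \<Longrightarrow> \<omega> (g x) = \<omega> x"
    and omega_indep: "\<And>c b j. (\<And>x. x \<in> Cn p \<Longrightarrow> (\<Sum>i<p. c i * \<omega> x i) = b) \<Longrightarrow> j < p \<Longrightarrow> c j = 0"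
    and omega_generate: "\<And>L. (\<And>x y. x \<in> Cn p \<Longrightarrow> y \<in> Cn p \<Longrightarrow> L (x + y) = L x + L y) \<Longrightarrow>
        (\<And>c x. x \<in> Cn p \<Longrightarrow> L (cscale c x) = c * L x) \<Longrightarrow>
        (\<And>g x. g \<in> G \<Longrightarrow> x \<in> Cn p \<Longrightarrow> L (g x) = L x) \<Longrightarrow>
        \<exists>Q. \<forall>x\<in>Cn p. L x = peval Q (\<omega> x)"
begin

definition omega_kernel :: "cvec set" where
  "omega_kernel = {x \<in> Cn p. \<forall>j<p. der1 p (\<lambda>x. \<omega> x j) x = 0}"

text \<open>
  Twice the Hessian form of the j-th invariant at the origin, written as a sum that is symmetric by
  construction.
\<close>

definition sform :: "nat \<Rightarrow> cvec \<Rightarrow> cvec \<Rightarrow> complex" where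
  "sform j x y = der2 p (\<lambda>x. \<omega> x j) x y + der2 p (\<lambda>x. \<omega> x j) y x"

text \<open>
  An invariant of degree 0 would be constant, contradicting independence.
\<close>

lemma degree_pos: assumes j: "j < p" shows "d j \<noteq> 0"
proof
  assume "d j = 0"
  have "(\<Sum>i<p. (if i = j then 1 else 0) * \<omega> x i) = \<omega> 0 j" if "x \<in> Cn p" for x
  proof -
    have "(\<Sum>i<p. (if i = j then 1 else 0) * \<omega> x i) = \<omega> x j"
      using j by (simp add: if_distrib[of "\<lambda>x. x * _"] cong: if_cong)
    also have "\<dots> = \<omega> (cscale 0 x) j" using omega_scale[OF j that, of 0] \<open>d j = 0\<close> by simp
    also have "cscale 0 x = 0" by (auto simp: cscale_def)
    finally show ?thesis .
  qed
  then show False using omega_indep[of "\<lambda>i. if i = j then 1 else 0" "\<omega> 0 j" j] j by simp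
qed

lemma omega_0 [simp]: "\<omega> 0 = 0"
proof
  fix j
  have z: "(0::cvec) \<in> Cn p" by (simp add: Cn_def)
  show "\<omega> 0 j = 0 j"
  proof (cases "j < p")
    case True
    have "cscale 0 0 = (0::cvec)" by (auto simp: cscale_def)
    then show ?thesis using omega_scale[OF True z, of 0] degree_pos[OF True] by (simp add: power_0_left)
  next
    case False then show ?thesis using omega_Cn[OF z] by (simp add: Cn_def)
  qed
qed

lemma omega_germ: "hol_germ p p \<omega>"
  using omega_hol omega_Cn cube_Cn by (auto simp: hol_germ_iff hol_map_def intro!: exI[of _ 1])

text \<open>
  On a line through the origin a homogeneous function is a monomial in the parameter.
\<close>

lemma omega_jets:
  assumes j: "j < p" and x: "x \<in> Cn p"
  shows "der1 p (\<lambda>x. \<omega> x j) x = (if d j = 1 then \<omega> x j else 0)"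
    and "der2 p (\<lambda>x. \<omega> x j) x x = (if d j = 2 then 2 * \<omega> x j else 0)"
proof -
  have "jet2 (\<lambda>z. \<omega> (\<lambda>i. x i * z) j) (\<omega> 0 j) (der1 p (\<lambda>x. \<omega> x j) x) (der2 p (\<lambda>x. \<omega> x j) x x)"
    by (rule jet2_ray[OF omega_hol[OF j] zero_less_one x])
  moreover have "\<omega> (\<lambda>i. x i * z) j = \<omega> x j * z ^ d j" for z
    using omega_scale[OF j x, of z] by (simp add: cscale_def mult.commute)
  ultimately have "jet2 (\<lambda>z. \<omega> x j * z ^ d j) 0 (der1 p (\<lambda>x. \<omega> x j) x) (der2 p (\<lambda>x. \<omega> x j) x x)"
    by simp
  from jet2_unique[OF this jet2_monomial]
  show "der1 p (\<lambda>x. \<omega> x j) x = (if d j = 1 then \<omega> x j else 0)"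
    and "der2 p (\<lambda>x. \<omega> x j) x x = (if d j = 2 then 2 * \<omega> x j else 0)"
    by auto
qed

text \<open>
  Such a form is \<open>Q \<circ> \<omega>\<close> for a polynomial Q, so its derivative at 0, which is the form itself,
  factors through the differential of \<open>\<omega>\<close>.
\<close>

lemma invariant_form_vanishes:
  assumes add: "\<And>x y. x \<in> Cn p \<Longrightarrow> y \<in> Cn p \<Longrightarrow> L (x + y) = L x + L y"
    and scale: "\<And>c x. x \<in> Cn p \<Longrightarrow> L (cscale c x) = c * L x"
    and inv: "\<And>g x. g \<in> G \<Longrightarrow> x \<in> Cn p \<Longrightarrow> L (g x) = L x"
    and x: "x \<in> omega_kernel"
  shows "L x = 0"
proof -
  obtain Q where Q: "\<And>x. x \<in> Cn p \<Longrightarrow> L x = peval Q (\<omega> x)"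
  proof -
    have "\<exists>Q. \<forall>x\<in>Cn p. L x = peval Q (\<omega> x)"
      by (rule omega_generate[of L]) (erule (1) add, erule scale, erule (1) inv)
    then show ?thesis using that by blast
  qed
  have xC: "x \<in> Cn p" using x by (simp add: omega_kernel_def)
  have ray: "(\<lambda>i. x i * z) \<in> Cn p" for z using xC by (simp add: Cn_def)
  have "jet2 (\<lambda>z. peval Q (\<omega> (\<lambda>i. x i * z))) (peval Q 0) (der1 p (peval Q) 0)
     (der1 p (peval Q) (\<lambda>j. der2 p (\<lambda>x. \<omega> x j) x x) + der2 p (peval Q) 0 0)"
  proof (rule jet2_compose[OF hol_fun_peval zero_less_one])
    fix j assume "j < p"
    then show "jet2 (\<lambda>z. \<omega> (\<lambda>i. x i * z) j) 0 (0 j) (der2 p (\<lambda>x. \<omega> x j) x x)"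
      using jet2_ray[OF omega_hol zero_less_one xC, of j] x by (simp add: omega_kernel_def)
  next
    show "\<forall>\<^sub>F z in nhds 0. \<omega> (\<lambda>i. x i * z) \<in> Cn p"
      using omega_Cn[OF ray] by (simp add: always_eventually)
  qed
  moreover have "peval Q (\<omega> (\<lambda>i. x i * z)) = L x * z" for z
    using Q[OF ray] scale[OF xC, of z] by (simp add: cscale_def mult.commute)
  ultimately have "jet2 (\<lambda>z. L x * z) (peval Q 0) 0
      (der1 p (peval Q) (\<lambda>j. der2 p (\<lambda>x. \<omega> x j) x x) + der2 p (peval Q) 0 0)"
    by (simp add: der1_def)
  from jet2_unique[OF this jet2_linear] show ?thesis by simp
qed

lemma sform_commute: "sform j x y = sform j y x"
  by (simp add: sform_def)

lemma sform_add: "sform j (x + x') y = sform j x y + sform j x' y"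
  by (simp add: sform_def der2_def algebra_simps sum.distrib)

lemma sform_scale: "sform j (cscale c x) y = c * sform j x y"
  by (simp add: sform_def der2_def cscale_def algebra_simps sum_distrib_left)

lemma sform_expand: "sform j x y = (\<Sum>k<p. (\<Sum>l<p. (pderiv_at l (pderiv_at k (\<lambda>x. \<omega> x j)) 0
   + pderiv_at k (pderiv_at l (\<lambda>x. \<omega> x j)) 0) * y l) * x k)"
proof -
  have "der2 p (\<lambda>x. \<omega> x j) y x = (\<Sum>k<p. \<Sum>l<p. pderiv_at k (pderiv_at l (\<lambda>x. \<omega> x j)) 0 * y l * x k)"
    unfolding der2_def by (rule sum.swap)
  then show ?thesis
    by (simp add: sform_def der2_def algebra_simps sum.distrib sum_distrib_left)
qed

lemma sform_polar:
  "sform j x y = der2 p (\<lambda>x. \<omega> x j) (x + y) (x + y) - der2 p (\<lambda>x. \<omega> x j) x x - der2 p (\<lambda>x. \<omega> x j) y y"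
  by (simp add: sform_def der2_def algebra_simps sum.distrib)

lemma Cn_add: "x \<in> Cn p \<Longrightarrow> y \<in> Cn p \<Longrightarrow> x + y \<in> Cn p"
  by (simp add: Cn_def)

lemma sform_inv:
  assumes "j < p" "g \<in> G" "x \<in> Cn p" "y \<in> Cn p"
  shows "sform j (g x) (g y) = sform j x y"
  unfolding sform_polar
  using assms by (simp add: G_add[symmetric] omega_jets(2) G_closed Cn_add omega_inv)

text \<open>
  The projection onto the space of vectors fixed by the group.
\<close>

definition avg :: "cvec \<Rightarrow> cvec" where
  "avg x = (\<lambda>i. (\<Sum>g\<in>G. g x i) / of_nat (card G))"

lemma avg_Cn: "x \<in> Cn p \<Longrightarrow> avg x \<in> Cn p"
  unfolding avg_def Cn_def using G_closed[of _ x]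
  by (auto simp: Cn_def intro!: sum.neutral)

lemma card_G: "card G \<noteq> 0"
  using finite_G G_nonempty by simp

lemma avg_fixed: "(\<And>g. g \<in> G \<Longrightarrow> g x = x) \<Longrightarrow> avg x = x"
  using card_G by (simp add: avg_def)

lemma linear_avg: "(\<Sum>k<p. a k * avg x k) = (\<Sum>g\<in>G. \<Sum>k<p. a k * g x k) / of_nat (card G)"
  unfolding avg_def times_divide_eq_right sum_divide_distrib[symmetric] sum_distrib_left
  by (subst sum.swap) simp

lemma sform_avg: "sform j (avg x) y = (\<Sum>g\<in>G. sform j (g x) y) / of_nat (card G)"
  unfolding sform_expand by (rule linear_avg)

text \<open>
  With an averaged vector in one slot the Hessian form is an invariant linear form in the other.
\<close>

lemma sform_avg_kernel:
  assumes j: "j < p" and x: "x \<in> Cn p" and y: "y \<in> omega_kernel"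
  shows "sform j (avg x) y = 0"
proof (rule invariant_form_vanishes[OF _ _ _ y])
  fix g y assume g: "g \<in> G" and y: "y \<in> Cn p"
  obtain \<sigma> where \<sigma>: "bij_betw \<sigma> G G" "\<And>h x. h \<in> G \<Longrightarrow> x \<in> Cn p \<Longrightarrow> \<sigma> h x = g (h x)"
    using G_translate[OF g] by blast
  have "(\<Sum>h\<in>G. sform j (h x) (g y)) = (\<Sum>h\<in>G. sform j (\<sigma> h x) (g y))"
    by (rule sum.reindex_bij_betw[OF \<sigma>(1), symmetric])
  also have "\<dots> = (\<Sum>h\<in>G. sform j (h x) y)"
    by (intro sum.cong refl) (simp add: \<sigma>(2) x sform_inv j g y G_closed)
  finally show "sform j (avg x) (g y) = sform j (avg x) y" by (simp add: sform_avg)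
qed (simp_all only: sform_commute[of j "avg x"] sform_add sform_scale)

lemma linear_omega:
  assumes "j < p" "d j = 1" "x \<in> Cn p"
  shows "\<omega> x j = (\<Sum>k<p. pderiv_at k (\<lambda>x. \<omega> x j) 0 * x k)"
  using omega_jets(1)[OF assms(1,3)] assms(2) by (simp add: der1_def)

lemma omega_avg:
  assumes "j < p" "d j = 1" "x \<in> Cn p"
  shows "\<omega> (avg x) j = \<omega> x j"
proof -
  have "\<omega> (avg x) j = (\<Sum>g\<in>G. \<omega> (g x) j) / of_nat (card G)"
    using assms by (simp add: linear_omega avg_Cn linear_avg G_closed)
  then show ?thesis using card_G by (simp add: omega_inv assms)
qed

lemma omega_kernel_iff: "x \<in> omega_kernel \<longleftrightarrow> x \<in> Cn p \<and> (\<forall>j<p. d j = 1 \<longrightarrow> \<omega> x j = 0)"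
  unfolding omega_kernel_def using omega_jets(1) by auto

text \<open>
  If all invariants were linear, they would be p independent linear forms on a p-dimensional space,
  and such forms have no common zero other than 0.
\<close>

lemma exists_nonlinear_invariant:
  assumes x: "x \<in> omega_kernel" "x \<noteq> 0"
  shows "\<exists>j<p. d j \<noteq> 1"
proof (rule ccontr)
  assume "\<not> (\<exists>j<p. d j \<noteq> 1)"
  then have d1: "\<And>j. j < p \<Longrightarrow> d j = 1" by blast
  obtain k where k: "k < p" "x k \<noteq> 0"
  proof -
    have "x k = 0" if "k \<ge> p" for k using x(1) that by (simp add: omega_kernel_def Cn_def)
    then show ?thesis using x(2) that by (metis ext leI zero_fun_apply)
  qed
  define a where "a j i = pderiv_at i (\<lambda>x. \<omega> x j) 0" for j i
  have ax: "(\<Sum>i<p. a j i * x i) = 0" if "j < p" for j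
    using x(1) that by (auto simp: omega_kernel_def der1_def a_def)
  have "\<exists>c. (\<exists>j\<in>{..<p}. c j \<noteq> 0) \<and> (\<forall>i\<in>{..<p} - {k}. (\<Sum>j<p. c j * a j i) = 0)"
    by (rule underdetermined_system) (use k in auto)
  then obtain c where c: "\<exists>j<p. c j \<noteq> 0" "\<And>i. i < p \<Longrightarrow> i \<noteq> k \<Longrightarrow> (\<Sum>j<p. c j * a j i) = 0"
    by auto
  \<comment> \<open>the remaining equation follows because all forms vanish at x\<close>
  have "(\<Sum>i<p. (\<Sum>j<p. c j * a j i) * x i) = (\<Sum>j<p. c j * (\<Sum>i<p. a j i * x i))"
    unfolding sum_distrib_left sum_distrib_right by (subst sum.swap) (simp add: mult.assoc)
  then have "(\<Sum>i<p. (\<Sum>j<p. c j * a j i) * x i) = 0" using ax by simp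
  moreover have "(\<Sum>i<p. (\<Sum>j<p. c j * a j i) * x i) = (\<Sum>j<p. c j * a j k) * x k"
    using k(1) c(2) by (simp add: sum.remove[of "{..<p}" k])
  ultimately have ck: "(\<Sum>j<p. c j * a j i) = 0" if "i < p" for i
    using k(2) c(2) that by (cases "i = k") auto
  have "(\<Sum>j<p. c j * \<omega> y j) = 0" if y: "y \<in> Cn p" for y
  proof -
    have "(\<Sum>j<p. c j * \<omega> y j) = (\<Sum>j<p. c j * (\<Sum>i<p. a j i * y i))"
      using y by (intro sum.cong refl) (simp add: linear_omega d1 a_def)
    also have "\<dots> = (\<Sum>i<p. (\<Sum>j<p. c j * a j i) * y i)"
      unfolding sum_distrib_left sum_distrib_right by (subst sum.swap) (simp add: mult.assoc)
    finally show ?thesis using ck by simp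
  qed
  then show False using omega_indep[of c 0] c(1) by blast
qed

end

text \<open>
  The degrees come from the homogeneity of the defining polynomials.  Independence and generation
  are applied to affine polynomials.
\<close>

lemma basic_invariantsI:
  assumes refl: "reflection_group p B G" and orb: "orbit_map p G \<omega>"
  shows "\<exists>d. basic_invariants p G \<omega> d"
proof -
  have sub: "subgroup G (unitary_group p B)" and fin: "finite G"
    using refl by (auto simp: reflection_group_def)
  have G: "g \<in> Bij (Cn p)" "\<And>x y. x \<in> Cn p \<Longrightarrow> y \<in> Cn p \<Longrightarrow> g (x + y) = g x + g y" if "g \<in> G" for g
    using subgroup.subset[OF sub] that by (auto simp: unitary_group_def)
  obtain w where w1: "\<forall>x\<in>Cn p. \<omega> x = (\<lambda>j. if j < p then peval (w j) x else 0)"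
     and w2: "\<forall>j<p. w j \<in> invariant_polys p G \<and> homogeneous_poly (w j)"
     and w3: "\<forall>Q \<in> polys_in p. (\<forall>x\<in>Cn p. peval Q (\<omega> x) = 0) \<longrightarrow> Q = 0"
     and w4: "\<forall>P \<in> invariant_polys p G. \<exists>Q \<in> polys_in p. \<forall>x\<in>Cn p. peval P x = peval Q (\<omega> x)"
    using orb unfolding orbit_map_def by (elim exE conjE) (rule that)
  have w: "\<And>x. x \<in> Cn p \<Longrightarrow> \<omega> x = (\<lambda>j. if j < p then peval (w j) x else 0)"
     "\<And>j. j < p \<Longrightarrow> w j \<in> invariant_polys p G" "\<And>j. j < p \<Longrightarrow> homogeneous_poly (w j)"
    using w1 w2 by auto
  have "\<exists>e. \<forall>c x. peval (w j) (cscale c x) = c ^ e * peval (w j) x" if "j < p" for j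
    using peval_homogeneous[OF w(3)[OF that]] by metis
  then obtain d where d: "\<And>j c x. j < p \<Longrightarrow> peval (w j) (cscale c x) = c ^ d j * peval (w j) x"
    by metis
  have sC: "cscale c x \<in> Cn p" if "x \<in> Cn p" for c x using that by (simp add: Cn_def cscale_def)
  have gC: "g x \<in> Cn p" if "g \<in> G" "x \<in> Cn p" for g x
    using G(1)[OF that(1)] that(2) by (auto simp: Bij_def bij_betw_def)
  show ?thesis
  proof (intro exI[of _ d], unfold_locales)
    show "G \<noteq> {}" using subgroup.one_closed[OF sub] by auto
    show "\<exists>\<sigma>. bij_betw \<sigma> G G \<and> (\<forall>h\<in>G. \<forall>x\<in>Cn p. \<sigma> h x = g (h x))" if g: "g \<in> G" for g
    proof (intro exI[of _ "compose (Cn p) g"] conjI ballI)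
      have cl: "compose (Cn p) g h \<in> G" if "h \<in> G" for h
        using subgroup.m_closed[OF sub g that] G(1)[OF g] G(1)[OF that]
        by (simp add: unitary_group_def BijGroup_def)
      have inj: "inj_on (compose (Cn p) g) G"
      proof (rule inj_onI)
        fix h k assume h: "h \<in> G" and k: "k \<in> G" and eq: "compose (Cn p) g h = compose (Cn p) g k"
        have "h x = k x" for x
        proof (cases "x \<in> Cn p")
          case True
          then have "g (h x) = g (k x)" using fun_cong[OF eq, of x] by (simp add: compose_def)
          then show ?thesis
            using G(1)[OF g] gC[OF h True] gC[OF k True] by (auto simp: Bij_def bij_betw_def dest: inj_onD)
        next
          case False
          then show ?thesis using G(1)[OF h] G(1)[OF k] by (auto simp: Bij_def extensional_def)
        qed
        then show "h = k" by blast
      qed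
      have "compose (Cn p) g ` G = G"
        by (rule endo_inj_surj[OF fin _ inj]) (use cl in auto)
      with inj show "bij_betw (compose (Cn p) g) G G" by (simp add: bij_betw_def)
    qed (simp add: compose_def)
    show "hol_fun p (cube p e) (\<lambda>x. \<omega> x j)" if "j < p" for j e
      by (rule hol_fun_cong[OF _ hol_fun_peval[of p "cube p e" "w j"]]) (use that w(1) cube_Cn in auto)
    show "\<omega> (cscale c x) j = c ^ d j * \<omega> x j" if "j < p" "x \<in> Cn p" for j c x
      using that by (simp add: w(1) sC d)
    show "\<omega> (g x) = \<omega> x" if "g \<in> G" "x \<in> Cn p" for g x
      using that w(2) gC by (auto simp: w(1) invariant_polys_def fun_eq_iff)
    show "c j = 0" if "\<And>x. x \<in> Cn p \<Longrightarrow> (\<Sum>i<p. c i * \<omega> x i) = b" "j < p" for c b j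
    proof -
      have "affine_poly p c (-b) = 0"
        by (rule w3[rule_format, OF affine_poly_in]) (use that in \<open>simp add: peval_affine_poly\<close>)
      then show ?thesis using affine_poly_eq_0(2) that(2) by blast
    qed
    show "\<exists>Q. \<forall>x\<in>Cn p. L x = peval Q (\<omega> x)"
      if add: "\<And>x y. x \<in> Cn p \<Longrightarrow> y \<in> Cn p \<Longrightarrow> L (x + y) = L x + L y"
        and scale: "\<And>c x. x \<in> Cn p \<Longrightarrow> L (cscale c x) = c * L x"
        and inv: "\<And>g x. g \<in> G \<Longrightarrow> x \<in> Cn p \<Longrightarrow> L (g x) = L x" for L :: "cvec \<Rightarrow> complex"
    proof -
      define P where "P = affine_poly p (\<lambda>i. L (\<lambda>k. if k = i then 1 else 0)) 0"
      have P: "peval P x = L x" if "x \<in> Cn p" for x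
        using linear_form_coeffs[of p L x, OF add scale that] by (simp add: P_def peval_affine_poly)
      have "P \<in> invariant_polys p G"
        using P gC inv affine_poly_in by (auto simp: invariant_polys_def P_def[symmetric]) (simp add: P_def affine_poly_in)
      from w4[rule_format, OF this] show ?thesis using P by auto
    qed
  qed (use fin gC G w(1) in \<open>auto simp: Cn_def\<close>)
qed

section \<open>Stability and the Hessian forms of the invariants\<close>

context basic_invariants
begin

text \<open>
  Along a curve the second derivative of \<open>\<omega>\<^sub>j \<circ> h\<close> also contains the second derivative of h, but
  only through the differential of \<open>\<omega>\<^sub>j\<close>, which vanishes for a nonlinear invariant.  Polarising
  turns the statement about \<open>D\<^sup>2 f\<^sub>j\<close> into one about the Hessian form.
\<close>

lemma stable_sform:
  assumes h: "hol_germ n p h" and f: "germ_eq n f (\<omega> \<circ> h)" and st: "stable_germ n p f"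
  shows "\<exists>v\<in>Cn n. \<forall>w\<in>Cn n. differential n p h 0 w \<in> omega_kernel \<longrightarrow> (\<forall>j<p. d j \<noteq> 1 \<longrightarrow>
    2 * lin n p A w j = sform j (differential n p h 0 v) (differential n p h 0 w))"
proof -
  let ?T = "differential n p h 0"
  have fh: "hol_germ n p f"
    by (rule hol_germ_cong[OF hol_germ_compose[OF h omega_germ] germ_eq_sym[OF f]])
  have df: "differential n p f 0 v = differential p p \<omega> 0 (?T v)" if "v \<in> Cn n" for v
    using differential_cong[OF f] differential_compose[OF h omega_germ that] by simp
  have W: "?T w \<in> omega_kernel \<longleftrightarrow> differential p p \<omega> 0 (?T w) = 0" for w
    using differential_Cn[of n p h w] by (auto simp: omega_kernel_def differential_der1 fun_eq_iff)
  have crit: "differential p p \<omega> 0 x j = 0" if "j < p" "d j \<noteq> 1" "x \<in> Cn p" for x j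
    using omega_jets(1)[OF that(1,3)] that by (simp add: differential_der1)
  have critf: "der1 n (\<lambda>x. f x j) u = 0" if "j < p" "d j \<noteq> 1" for u j
  proof -
    have "der1 n (\<lambda>x. f x j) u = der1 n (\<lambda>x. f x j) (\<lambda>i. if i < n then u i else 0)"
      by (simp add: der1_def)
    then show ?thesis
      using df[of "\<lambda>i. if i < n then u i else 0"] crit[OF that differential_Cn] that(1)
      by (simp add: der1_differential[of j p] Cn_def)
  qed
  have der2f: "der2 n (\<lambda>x. f x j) v v = der2 p (\<lambda>x. \<omega> x j) (?T v) (?T v)"
    if "j < p" "d j \<noteq> 1" "v \<in> Cn n" for j v
  proof -
    obtain e where e: "e > 0" "\<And>x. x \<in> cube n e \<Longrightarrow> f x = \<omega> (h x)"
      using f by (auto simp: germ_eq_iff)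
    have "\<forall>\<^sub>F z in nhds 0. f (\<lambda>i. v i * z) j = \<omega> (h (\<lambda>i. v i * z)) j"
      using eventually_ray_in_cube[OF that(3) e(1)] by (rule eventually_mono) (simp add: e(2))
    from jet2_unique[OF jet2_cong[OF jet2_germ_ray[OF fh that(3,1)] this]
        jet2_germ_compose[OF h omega_germ that(3,1)]]
    have "der2 n (\<lambda>x. f x j) v v = der1 p (\<lambda>y. \<omega> y j) (\<lambda>k. der2 n (\<lambda>x. h x k) v v)
      + der2 p (\<lambda>x. \<omega> x j) (?T v) (?T v)" by simp
    moreover have "der1 p (\<lambda>y. \<omega> y j) (\<lambda>k. der2 n (\<lambda>x. h x k) v v) = 0"
    proof -
      let ?u = "\<lambda>k. if k < p then der2 n (\<lambda>x. h x k) v v else 0"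
      have "der1 p (\<lambda>y. \<omega> y j) (\<lambda>k. der2 n (\<lambda>x. h x k) v v) = der1 p (\<lambda>y. \<omega> y j) ?u"
        by (simp add: der1_def)
      also have "\<dots> = 0" using omega_jets(1)[OF that(1), of ?u] that(2) by (simp add: Cn_def)
      finally show ?thesis .
    qed
    ultimately show ?thesis by simp
  qed
  have polar: "der2 n (\<lambda>x. f x j) v w + der2 n (\<lambda>x. f x j) w v = sform j (?T v) (?T w)"
    if "j < p" "d j \<noteq> 1" "v \<in> Cn n" "w \<in> Cn n" for j v w
  proof -
    let ?Q = "der2 n (\<lambda>x. f x j)"
    have "?Q v w + ?Q w v =
        ?Q (v + w) (v + w) - ?Q v v - ?Q w w"
      by (simp add: der2_def algebra_simps sum.distrib)
    also have "\<dots> = sform j (?T v) (?T w)"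
    proof -
      have "v + w \<in> Cn n" using that by (simp add: Cn_def)
      then show ?thesis unfolding der2f[OF that(1,2,3)] der2f[OF that(1,2,4)] sform_polar
        using der2f[OF that(1,2)] by (simp only: differential_eq_lin lin_add)
    qed
    finally show ?thesis .
  qed
  obtain v where v: "v \<in> Cn n" "\<And>w j. w \<in> Cn n \<Longrightarrow> (\<forall>k<p. der1 n (\<lambda>x. f x k) w = 0) \<Longrightarrow>
      j < p \<Longrightarrow> (\<forall>u. der1 n (\<lambda>x. f x j) u = 0) \<Longrightarrow>
       2 * lin n p A w j = der2 n (\<lambda>x. f x j) v w + der2 n (\<lambda>x. f x j) w v"
    using stable_second_order[OF fh st, of A] by blast
  show ?thesis
  proof (intro bexI[of _ v] ballI impI allI)
    fix w j assume w: "w \<in> Cn n" "?T w \<in> omega_kernel" and j: "j < p" "d j \<noteq> 1"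
    have "der1 n (\<lambda>x. f x k) w = 0" if "k < p" for k
      using df[OF w(1)] W[of w] w(2) that by (simp add: der1_differential[of k p])
    then show "2 * lin n p A w j = sform j (?T v) (?T w)"
      using v(2)[OF w(1) _ j(1)] critf[OF j] polar[OF j v(1) w(1)] by simp
  qed (rule v(1))
qed

text \<open>
  Let r be the number of nonlinear invariants.  The p - r linear invariants and the 2r forms
  \<open>sform j - (T w\<^sub>1)\<close>, \<open>sform j - (T w\<^sub>2)\<close> are more than p linear forms on a space of dimension p, so
  they satisfy a linear relation.  On averaged vectors only the linear invariants survive, so their
  coefficients vanish.  By stability the other forms take arbitrary values simultaneously, and
  choosing the conjugates of the coefficients makes the relation a vanishing sum of squares.

  In the system of equations the summand \<open>Inl i\<close> stands for the i-th invariant if it is linear and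
  for \<open>sform i - (T w\<^sub>1)\<close> otherwise, and \<open>Inr i\<close> for \<open>sform i - (T w\<^sub>2)\<close>.
\<close>

theorem two_kernel_directions_unstable:
  assumes h: "hol_germ n p h" and f: "germ_eq n f (\<omega> \<circ> h)"
    and inj: "\<And>v. v \<in> Cn n \<Longrightarrow> differential n p h 0 v = 0 \<Longrightarrow> v = 0"
    and w1: "w1 \<in> Cn n" "differential n p h 0 w1 \<in> omega_kernel"
    and w2: "w2 \<in> Cn n" "differential n p h 0 w2 \<in> omega_kernel"
    and minor: "w1 k * w2 l - w1 l * w2 k \<noteq> 0"
  shows "\<not> stable_germ n p f"
proof
  assume st: "stable_germ n p f"
  let ?T = "differential n p h 0"
  define N where "N = {j. j < p \<and> d j \<noteq> 1}"
  have finN: "finite N" by (simp add: N_def)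
  have kl: "k < n" "l < n" "k \<noteq> l"
    using minor w1(1) w2(1) unfolding Cn_def by (force simp: not_less[symmetric])+
  have "w1 \<noteq> 0" using minor by auto
  then have "?T w1 \<noteq> 0" using inj w1 by blast
  then have Nne: "N \<noteq> {}" using exists_nonlinear_invariant[OF w1(2)] by (auto simp: N_def)
  define a where "a i k = pderiv_at k (\<lambda>x. \<omega> x i) 0" for i k
  \<comment> \<open>the coefficients of the linear form x -> sform i x y\<close>
  define s where "s i y k = (\<Sum>l<p. (pderiv_at l (pderiv_at k (\<lambda>x. \<omega> x i)) 0
   + pderiv_at k (pderiv_at l (\<lambda>x. \<omega> x i)) 0) * y l)" for i y k
  have s: "(\<Sum>k<p. s i y k * x k) = sform i x y" for i x y
    unfolding sform_expand s_def ..
  define M where "M i k = (case i of Inl i \<Rightarrow> if d i = 1 then a i k else s i (?T w1) k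
      | Inr i \<Rightarrow> s i (?T w2) k)" for i :: "nat + nat" and k
  have "\<exists>c. (\<exists>i\<in>{..<p} <+> N. c i \<noteq> 0) \<and> (\<forall>k\<in>{..<p}. (\<Sum>i\<in>{..<p} <+> N. c i * M i k) = 0)"
    by (rule underdetermined_system) (use finN Nne in \<open>auto simp: card_Plus card_gt_0_iff\<close>)
  then obtain c where c: "\<exists>i\<in>{..<p} <+> N. c i \<noteq> 0" "\<And>k. k < p \<Longrightarrow> (\<Sum>i\<in>{..<p} <+> N. c i * M i k) = 0"
    by auto
  let ?cl = "\<lambda>i. c (Inl i)" and ?cr = "\<lambda>i. c (Inr i)"
  have rel: "(\<Sum>i<p. ?cl i * (if d i = 1 then \<omega> x i else sform i x (?T w1)))
      + (\<Sum>i\<in>N. ?cr i * sform i x (?T w2)) = 0" if x: "x \<in> Cn p" for x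
  proof -
    have "0 = (\<Sum>k<p. (\<Sum>i\<in>{..<p} <+> N. c i * M i k) * x k)" using c(2) by simp
    also have "\<dots> = (\<Sum>i\<in>{..<p} <+> N. c i * (\<Sum>k<p. M i k * x k))"
      unfolding sum_distrib_left sum_distrib_right by (subst sum.swap) (simp add: mult.assoc)
    also have "\<dots> = (\<Sum>i<p. ?cl i * (\<Sum>k<p. M (Inl i) k * x k)) + (\<Sum>i\<in>N. ?cr i * (\<Sum>k<p. M (Inr i) k * x k))"
      using finN by (simp add: sum.Plus)
    also have "(\<Sum>i<p. ?cl i * (\<Sum>k<p. M (Inl i) k * x k))
        = (\<Sum>i<p. ?cl i * (if d i = 1 then \<omega> x i else sform i x (?T w1)))"
      by (intro sum.cong refl arg_cong[of _ _ "(*) _"]) (simp add: M_def linear_omega x a_def s)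
    also have "(\<Sum>i\<in>N. ?cr i * (\<Sum>k<p. M (Inr i) k * x k)) = (\<Sum>i\<in>N. ?cr i * sform i x (?T w2))"
      by (simp add: M_def s)
    finally show ?thesis by simp
  qed
  \<comment> \<open>averaging kills the second-order part of the relation\<close>
  have lin0: "?cl i = 0" if i: "i < p" "d i = 1" for i
  proof -
    have "(\<Sum>i<p. (if d i = 1 then ?cl i else 0) * \<omega> x i) = 0" if x: "x \<in> Cn p" for x
    proof -
      have "(\<Sum>i<p. ?cl i * (if d i = 1 then \<omega> (avg x) i else sform i (avg x) (?T w1)))
         = (\<Sum>i<p. (if d i = 1 then ?cl i else 0) * \<omega> x i)"
        by (intro sum.cong refl) (simp add: omega_avg x sform_avg_kernel[OF _ x w1(2)])
      moreover have "(\<Sum>i\<in>N. ?cr i * sform i (avg x) (?T w2)) = 0"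
        by (intro sum.neutral) (simp add: N_def sform_avg_kernel[OF _ x w2(2)])
      ultimately show ?thesis using rel[OF avg_Cn[OF x]] by simp
    qed
    from omega_indep[OF this i(1)] show ?thesis using i(2) by simp
  qed
  have rel2: "(\<Sum>i\<in>N. ?cl i * sform i x (?T w1) + ?cr i * sform i x (?T w2)) = 0" if x: "x \<in> Cn p" for x
  proof -
    have "(\<Sum>i<p. ?cl i * (if d i = 1 then \<omega> x i else sform i x (?T w1))) = (\<Sum>i\<in>N. ?cl i * sform i x (?T w1))"
      by (rule sum.mono_neutral_cong_right) (auto simp: N_def lin0)
    then show ?thesis using rel[OF x] by (simp add: sum.distrib)
  qed
  \<comment> \<open>a linear perturbation that sends the two kernel vectors to the conjugates of the coefficients\<close>
  define \<Delta> where "\<Delta> = w1 k * w2 l - w1 l * w2 k"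
  define A where "A j i = (if i = k then (cnj (?cl j) * w2 l - cnj (?cr j) * w1 l) / \<Delta>
      else if i = l then (cnj (?cr j) * w1 k - cnj (?cl j) * w2 k) / \<Delta> else 0)" for j i
  have A: "lin n p A w j = (cnj (?cl j) * w2 l - cnj (?cr j) * w1 l) / \<Delta> * w k
       + (cnj (?cr j) * w1 k - cnj (?cl j) * w2 k) / \<Delta> * w l" if "j < p" for w j
  proof -
    have "(\<Sum>i<n. A j i * w i) = A j k * w k + (A j l * w l + (\<Sum>i\<in>{..<n} - {k} - {l}. A j i * w i))"
      using kl by (simp add: sum.remove[of "{..<n}" k] sum.remove[of "{..<n} - {k}" l])
    also have "(\<Sum>i\<in>{..<n} - {k} - {l}. A j i * w i) = 0"
      by (intro sum.neutral) (simp add: A_def)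
    finally show ?thesis using kl that by (simp add: lin_def A_def)
  qed
  have A1: "lin n p A w1 j = cnj (?cl j)" and A2: "lin n p A w2 j = cnj (?cr j)" if "j < p" for j
  proof -
    let ?a = "cnj (?cl j)" and ?b = "cnj (?cr j)"
    have A': "lin n p A w j = ((?a * w2 l - ?b * w1 l) * w k + (?b * w1 k - ?a * w2 k) * w l) / \<Delta>" for w
      using A[OF that, of w] by (simp add: add_divide_distrib)
    have "(?a * w2 l - ?b * w1 l) * w1 k + (?b * w1 k - ?a * w2 k) * w1 l = ?a * \<Delta>"
      "(?a * w2 l - ?b * w1 l) * w2 k + (?b * w1 k - ?a * w2 k) * w2 l = ?b * \<Delta>"
      by (simp_all add: \<Delta>_def algebra_simps)
    then show "lin n p A w1 j = ?a" "lin n p A w2 j = ?b"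
      using minor by (simp_all only: A') (simp_all add: \<Delta>_def)
  qed
  obtain v where v: "v \<in> Cn n" "\<And>w j. w \<in> Cn n \<Longrightarrow> ?T w \<in> omega_kernel \<Longrightarrow> j < p \<Longrightarrow> d j \<noteq> 1 \<Longrightarrow>
      2 * lin n p A w j = sform j (?T v) (?T w)"
    using stable_sform[OF h f st, of A] by blast
  have "(\<Sum>i\<in>N. ?cl i * (2 * cnj (?cl i)) + ?cr i * (2 * cnj (?cr i))) = 0"
  proof -
    have "(\<Sum>i\<in>N. ?cl i * (2 * cnj (?cl i)) + ?cr i * (2 * cnj (?cr i)))
       = (\<Sum>i\<in>N. ?cl i * sform i (?T v) (?T w1) + ?cr i * sform i (?T v) (?T w2))"
      by (intro sum.cong refl) (simp add: N_def v(2)[OF w1, symmetric] v(2)[OF w2, symmetric] A1 A2)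
    then show ?thesis using rel2[OF differential_Cn] by simp
  qed
  also have "(\<Sum>i\<in>N. ?cl i * (2 * cnj (?cl i)) + ?cr i * (2 * cnj (?cr i)))
      = of_real (\<Sum>i\<in>N. 2 * (cmod (?cl i))\<^sup>2 + 2 * (cmod (?cr i))\<^sup>2)"
    by (simp add: complex_norm_square[symmetric] mult.left_commute[of _ 2])
  finally have "(\<Sum>i\<in>N. 2 * (cmod (?cl i))\<^sup>2 + 2 * (cmod (?cr i))\<^sup>2) = 0"
    using of_real_eq_0_iff by blast
  then have "\<forall>i\<in>N. 2 * (cmod (?cl i))\<^sup>2 + 2 * (cmod (?cr i))\<^sup>2 = 0"
    using finN by (subst (asm) sum_nonneg_eq_0_iff) auto
  then have "?cl i = 0 \<and> ?cr i = 0" if "i \<in> N" for i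
    using that by (simp add: add_nonneg_eq_0_iff)
  then show False using c(1) lin0 by (auto simp: N_def)
qed

end

section \<open>Reflection groups of rank one\<close>

lemma pos_def_form_add:
  "pos_def_form p B \<Longrightarrow> x \<in> Cn p \<Longrightarrow> y \<in> Cn p \<Longrightarrow> z \<in> Cn p \<Longrightarrow> B (x + y) z = B x z + B y z"
  unfolding pos_def_form_def hermitian_form_def by metis

lemma pos_def_form_scale:
  "pos_def_form p B \<Longrightarrow> x \<in> Cn p \<Longrightarrow> y \<in> Cn p \<Longrightarrow> B (cscale c x) y = c * B x y"
  unfolding pos_def_form_def hermitian_form_def by metis

lemma pos_def_form_cnj:
  "pos_def_form p B \<Longrightarrow> x \<in> Cn p \<Longrightarrow> y \<in> Cn p \<Longrightarrow> B y x = cnj (B x y)"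
  unfolding pos_def_form_def hermitian_form_def by metis

lemma pos_def_form_zero: "pos_def_form p B \<Longrightarrow> x \<in> Cn p \<Longrightarrow> B x x = 0 \<Longrightarrow> x = 0"
  unfolding pos_def_form_def by fastforce

lemma Cn_diff: "x \<in> Cn p \<Longrightarrow> y \<in> Cn p \<Longrightarrow> x - y \<in> Cn p"
  by (simp add: Cn_def)

lemma subspace_Cn: "cvs.subspace (Cn p)"
  by (rule cvs.subspaceI) (simp_all add: Cn_def cscale_def)

lemma group_unitary_group: "Group.group (unitary_group p B)"
proof -
  let ?H = "{g \<in> Bij (Cn p).
        (\<forall>x\<in>Cn p. \<forall>y\<in>Cn p. g (x + y) = g x + g y) \<and>
        (\<forall>c. \<forall>x\<in>Cn p. g (cscale c x) = cscale c (g x)) \<and>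
        (\<forall>x\<in>Cn p. \<forall>y\<in>Cn p. B (g x) (g y) = B x y)}"
  have add: "x + y \<in> Cn p" and sc: "cscale c x \<in> Cn p" if "x \<in> Cn p" "y \<in> Cn p" for x y c
    using that by (simp_all add: Cn_def cscale_def)
  have cl: "g x \<in> Cn p" if "g \<in> Bij (Cn p)" "x \<in> Cn p" for g x
    using that by (auto simp: Bij_def bij_betw_def)
  have "subgroup ?H (BijGroup (Cn p))"
  proof (rule group.subgroupI[OF group_BijGroup])
    show "?H \<subseteq> carrier (BijGroup (Cn p))" by (auto simp: BijGroup_def)
    have "(\<lambda>x\<in>Cn p. x) \<in> ?H" by (simp add: id_Bij add sc)
    then show "?H \<noteq> {}" by blast
  next
    fix g assume g: "g \<in> ?H"
    then have gB: "g \<in> Bij (Cn p)" by simp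
    define t where "t = (\<lambda>x\<in>Cn p. inv_into (Cn p) g x)"
    have tB: "t \<in> Bij (Cn p)" unfolding t_def by (rule restrict_inv_into_Bij[OF gB])
    have gt: "g (t x) = x" if "x \<in> Cn p" for x
      using gB that by (auto simp: t_def Bij_def bij_betw_def f_inv_into_f)
    have tg: "t x = y" if "y \<in> Cn p" "g y = x" for x y
      using gB that cl[OF gB that(1)] by (auto simp: t_def Bij_def bij_betw_def)
    have "t \<in> ?H"
    proof (intro CollectI conjI tB ballI allI)
      fix x y assume x: "x \<in> Cn p" and y: "y \<in> Cn p"
      note tx = cl[OF tB x] and ty = cl[OF tB y]
      have "g (t x + t y) = x + y" using g tx ty gt[OF x] gt[OF y] by simp
      then show "t (x + y) = t x + t y" by (rule tg[OF add[OF tx ty]])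
      have "B (g (t x)) (g (t y)) = B (t x) (t y)" using g tx ty by blast
      then show "B (t x) (t y) = B x y" by (simp only: gt[OF x] gt[OF y])
    next
      fix c x assume x: "x \<in> Cn p"
      note tx = cl[OF tB x]
      have "g (cscale c (t x)) = cscale c x" using g tx gt[OF x] by simp
      then show "t (cscale c x) = cscale c (t x)" by (rule tg[OF sc[OF tx tx]])
    qed
    then show "inv\<^bsub>BijGroup (Cn p)\<^esub> g \<in> ?H"
      using inv_BijGroup[OF gB] by (simp only: t_def)
  next
    fix g k assume g: "g \<in> ?H" and k: "k \<in> ?H"
    then have gB: "g \<in> Bij (Cn p)" and kB: "k \<in> Bij (Cn p)" by auto
    have "compose (Cn p) g k \<in> ?H"
    proof (intro CollectI conjI compose_Bij[OF gB kB] ballI allI)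
      fix x y assume x: "x \<in> Cn p" and y: "y \<in> Cn p"
      note kx = cl[OF kB x] and ky = cl[OF kB y]
      have "g (k (x + y)) = g (k x) + g (k y)" using g k x y kx ky by simp
      then show "compose (Cn p) g k (x + y) = compose (Cn p) g k x + compose (Cn p) g k y"
        using x y add[OF x y] by (simp only: compose_eq)
      have "B (g (k x)) (g (k y)) = B x y" using g k x y kx ky by simp
      then show "B (compose (Cn p) g k x) (compose (Cn p) g k y) = B x y"
        using x y by (simp only: compose_eq)
    next
      fix c x assume x: "x \<in> Cn p"
      have "g (k (cscale c x)) = cscale c (g (k x))" using g k x cl[OF kB x] by simp
      then show "compose (Cn p) g k (cscale c x) = cscale c (compose (Cn p) g k x)"
        using x sc[OF x x] by (simp only: compose_eq)
    qed
    then show "g \<otimes>\<^bsub>BijGroup (Cn p)\<^esub> k \<in> ?H"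
      using gB kB by (simp add: BijGroup_def)
  qed
  from subgroup.subgroup_is_group[OF this group_BijGroup]
  show ?thesis by (simp add: unitary_group_def)
qed

lemma unitary_group_mult:
  "g \<in> carrier (unitary_group p B) \<Longrightarrow> k \<in> carrier (unitary_group p B) \<Longrightarrow> x \<in> Cn p \<Longrightarrow>
    (g \<otimes>\<^bsub>unitary_group p B\<^esub> k) x = g (k x)"
  by (simp add: unitary_group_def BijGroup_def compose_eq)

lemma unitary_group_one: "x \<in> Cn p \<Longrightarrow> \<one>\<^bsub>unitary_group p B\<^esub> x = x"
  by (simp add: unitary_group_def BijGroup_def)

lemma generate_fixes:
  assumes S: "S \<subseteq> carrier (unitary_group p B)" and x: "x \<in> Cn p"
    and fixed: "\<And>s. s \<in> S \<Longrightarrow> s x = x" and g: "g \<in> generate (unitary_group p B) S"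
  shows "g x = x"
proof -
  let ?U = "unitary_group p B"
  interpret U: Group.group ?U by (rule group_unitary_group)
  have cl: "s y \<in> Cn p" if "s \<in> carrier ?U" "y \<in> Cn p" for s y
    using that by (auto simp: unitary_group_def Bij_def bij_betw_def)
  show ?thesis using g
  proof (induction rule: generate.induct)
    case one show ?case by (rule unitary_group_one[OF x])
  next
    case (incl s) then show ?case by (rule fixed)
  next
    case (inv s)
    then have s: "s \<in> carrier ?U" using S by blast
    have "(inv\<^bsub>?U\<^esub> s) x = (inv\<^bsub>?U\<^esub> s) (s x)" using fixed[OF inv] by simp
    also have "\<dots> = (inv\<^bsub>?U\<^esub> s \<otimes>\<^bsub>?U\<^esub> s) x"
      using unitary_group_mult[OF U.inv_closed[OF s] s x] by simp
    also have "\<dots> = x" using U.l_inv[OF s] unitary_group_one[OF x] by simp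
    finally show ?case .
  next
    case (eng g k)
    have "g \<in> carrier ?U" "k \<in> carrier ?U"
      using eng U.generate_in_carrier[OF S] by blast+
    then show ?case using eng x by (simp add: unitary_group_mult)
  qed
qed

text \<open>
  For a reflection s and any x, the vector \<open>x - s x\<close> is orthogonal to the fixed space of s, hence a
  multiple of the vector a spanning all these orthogonal complements.  If x is orthogonal to a, then
  it is orthogonal to \<open>x - s x\<close>, and since s preserves lengths this forces \<open>s x = x\<close>.
\<close>

lemma rank_one_fixes_hyperplane:
  assumes B: "pos_def_form p B" and G: "reflection_group p B G" and rank: "refl_rank p B G = 1"
  shows "\<exists>a\<in>Cn p. \<forall>x\<in>Cn p. B x a = 0 \<longrightarrow> (\<forall>g\<in>G. g x = x)"
proof -
  let ?U = "unitary_group p B"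
  obtain S where S: "S \<subseteq> {s. reflection p B s}" "G = generate ?U S"
    using G by (auto simp: reflection_group_def)
  define R where "R = (\<Union>s\<in>{s \<in> G. reflection p B s}. orth_compl p B (fixed_space p s))"
  have dim: "cvs.dim (cvs.span R) = 1" using rank by (simp add: refl_rank_def R_def)
  obtain b where b: "b \<subseteq> cvs.span R" "cvs.span R \<subseteq> cvs.span b" "card b = 1"
    using cvs.basis_exists[of "cvs.span R"] dim by metis
  then obtain a where a: "b = {a}" by (auto simp: card_1_singleton_iff)
  have "R \<subseteq> Cn p" by (auto simp: R_def orth_compl_def)
  then have "cvs.span R \<subseteq> Cn p" by (rule cvs.span_minimal[OF _ subspace_Cn])
  then have aC: "a \<in> Cn p" using a b by blast
  have line: "\<exists>c. y = cscale c a" if "y \<in> R" for y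
    using cvs.span_base[OF that] b(2) by (auto simp: a cvs.span_singleton)
  note Badd = pos_def_form_add[OF B] and Bsc = pos_def_form_scale[OF B]
    and Bcnj = pos_def_form_cnj[OF B]
  have "s x = x" if s: "s \<in> S" and x: "x \<in> Cn p" and xa: "B x a = 0" for s x
  proof -
    have refl: "reflection p B s" using S(1) s by blast
    then have sU: "s \<in> carrier ?U" by (simp add: reflection_def)
    then have sx: "s x \<in> Cn p" and sB: "\<And>y z. y \<in> Cn p \<Longrightarrow> z \<in> Cn p \<Longrightarrow> B (s y) (s z) = B y z"
      using x by (auto simp: unitary_group_def Bij_def bij_betw_def)
    have sG: "s \<in> G" using s S(2) generate.incl by metis
    define \<delta> where "\<delta> = x - s x"
    have \<delta>C: "\<delta> \<in> Cn p" unfolding \<delta>_def by (rule Cn_diff[OF x sx])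
    have dec: "x = \<delta> + s x" by (simp add: \<delta>_def)
    have split: "B x y = B \<delta> y + B (s x) y" if "y \<in> Cn p" for y
      using Badd[OF \<delta>C sx that] dec by simp
    have "B \<delta> y = 0" if "y \<in> fixed_space p s" for y
    proof -
      have y: "y \<in> Cn p" "s y = y" using that by (auto simp: fixed_space_def)
      then show ?thesis using split[OF y(1)] sB[OF x y(1)] by simp
    qed
    then have "\<delta> \<in> R" using \<delta>C sG refl by (auto simp: R_def orth_compl_def)
    then obtain c where c: "\<delta> = cscale c a" using line by blast
    have "B a x = 0" using Bcnj[OF x aC] xa by simp
    then have 1: "B \<delta> x = 0" using Bsc[OF aC x] c by simp
    have 2: "B (s x) x = B x x" using split[OF x] 1 by simp
    have "B x (s x) = cnj (B (s x) x)" by (rule Bcnj[OF sx x])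
    also have "\<dots> = B x x" using 2 Bcnj[OF x x] by simp
    finally have 3: "B \<delta> (s x) = 0" using split[OF sx] sB[OF x x] by simp
    have "B x \<delta> = 0" using Bcnj[OF \<delta>C x] 1 by simp
    moreover have "B (s x) \<delta> = 0" using Bcnj[OF \<delta>C sx] 3 by simp
    ultimately have "B \<delta> \<delta> = 0" using split[OF \<delta>C] by simp
    then have "\<delta> = 0" by (rule pos_def_form_zero[OF B \<delta>C])
    then show ?thesis using dec by simp
  qed
  moreover have "S \<subseteq> carrier ?U" using S(1) by (auto simp: reflection_def)
  ultimately show ?thesis
    unfolding S(2) using generate_fixes aC by (intro bexI[of _ a]) blast+
qed

section \<open>Choosing coordinates\<close>

text \<open>
  A matrix with independent columns contains an invertible square submatrix, and one nonzero row
  can be prescribed.  A smallest set of rows containing the prescribed one and still killing no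
  nonzero vector works: with fewer than n rows some vector is killed, and with more than n rows
  there is a relation through which a further row can be dropped.
\<close>

lemma select_rows:
  fixes R :: "nat \<Rightarrow> nat \<Rightarrow> complex"
  assumes inj: "\<And>v. v \<in> Cn n \<Longrightarrow> (\<And>k. k < p \<Longrightarrow> (\<Sum>i<n. R k i * v i) = 0) \<Longrightarrow> v = 0"
    and j0: "j0 < p" "i0 < n" "R j0 i0 \<noteq> 0"
  shows "\<exists>J\<subseteq>{..<p}. j0 \<in> J \<and> card J = n \<and>
    (\<forall>v\<in>Cn n. (\<forall>k\<in>J. (\<Sum>i<n. R k i * v i) = 0) \<longrightarrow> v = 0)"
proof -
  define P where "P J \<longleftrightarrow> J \<subseteq> {..<p} \<and> j0 \<in> J \<and>
    (\<forall>v\<in>Cn n. (\<forall>k\<in>J. (\<Sum>i<n. R k i * v i) = 0) \<longrightarrow> v = 0)" for J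
  have "P {..<p}" unfolding P_def using inj j0 by blast
  then obtain J where J: "P J" "\<And>J'. P J' \<Longrightarrow> card J \<le> card J'"
    using ex_has_least_nat[of P "{..<p}" card] by blast
  have fin: "finite J" using J(1) finite_subset[of J "{..<p}"] by (simp add: P_def)
  have "\<not> card J < n"
  proof
    assume "card J < n"
    then obtain c where c: "\<exists>i\<in>{..<n}. c i \<noteq> 0" "\<And>k. k \<in> J \<Longrightarrow> (\<Sum>i<n. c i * R k i) = 0"
      using underdetermined_system[of J "{..<n}" "\<lambda>i k. R k i"] fin by auto
    define v where "v i = (if i < n then c i else 0)" for i
    have "v \<in> Cn n" by (simp add: v_def Cn_def)
    moreover have "\<forall>k\<in>J. (\<Sum>i<n. R k i * v i) = 0" using c(2) by (simp add: v_def mult.commute)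
    ultimately have "v = 0" using J(1) by (simp add: P_def)
    then have "v i = 0" for i by simp
    then show False using c(1) by (metis lessThan_iff v_def)
  qed
  moreover have "\<not> n < card J"
  proof
    assume "n < card J"
    then obtain c where c: "\<exists>k\<in>J. c k \<noteq> 0" "\<And>i. i < n \<Longrightarrow> (\<Sum>k\<in>J. c k * R k i) = 0"
      using underdetermined_system[of "{..<n}" J R] fin by auto
    \<comment> \<open>the relation involves a row other than j0, which can then be dropped\<close>
    have "\<exists>k\<in>J - {j0}. c k \<noteq> 0"
    proof (rule ccontr)
      assume *: "\<not> (\<exists>k\<in>J - {j0}. c k \<noteq> 0)"
      have "j0 \<in> J" using J(1) by (simp add: P_def)
      then have "(\<Sum>k\<in>J. c k * R k i0) = c j0 * R j0 i0 + (\<Sum>k\<in>J - {j0}. c k * R k i0)"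
        using fin by (simp add: sum.remove)
      also have "(\<Sum>k\<in>J - {j0}. c k * R k i0) = 0" using * by (intro sum.neutral) auto
      finally have "c j0 = 0" using c(2)[OF j0(2)] j0(3) by simp
      then show False using c(1) * by blast
    qed
    then obtain k where k: "k \<in> J" "k \<noteq> j0" "c k \<noteq> 0" by blast
    have "P (J - {k})"
      unfolding P_def
    proof (intro conjI ballI impI)
      show "J - {k} \<subseteq> {..<p}" "j0 \<in> J - {k}" using J(1) k by (auto simp: P_def)
      fix v assume v: "v \<in> Cn n" "\<forall>l\<in>J - {k}. (\<Sum>i<n. R l i * v i) = 0"
      have "0 = (\<Sum>i<n. (\<Sum>l\<in>J. c l * R l i) * v i)" using c(2) by simp
      also have "\<dots> = (\<Sum>l\<in>J. c l * (\<Sum>i<n. R l i * v i))"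
        unfolding sum_distrib_left sum_distrib_right by (subst sum.swap) (simp add: mult.assoc)
      also have "\<dots> = c k * (\<Sum>i<n. R k i * v i)"
        using fin k(1) v(2) by (simp add: sum.remove[of J k])
      finally have "(\<Sum>i<n. R k i * v i) = 0" using k(3) by simp
      then have "\<forall>l\<in>J. (\<Sum>i<n. R l i * v i) = 0" using v(2) by blast
      then show "v = 0" using J(1) v(1) by (simp add: P_def)
    qed
    then have "card J \<le> card (J - {k})" by (rule J(2))
    then show False using card_Diff1_less[OF fin k(1)] by simp
  qed
  ultimately have "card J = n" by simp
  then show ?thesis using J(1) by (auto simp: P_def)
qed

lemma enumerate_with_last:
  assumes J: "J \<subseteq> {..<p}" "card J = n" "j0 \<in> J"
  shows "\<exists>\<pi>. \<pi> ` {..<n} = J \<and> \<pi> ` {..<p} = {..<p} \<and> \<pi> (n - 1) = j0 \<and> inj_on \<pi> {..<p} \<and> 1 \<le> n \<and> n \<le> p"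
proof -
  have fin: "finite J" using J(1) finite_subset by blast
  have n: "1 \<le> n" "n \<le> p"
    using J fin card_mono[of "{..<p}" J] by (auto simp: Suc_le_eq card_gt_0_iff)
  have "card (J - {j0}) = card {..<n - 1}" using J fin by simp
  then obtain b1 where b1: "bij_betw b1 {..<n - 1} (J - {j0})"
    using finite_same_card_bij[of "{..<n - 1}" "J - {j0}"] fin by auto
  have "card ({..<p} - J) = card {n..<p}" using J fin by (simp add: card_Diff_subset)
  then obtain b2 where b2: "bij_betw b2 {n..<p} ({..<p} - J)"
    using finite_same_card_bij[of "{n..<p}" "{..<p} - J"] by auto
  define \<pi> where "\<pi> i = (if i < n - 1 then b1 i else if i = n - 1 then j0 else b2 i)" for i
  have 1: "bij_betw \<pi> {..<n - 1} (J - {j0})"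
    using b1 by (rule bij_betw_cong[THEN iffD1, rotated]) (simp add: \<pi>_def)
  have 2: "bij_betw \<pi> {n - 1} {j0}" by (simp add: \<pi>_def bij_betw_def)
  have 3: "bij_betw \<pi> {n..<p} ({..<p} - J)"
    using b2 by (rule bij_betw_cong[THEN iffD1, rotated]) (use n in \<open>auto simp: \<pi>_def\<close>)
  have "bij_betw \<pi> ({..<n - 1} \<union> {n - 1}) ((J - {j0}) \<union> {j0})"
    by (rule bij_betw_combine[OF 1 2]) auto
  moreover have "{..<n - 1} \<union> {n - 1} = {..<n}" using n by auto
  moreover have "(J - {j0}) \<union> {j0} = J" using J by auto
  ultimately have 4: "bij_betw \<pi> {..<n} J" by simp
  have "bij_betw \<pi> ({..<n} \<union> {n..<p}) (J \<union> ({..<p} - J))"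
    by (rule bij_betw_combine[OF 4 3]) auto
  moreover have "{..<n} \<union> {n..<p} = {..<p}" using n by auto
  moreover have "J \<union> ({..<p} - J) = {..<p}" using J by auto
  ultimately have 5: "bij_betw \<pi> {..<p} {..<p}" by simp
  show ?thesis using 4 5 n by (intro exI[of _ \<pi>]) (auto simp: bij_betw_def \<pi>_def)
qed

section \<open>Rank one: reduction to a fold\<close>

context basic_invariants
begin

text \<open>
  For a fixed vector x the form \<open>B(-, x)\<close> is invariant, so it vanishes on the kernel, and in
  particular \<open>B(x, x) = 0\<close>.
\<close>

lemma fixed_kernel_vector_zero:
  assumes B: "pos_def_form p B" and Binv: "\<And>g x y. g \<in> G \<Longrightarrow> x \<in> Cn p \<Longrightarrow> y \<in> Cn p \<Longrightarrow> B (g x) (g y) = B x y"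
    and fixed: "\<And>g. g \<in> G \<Longrightarrow> g x = x" and x: "x \<in> omega_kernel"
  shows "x = 0"
proof -
  have xC: "x \<in> Cn p" using x by (simp add: omega_kernel_def)
  have "B x x = 0"
  proof (rule invariant_form_vanishes[of "\<lambda>y. B y x", OF _ _ _ x])
    show "B (y + z) x = B y x + B z x" if "y \<in> Cn p" "z \<in> Cn p" for y z
      by (rule pos_def_form_add[OF B that xC])
    show "B (cscale c y) x = c * B y x" if "y \<in> Cn p" for c y
      by (rule pos_def_form_scale[OF B that xC])
    show "B (g y) x = B y x" if "g \<in> G" "y \<in> Cn p" for g y
      using Binv[OF that xC] fixed[OF that(1)] by simp
  qed
  then show ?thesis by (rule pos_def_form_zero[OF B xC])
qed

text \<open>
  If there were two nonlinear invariants, the linear ones would impose at most p - 2 equations, and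
  together with \<open>L = 0\<close> at most p - 1; so some nonzero vector of the kernel would satisfy \<open>L = 0\<close>.
\<close>

lemma nonlinear_invariant_unique:
  assumes L: "\<And>x y. x \<in> Cn p \<Longrightarrow> y \<in> Cn p \<Longrightarrow> L (x + y) = L x + L y"
      "\<And>c x. x \<in> Cn p \<Longrightarrow> L (cscale c x) = c * L x"
    and W: "\<And>x. x \<in> omega_kernel \<Longrightarrow> L x = 0 \<Longrightarrow> x = 0"
    and j: "j < p" "d j \<noteq> 1" "k < p" "d k \<noteq> 1"
  shows "j = k"
proof (rule ccontr)
  assume "j \<noteq> k"
  define M where "M i l = (if l = k then L (\<lambda>m. if m = i then 1 else 0) else pderiv_at i (\<lambda>x. \<omega> x l) 0)" for i l
  have "\<exists>c. (\<exists>i\<in>{..<p}. c i \<noteq> 0) \<and> (\<forall>l\<in>{..<p} - {j}. (\<Sum>i<p. c i * M i l) = 0)"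
    by (rule underdetermined_system) (use j in auto)
  then obtain c where c: "\<exists>i<p. c i \<noteq> 0" "\<And>l. l < p \<Longrightarrow> l \<noteq> j \<Longrightarrow> (\<Sum>i<p. c i * M i l) = 0"
    by auto
  define x where "x = (\<lambda>i. if i < p then c i else 0)"
  have xC: "x \<in> Cn p" by (simp add: x_def Cn_def)
  have "\<omega> x l = 0" if l: "l < p" "d l = 1" for l
  proof -
    have "l \<noteq> j" "l \<noteq> k" using l j by auto
    have "\<omega> x l = (\<Sum>i<p. c i * M i l)"
      unfolding linear_omega[OF l xC] using \<open>l \<noteq> k\<close>
      by (intro sum.cong refl) (simp add: M_def x_def)
    then show ?thesis using c(2)[OF l(1) \<open>l \<noteq> j\<close>] by simp
  qed
  then have xW: "x \<in> omega_kernel" using xC by (simp add: omega_kernel_iff)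
  have "L x = (\<Sum>i<p. L (\<lambda>m. if m = i then 1 else 0) * x i)"
    by (rule linear_form_coeffs[OF L xC])
  also have "\<dots> = (\<Sum>i<p. c i * M i k)"
    by (intro sum.cong refl) (simp add: M_def x_def)
  also have "\<dots> = 0" using c(2)[of k] j \<open>j \<noteq> k\<close> by simp
  finally have "x = 0" by (rule W[OF xW])
  then have "x i = 0" for i by simp
  then show False using c(1) by (metis x_def)
qed

text \<open>
  The form L is an equation of the hyperplane fixed by the group.  Every x is \<open>u x + c x w\<^sub>0\<close> with
  \<open>u x\<close> in this hyperplane and \<open>w\<^sub>0 = T w\<close> spanning the kernel line.  The Hessian form of the
  nonlinear invariant has no mixed term for this decomposition, so the invariant at x is its value
  at \<open>u x\<close> plus \<open>\<kappa> (c x)\<^sup>2\<close>.  The matrix M collects the linear invariants and, in row \<open>j0\<close>, the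
  coordinate c; it is invertible, and \<open>\<rho>\<close> expresses the value at \<open>u x\<close> through the linear invariants.
\<close>

theorem stable_rank_one_fold:
  assumes h: "hol_germ n p h" and f: "germ_eq n f (\<omega> \<circ> h)"
    and inj: "\<And>v. v \<in> Cn n \<Longrightarrow> differential n p h 0 v = 0 \<Longrightarrow> v = 0"
    and st: "stable_germ n p f"
    and w: "w \<in> Cn n" "w \<noteq> 0" "differential n p h 0 w \<in> omega_kernel"
    and L: "\<And>x y. x \<in> Cn p \<Longrightarrow> y \<in> Cn p \<Longrightarrow> L (x + y) = L x + L y"
      "\<And>c x. x \<in> Cn p \<Longrightarrow> L (cscale c x) = c * L x"
    and fixed: "\<And>g x. g \<in> G \<Longrightarrow> x \<in> Cn p \<Longrightarrow> L x = 0 \<Longrightarrow> g x = x"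
    and WL: "\<And>x. x \<in> omega_kernel \<Longrightarrow> L x = 0 \<Longrightarrow> x = 0"
  shows "\<exists>f'. fold_map n p f' \<and> A_equiv n p f f'"
proof -
  let ?T = "differential n p h 0"
  define w0 where "w0 = ?T w"
  have w0W: "w0 \<in> omega_kernel" and w0C: "w0 \<in> Cn p" using w(3) by (simp_all add: w0_def omega_kernel_def)
  have w0ne: "w0 \<noteq> 0" using inj[OF w(1)] w(2) by (auto simp: w0_def)
  obtain j0 where j0: "j0 < p" "d j0 \<noteq> 1" using exists_nonlinear_invariant[OF w0W w0ne] by blast
  have d1: "d j = 1" if "j < p" "j \<noteq> j0" for j
    using nonlinear_invariant_unique[of L, OF L WL that(1) _ j0] that(2) by blast
  have Lw0: "L w0 \<noteq> 0" using WL[OF w0W] w0ne by blast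
  define c where "c x = L x / L w0" for x
  define u where "u x = x - cscale (c x) w0" for x
  have scC: "cscale z y \<in> Cn p" if "y \<in> Cn p" for z y using that by (simp add: Cn_def cscale_def)
  have uC: "u x \<in> Cn p" if "x \<in> Cn p" for x
    unfolding u_def by (rule Cn_diff[OF that scC[OF w0C]])
  have dec: "x = u x + cscale (c x) w0" for x by (simp add: u_def)
  have Lu: "L (u x) = 0" if x: "x \<in> Cn p" for x
  proof -
    have "L x = L (u x) + c x * L w0"
      using L(1)[OF uC[OF x] scC[OF w0C], of "c x"] L(2)[OF w0C, of "c x"] dec[of x] by simp
    then show ?thesis using Lw0 by (simp add: c_def)
  qed
  have su: "sform j0 (u x) w0 = 0" if x: "x \<in> Cn p" for x
    using sform_avg_kernel[OF j0(1) uC[OF x] w0W] avg_fixed[of "u x"] fixed[OF _ uC[OF x] Lu[OF x]] by simp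
  define S where "S = sform j0 w0 w0"
  have sx: "sform j0 x w0 = c x * S" if x: "x \<in> Cn p" for x
  proof -
    have "sform j0 x w0 = sform j0 (u x) w0 + sform j0 (cscale (c x) w0) w0"
      by (subst dec) (rule sform_add)
    then show ?thesis using su[OF x] by (simp only: sform_scale S_def) simp
  qed
  obtain i1 where i1: "i1 < n" "w i1 \<noteq> 0"
  proof -
    have "w k = 0" if "k \<ge> n" for k using w(1) that by (simp add: Cn_def)
    then show ?thesis using w(2) that by (metis ext leI zero_fun_apply)
  qed
  \<comment> \<open>stability forces the nonlinear invariant to be quadratic and nonzero along the line\<close>
  have S: "S \<noteq> 0"
  proof
    assume "S = 0"
    obtain v where v: "v \<in> Cn n" "\<And>w j. w \<in> Cn n \<Longrightarrow> ?T w \<in> omega_kernel \<Longrightarrow> j < p \<Longrightarrow> d j \<noteq> 1 \<Longrightarrow>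
      2 * lin n p (\<lambda>j i. if i = i1 then 1 else 0) w j = sform j (?T v) (?T w)"
      using stable_sform[OF h f st, of "\<lambda>j i. if i = i1 then 1 else 0"] by blast
    have "2 * lin n p (\<lambda>j i. if i = i1 then 1 else 0) w j0 = sform j0 (?T v) w0"
      unfolding w0_def by (rule v(2)[OF w(1,3) j0])
    also have "\<dots> = 0" using sx[OF differential_Cn] \<open>S = 0\<close> by simp
    also have "lin n p (\<lambda>j i. if i = i1 then 1 else 0) w j0 = w i1"
      using i1 j0 by (simp add: lin_def if_distrib[of "\<lambda>x. x * _"] cong: if_cong)
    finally show False using i1 by simp
  qed
  have d2: "d j0 = 2"
  proof (rule ccontr)
    assume "d j0 \<noteq> 2"
    then have "S = 0" using omega_jets(2)[OF j0(1) w0C] by (simp add: S_def sform_def)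
    then show False using S by simp
  qed
  have quad: "\<omega> x j0 = sform j0 x x / 4" if "x \<in> Cn p" for x
    using omega_jets(2)[OF j0(1) that] d2 by (simp add: sform_def)
  define \<kappa> where "\<kappa> = S / 4"
  have \<kappa>: "\<kappa> \<noteq> 0" using S by (simp add: \<kappa>_def)
  have omega_split: "\<omega> x j0 = \<omega> (u x) j0 + \<kappa> * (c x)\<^sup>2" if x: "x \<in> Cn p" for x
  proof -
    have split: "sform j0 x y = sform j0 (u x) y + c x * sform j0 w0 y" for y
      using sform_add[of j0 "u x" "cscale (c x) w0" y] unfolding dec[of x, symmetric] sform_scale .
    have "sform j0 (u x) x = sform j0 (u x) (u x) + c x * sform j0 (u x) w0"
      using split[of "u x"] sform_commute[of j0 x "u x"] sform_commute[of j0 w0 "u x"] by argo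
    with split[of x] have "sform j0 x x = sform j0 (u x) (u x) + c x * sform j0 (u x) w0 + c x * sform j0 w0 x"
      by argo
    also have "sform j0 w0 x = c x * S" using sx[OF x] by (simp add: sform_commute)
    finally show ?thesis using su[OF x] by (simp add: quad x uC \<kappa>_def power2_eq_square)
  qed
  \<comment> \<open>the coefficients of the linear form x -> sform j0 x w0\<close>
  define s where "s k = (\<Sum>l<p. (pderiv_at l (pderiv_at k (\<lambda>x. \<omega> x j0)) 0
   + pderiv_at k (pderiv_at l (\<lambda>x. \<omega> x j0)) 0) * w0 l)" for k
  define M where "M k i = (if k = j0 then s i / S else pderiv_at i (\<lambda>x. \<omega> x k) 0)" for k i
  have Mx: "lin p p M x k = (if k = j0 then c x else \<omega> x k)" if x: "x \<in> Cn p" and k: "k < p" for x k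
  proof (cases "k = j0")
    case True
    have "(\<Sum>i<p. s i / S * x i) = sform j0 x w0 / S"
    proof -
      have "sform j0 x w0 = (\<Sum>i<p. s i * x i)" unfolding sform_expand s_def ..
      then show ?thesis by (simp add: sum_divide_distrib)
    qed
    then show ?thesis using True k S sx[OF x] by (simp add: lin_def M_def)
  next
    case False
    then show ?thesis using k linear_omega[OF k d1[OF k False] x] by (simp add: lin_def M_def)
  qed
  have cw0: "c w0 = 1" using Lw0 by (simp add: c_def)
  have Mw0: "lin p p M w0 k = (if k = j0 then 1 else 0)" if "k < p" for k
    using Mx[OF w0C that] d1[OF that] w0W that by (auto simp: cw0 omega_kernel_iff)
  have Minj: "x = 0" if x: "x \<in> Cn p" "lin p p M x = 0" for x
  proof -
    have z: "(if k = j0 then c x else \<omega> x k) = 0" if "k < p" for k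
      using Mx[OF x(1) that] x(2) by simp
    have "\<omega> x k = 0" if "k < p" "d k = 1" for k using z[OF that(1)] that j0 by (auto split: if_splits)
    then have "x \<in> omega_kernel" using x(1) by (simp add: omega_kernel_iff)
    moreover have "L x = 0" using z[OF j0(1)] Lw0 by (simp add: c_def)
    ultimately show ?thesis by (rule WL)
  qed
  obtain N where N: "\<And>x. x \<in> Cn p \<Longrightarrow> lin p p N (lin p p M x) = x"
    using lin_inj_imp_inverse[of p M] Minj by metis
  define N' where "N' k i = (if i = j0 then 0 else N k i)" for k i
  \<comment> \<open>N' ignores the coordinate j0, which makes rho a function of the linear invariants alone\<close>
  define \<rho> where "\<rho> y = \<omega> (lin p p N' y) j0" for y
  \<comment> \<open>the linear invariants of x determine its component in the fixed hyperplane\<close>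
  have N'\<omega>: "lin p p N' (\<omega> x) = u x" if x: "x \<in> Cn p" for x
  proof -
    have "lin p p M (u x) = (\<lambda>k. if k = j0 then 0 else \<omega> x k)"
    proof
      fix k show "lin p p M (u x) k = (if k = j0 then 0 else \<omega> x k)"
      proof (cases "k < p")
        case True
        have "lin p p M (u x) k = lin p p M x k - c x * lin p p M w0 k"
          unfolding u_def lin_diff lin_scale by (simp add: cscale_def)
        then show ?thesis using Mx[OF x True] Mw0[OF True] by auto
      next
        case False
        then show ?thesis using omega_Cn[OF x] j0 by (simp add: lin_def Cn_def)
      qed
    qed
    moreover have "lin p p N' (\<omega> x) = lin p p N (\<lambda>k. if k = j0 then 0 else \<omega> x k)"
      unfolding lin_def N'_def by (intro ext if_cong refl sum.cong) auto
    ultimately show ?thesis using N[OF uC[OF x]] by simp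
  qed
  have normal: "\<omega> x j0 = \<rho> (\<omega> x) + \<kappa> * (c x)\<^sup>2" if "x \<in> Cn p" for x
    using omega_split[OF that] N'\<omega>[OF that] by (simp add: \<rho>_def)
  \<comment> \<open>source coordinates: n of the coordinates of M h, among them the one along the line\<close>
  define D where "D l i = pderiv_at i (\<lambda>x. h x l) 0" for l i
  have TD: "?T v = lin n p D v" for v unfolding differential_eq_lin D_def ..
  \<comment> \<open>the matrix of the differential of M h\<close>
  define R where "R k i = (\<Sum>l<p. M k l * D l i)" for k i
  have R: "(\<Sum>i<n. R k i * v i) = lin p p M (?T v) k" if "k < p" for k v
  proof -
    have "(\<Sum>i<n. R k i * v i) = (\<Sum>l<p. M k l * (\<Sum>i<n. D l i * v i))"
      unfolding R_def sum_distrib_left sum_distrib_right by (subst sum.swap) (simp add: mult.assoc)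
    also have "\<dots> = lin p p M (?T v) k" unfolding TD using that by (simp add: lin_def)
    finally show ?thesis .
  qed
  have Rinj: "v = 0" if v: "v \<in> Cn n" "\<And>k. k < p \<Longrightarrow> (\<Sum>i<n. R k i * v i) = 0" for v
  proof -
    have "lin p p M (?T v) k = 0" for k
      using v(2)[of k] R[of k v] by (cases "k < p") (auto simp: lin_def)
    then have "lin p p M (?T v) = 0" by (intro ext) simp
    then have "?T v = 0" by (rule Minj[OF differential_Cn])
    then show ?thesis by (rule inj[OF v(1)])
  qed
  obtain i0 where i0: "i0 < n" "R j0 i0 \<noteq> 0"
  proof -
    have "(\<Sum>i<n. R j0 i * w i) = 1" using R[OF j0(1), of w] Mw0[OF j0(1)] by (simp add: w0_def)
    then have "\<exists>i\<in>{..<n}. R j0 i * w i \<noteq> 0" using sum.neutral[of "{..<n}" "\<lambda>i. R j0 i * w i"] by force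
    then show ?thesis using that by auto
  qed
  obtain J where J: "J \<subseteq> {..<p}" "j0 \<in> J" "card J = n"
      "\<And>v. v \<in> Cn n \<Longrightarrow> (\<And>k. k \<in> J \<Longrightarrow> (\<Sum>i<n. R k i * v i) = 0) \<Longrightarrow> v = 0"
    using select_rows[of n p R, OF Rinj j0(1) i0] by metis
  obtain \<pi> where \<pi>: "\<pi> ` {..<n} = J" "\<pi> ` {..<p} = {..<p}" "\<pi> (n - 1) = j0" "inj_on \<pi> {..<p}"
      and n: "1 \<le> n" "n \<le> p"
    using enumerate_with_last[OF J(1,3,2)] by blast
  have \<pi>p: "\<pi> i < p" if "i < p" for i using \<pi>(2) that by blast
  have \<pi>j: "\<pi> i \<noteq> j0" if "i < p" "i \<noteq> n - 1" for i
  proof -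
    have "n - 1 < p" using n by linarith
    then show ?thesis using inj_onD[OF \<pi>(4), of i "n - 1"] \<pi>(3) that by auto
  qed
  \<comment> \<open>the matrix that selects the coordinates pi m, pi (m + 1), ...\<close>
  define P where "P m i l = (if l = \<pi> (m + i) then 1 else 0 :: complex)" for m i l
  have P: "lin p q (P m) y i = y (\<pi> (m + i))" if "i < q" "m + i < p" for q m y i
    using that \<pi>p[OF that(2)] by (simp add: lin_def P_def if_distrib[of "\<lambda>x. x * _"] cong: if_cong)
  define hM where "hM = lin p p M \<circ> h"
  have hM: "hol_germ n p hM" unfolding hM_def by (rule hol_germ_compose[OF h hol_germ_lin])
  define g where "g = lin p n (P 0) \<circ> hM"
  have g: "hol_germ n n g" unfolding g_def by (rule hol_germ_compose[OF hM hol_germ_lin])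
  have dg: "differential n n g 0 v = lin p n (P 0) (lin p p M (?T v))" if "v \<in> Cn n" for v
    unfolding g_def hM_def
    by (simp only: differential_compose[OF hol_germ_compose[OF h hol_germ_lin] hol_germ_lin that]
        differential_compose[OF h hol_germ_lin that] differential_lin[OF differential_Cn] differential_lin[OF lin_in_Cn])
  have "biholo_germ n g"
  proof (rule biholo_germ_inverse_function[OF g])
    fix v assume v: "v \<in> Cn n" "differential n n g 0 v = 0"
    then have z: "lin p n (P 0) (lin p p M (?T v)) = 0" by (simp only: dg)
    show "v = 0"
    proof (rule J(4)[OF v(1)])
      fix k assume k: "k \<in> J"
      then obtain i where i: "i < n" "k = \<pi> i" using \<pi>(1) by blast
      have "lin p p M (?T v) (\<pi> i) = 0"
        using fun_cong[OF z, of i] P[OF i(1), of 0] i(1) n by simp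
      moreover have "k < p" using k J(1) by blast
      ultimately show "(\<Sum>i<n. R k i * v i) = 0" using R i(2) by simp
    qed
  qed
  then obtain \<phi> where \<phi>: "hol_germ n n \<phi>" "germ_eq n (\<phi> \<circ> g) id" "germ_eq n (g \<circ> \<phi>) id"
    by (auto simp: biholo_germ_def)
  have \<phi>bi: "biholo_germ n \<phi>" unfolding biholo_germ_def using \<phi> g by blast
  \<comment> \<open>target coordinates: subtract the part of the quadratic invariant that the linear ones determine\<close>
  define \<psi> where "\<psi> y = (\<lambda>i. if i < p then if i = n - 1 then inverse \<kappa> * (y j0 - \<rho> y) else y (\<pi> i) else 0)" for y
  have \<psi>: "hol_germ p p \<psi>"
  proof -
    have "hol_germ p p (\<omega> \<circ> lin p p N')" by (rule hol_germ_compose[OF hol_germ_lin omega_germ])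
    then obtain e where e: "e > 0" "hol_map p p (cube p e) (\<omega> \<circ> lin p p N')"
      by (auto simp: hol_germ_iff)
    then have \<rho>: "hol_fun p (cube p e) \<rho>" using j0(1) by (simp add: hol_map_def \<rho>_def[abs_def] o_def)
    have "hol_map p p (cube p e) \<psi>"
      unfolding hol_map_def
    proof (intro conjI allI impI)
      show "\<psi> ` cube p e \<subseteq> Cn p" by (auto simp: \<psi>_def Cn_def)
      fix i assume "i < p"
      then show "hol_fun p (cube p e) (\<lambda>y. \<psi> y i)"
        by (cases "i = n - 1")
          (simp_all add: \<psi>_def hol_fun_coord hol_fun_mult hol_fun_const hol_fun_diff \<rho>)
    qed
    moreover have "\<psi> 0 = 0"
    proof
      have "\<rho> 0 = 0" unfolding \<rho>_def lin_zero omega_0 by (rule zero_fun_apply)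
      then show "\<psi> 0 i = 0 i" for i by (simp only: \<psi>_def zero_fun_apply) simp
    qed
    ultimately show ?thesis using e(1) by (auto simp: hol_germ_iff)
  qed
  have \<psi>bi: "biholo_germ p \<psi>"
  proof (rule biholo_germ_inverse_function[OF \<psi>])
    fix v assume v: "v \<in> Cn p" "differential p p \<psi> 0 v = 0"
    have jet: "jet2 (\<lambda>z. \<psi> (\<lambda>i. v i * z) i) 0 0 (der2 p (\<lambda>x. \<psi> x i) v v)" if "i < p" for i
      using jet2_germ_ray[OF \<psi> v(1) that] by (simp only: v(2) zero_fun_apply)
    have "v (\<pi> i) = 0" if i: "i < p" for i
    proof (cases "i = n - 1")
      case True
      have ray: "lin p p N' (\<lambda>i. v i * z) = cscale z (lin p p N' v)" for z
        using lin_scale[of p p N' z v] by (simp add: cscale_def mult.commute)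
      have eq: "\<psi> (\<lambda>i. v i * z) i = inverse \<kappa> * v j0 * z + (- inverse \<kappa> * \<rho> v) * z ^ 2" for z
        unfolding \<psi>_def \<rho>_def ray using True i omega_scale[OF j0(1) lin_in_Cn, of z]
        by (simp add: d2 algebra_simps)
      have "0 = inverse \<kappa> * v j0 + (if 2 = (1::nat) then - inverse \<kappa> * \<rho> v else 0)"
        using jet2_unique[OF jet[OF i, unfolded eq]
            jet2_add[OF jet2_linear[of "inverse \<kappa> * v j0"] jet2_monomial[of "- inverse \<kappa> * \<rho> v" 2]]]
        by blast
      then show ?thesis using \<kappa> True \<pi>(3) by simp
    next
      case False
      then have "\<psi> (\<lambda>i. v i * z) i = v (\<pi> i) * z" for z using i by (simp add: \<psi>_def)
      then show ?thesis using jet2_unique[OF jet[OF i]] jet2_linear[of "v (\<pi> i)"] by simp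
    qed
    then have "v k = 0" if "k < p" for k using \<pi>(2) that by (metis imageE lessThan_iff)
    then have "v k = 0" for k using v(1) by (cases "k < p") (auto simp: Cn_def)
    then show "v = 0" by (intro ext) simp
  qed
  define H where "H = lin p (p - n) (P n) \<circ> (hM \<circ> \<phi>)"
  define f' where "f' = (\<lambda>x i. if i < n - 1 then x i else if i = n - 1 then (x (n - 1))\<^sup>2 else H x (i - n))"
  have "fold_map n p f'"
    unfolding fold_map_def
  proof (intro conjI n exI[of _ H])
    show "hol_germ n (p - n) H"
      unfolding H_def by (intro hol_germ_compose[OF _ hol_germ_lin] hol_germ_compose[OF \<phi>(1) hM])
    show "germ_eq n f' (\<lambda>x i. if i < n - 1 then x i else if i = n - 1 then (x (n - 1))\<^sup>2 else H x (i - n))"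
      by (auto simp: f'_def germ_eq_iff intro!: exI[of _ 1])
  qed
  moreover have "germ_eq n f' (\<psi> \<circ> f \<circ> \<phi>)"
  proof -
    obtain e1 where e1: "e1 > 0" "\<And>x. x \<in> cube n e1 \<Longrightarrow> f x = \<omega> (h x)" using f by (auto simp: germ_eq_iff)
    obtain e2 where e2: "e2 > 0" "hol_map n p (cube n e2) h" using h by (auto simp: hol_germ_iff)
    have "min e1 e2 > 0" using e1 e2 by simp
    then obtain e3 where e3: "e3 > 0" "\<phi> ` cube n e3 \<subseteq> cube n (min e1 e2)"
      using hol_germ_bound[OF \<phi>(1)] by blast
    obtain e4 where e4: "e4 > 0" "\<And>x. x \<in> cube n e4 \<Longrightarrow> g (\<phi> x) = x" using \<phi>(3) by (auto simp: germ_eq_iff)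
    have "f' x = \<psi> (f (\<phi> x))" if x: "x \<in> cube n (min e3 e4)" for x
    proof
      fix i
      define X where "X = h (\<phi> x)"
      have "x \<in> cube n e3" and x4: "x \<in> cube n e4" using x by (auto simp: cube_def)
      then have "\<phi> x \<in> cube n (min e1 e2)" using e3 by blast
      then have "\<phi> x \<in> cube n e1" "\<phi> x \<in> cube n e2" by (auto simp: cube_def)
      then have fX: "f (\<phi> x) = \<omega> X" and XC: "X \<in> Cn p" using e1 e2 by (auto simp: X_def hol_map_def)
      have gx: "lin p p M X (\<pi> k) = x k" if k: "k < n" for k
      proof -
        have "g (\<phi> x) k = lin p p M X (\<pi> k)" using P[OF k, of 0] k n by (simp add: g_def hM_def X_def)
        then show ?thesis using e4(2)[OF x4] by simp
      qed
      consider "i < n - 1" | "i = n - 1" | "n \<le> i" "i < p" | "p \<le> i" by linarith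
      then show "f' x i = \<psi> (f (\<phi> x)) i"
      proof cases
        case 1
        then have "i < p" "i \<noteq> n - 1" "i < n" using n by auto
        then show ?thesis
          using 1 gx[of i] Mx[OF XC \<pi>p, of i] \<pi>j[of i] by (simp add: f'_def \<psi>_def fX)
      next
        case 2
        have "x (n - 1) = c X" using gx[of "n - 1"] Mx[OF XC j0(1)] \<pi>(3) n by simp
        moreover have "inverse \<kappa> * (\<omega> X j0 - \<rho> (\<omega> X)) = (c X)\<^sup>2"
          using normal[OF XC] \<kappa> by simp
        ultimately show ?thesis using 2 n by (simp add: f'_def \<psi>_def fX)
      next
        case 3
        then have "H x (i - n) = lin p p M X (\<pi> i)"
          using P[of "i - n" "p - n" n] n by (simp add: H_def hM_def X_def)
        moreover have "i \<noteq> n - 1" "\<not> i < n - 1" using 3 n by auto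
        ultimately show ?thesis
          using 3 Mx[OF XC \<pi>p, of i] \<pi>j[of i] by (simp add: f'_def \<psi>_def fX)
      next
        case 4
        then have "H x (i - n) = 0" using n by (simp add: H_def lin_def)
        moreover have "i \<noteq> n - 1" "\<not> i < n - 1" using 4 n by auto
        ultimately show ?thesis using 4 by (simp add: f'_def \<psi>_def)
      qed
    qed
    then show ?thesis using e3 e4 by (auto simp: germ_eq_iff intro!: exI[of _ "min e3 e4"])
  qed
  ultimately show ?thesis using \<phi>bi \<psi>bi by (auto simp: A_equiv_def A_equiv_via_def)
qed

end

section \<open>Stability and corank of reflection maps\<close>

text \<open>
  If all 2 x 2 minors vanish, then the second vector is a multiple of the first.
\<close>

lemma independent_pair_minor:
  assumes ind: "cvs.independent b" and b: "w1 \<in> b" "w2 \<in> b" "w1 \<noteq> w2"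
  shows "\<exists>k l. w1 k * w2 l - w1 l * w2 k \<noteq> 0"
proof (rule ccontr)
  assume *: "\<not> ?thesis"
  have "w1 \<noteq> 0" using ind b(1) cvs.dependent_zero by blast
  then obtain k where k: "w1 k \<noteq> 0" by (metis ext zero_fun_apply)
  have "w2 = cscale (w2 k / w1 k) w1"
  proof
    fix l show "w2 l = cscale (w2 k / w1 k) w1 l"
      using * k by (auto simp: cscale_def field_simps)
  qed
  moreover have "cscale (w2 k / w1 k) w1 \<in> cvs.span (b - {w2})"
    using b by (intro cvs.span_scale cvs.span_base) auto
  ultimately have "w2 \<in> cvs.span (b - {w2})" by simp
  then show False using ind b(2) cvs.dependent_def by blast
qed

text \<open>
  Two independent vectors in the kernel of the differential of f exclude stability; in corank one a
  single nonzero kernel vector and the hyperplane orthogonal to the common root line of the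
  reflections give the fold.
\<close>

theorem theorem8p5:
  fixes n p :: nat
    and B :: "cvec \<Rightarrow> cvec \<Rightarrow> complex"
    and G :: "(cvec \<Rightarrow> cvec) set"
    and f :: "cvec \<Rightarrow> cvec"
  assumes "reflection_map_germ n p B G f"
  shows "(corank n p f \<ge> 2 \<longrightarrow> \<not> stable_germ n p f) \<and>
         (essential n p B G f \<and> corank n p f = 1 \<and> stable_germ n p f \<longrightarrow>
            (\<exists>f'. fold_map n p f' \<and> A_equiv n p f f'))"
proof -
  obtain \<omega> h where B: "pos_def_form p B" and G: "reflection_group p B G"
    and \<omega>: "orbit_map p G \<omega>" and h: "embedding_germ n p h" and f: "germ_eq n f (\<omega> \<circ> h)"
    using assms by (auto simp: reflection_map_germ_def)
  obtain d where "basic_invariants p G \<omega> d" using basic_invariantsI[OF G \<omega>] by blast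
  then interpret basic_invariants p G \<omega> d .
  note hh = embedding_germD[OF h]
  let ?T = "differential n p h 0"
  define K where "K = {v \<in> Cn n. differential n p f 0 v = 0}"
  have K: "v \<in> Cn n \<and> ?T v \<in> omega_kernel" if "v \<in> K" for v
  proof -
    have v: "v \<in> Cn n" "differential n p f 0 v = 0" using that by (simp_all only: K_def) auto
    have "differential n p f 0 v = differential p p \<omega> 0 (?T v)"
      using differential_cong[OF f] differential_compose[OF hh(1) omega_germ v(1)] by simp
    then have "differential p p \<omega> 0 (?T v) = 0" using v(2) by (simp only:)
    then have "der1 p (\<lambda>x. \<omega> x j) (?T v) = 0" if "j < p" for j
      unfolding der1_differential[OF that] by (simp only: zero_fun_apply)
    then show ?thesis using v(1) differential_Cn by (simp add: omega_kernel_def)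
  qed
  obtain b where b: "b \<subseteq> K" "cvs.independent b" "card b = corank n p f"
  proof -
    have "corank n p f = cvs.dim K" by (simp only: corank_def K_def)
    then show ?thesis using that by (metis cvs.basis_exists)
  qed
  show ?thesis
  proof (intro conjI impI; (elim conjE)?)
    assume "corank n p f \<ge> 2"
    then obtain w1 w2 where w: "w1 \<in> b" "w2 \<in> b" "w1 \<noteq> w2"
      using b(3) by (metis One_nat_def Suc_1 card_le_Suc0_iff_eq card.infinite not_less_eq_eq zero_le)
    then obtain k l where "w1 k * w2 l - w1 l * w2 k \<noteq> 0"
      using independent_pair_minor[OF b(2)] by blast
    then show "\<not> stable_germ n p f"
      using two_kernel_directions_unstable[OF hh(1) f hh(2)] K w b(1) by blast
  next
    assume ess: "essential n p B G f" and one: "corank n p f = 1" and st: "stable_germ n p f"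
    obtain w where w: "b = {w}" using b(3) one by (auto simp: card_1_singleton_iff)
    have wK: "w \<in> K" using b(1) w by blast
    have "w \<noteq> 0" using b(2) w cvs.dependent_zero by blast
    have "refl_rank p B G = 1" using ess one by (simp add: essential_def)
    then obtain a where a: "a \<in> Cn p" "\<And>x g. x \<in> Cn p \<Longrightarrow> B x a = 0 \<Longrightarrow> g \<in> G \<Longrightarrow> g x = x"
      using rank_one_fixes_hyperplane[OF B G] by blast
    have Binv: "B (g x) (g y) = B x y" if "g \<in> G" "x \<in> Cn p" "y \<in> Cn p" for g x y
    proof -
      have "g \<in> carrier (unitary_group p B)"
        using G that(1) subgroup.subset unfolding reflection_group_def by blast
      then show ?thesis using that by (simp add: unitary_group_def)
    qed
    show "\<exists>f'. fold_map n p f' \<and> A_equiv n p f f'"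
    proof (rule stable_rank_one_fold[OF hh(1) f hh(2) st])
      show "w \<in> Cn n" "w \<noteq> 0" "?T w \<in> omega_kernel" using K[OF wK] \<open>w \<noteq> 0\<close> by auto
      show "B (x + y) a = B x a + B y a" if "x \<in> Cn p" "y \<in> Cn p" for x y
        by (rule pos_def_form_add[OF B that a(1)])
      show "B (cscale c x) a = c * B x a" if "x \<in> Cn p" for c x
        by (rule pos_def_form_scale[OF B that a(1)])
      show "g x = x" if "g \<in> G" "x \<in> Cn p" "B x a = 0" for g x
        by (rule a(2)[OF that(2,3,1)])
      show "x = 0" if "x \<in> omega_kernel" "B x a = 0" for x
      proof (rule fixed_kernel_vector_zero[OF B Binv _ that(1)])
        have "x \<in> Cn p" using that(1) by (simp add: omega_kernel_def)
        then show "g x = x" if "g \<in> G" for g by (rule a(2)[OF _ \<open>B x a = 0\<close> that])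
      qed
    qed
  qed
qed

end
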